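(* Let $H,G$ be finite algebras in $\mathsf{PHil_0}$. Then there exist families $\tau$ and $\kappa$ of subsets of $X(H^* )\prod_{\mathrm{PEs}}X(G^* )$ such that $$P:=\Bigl(X(H^* )\prod_{\mathrm{PEs}}X(G^* ),\ \tau,\ \kappa\Bigr)$$ is an object of $\mathsf{PHS_0}$ and $X(H)\prod_{\mathsf{PHS_0}}X(G)\cong P$ in $\mathsf{PHS_0}$. Here $\prod_{\mathrm{PEs}}$ and $\prod_{\mathsf{PHS_0}}$ denote the categorical products in the categories $\mathrm{PEs}$ and $\mathsf{PHS_0}$ respectively.
   Context: A Hilbert algebra is an algebra $(H,\to,1)$ of type $(2,0)$ such that for all $a,b,c\in H$: $a\to(b\to a)=1$; $(a\to(b\to c))\to((a\to b)\to(a\to c))=1$; and $a\to b=b\to a=1$ implies $a=b$. Its natural order is $a\le b$ iff $a\to b=1$. A Hilbert chain is a Hilbert algebra whose natural order is total; a prelinear Hilbert algebra is a member of the variety generated by the Hilbert chains. $\mathsf{PHil_0}$ is the category of bounded prelinear Hilbert algebras $(H,\to,1,0)$ ($0\le a$ for all $a$) and homomorphisms. An implicative filter of $H$ is a subset $F$ with $1\in F$ such that $a,a\to b\in F$ imply $b\in F$; it is irreducible if $F\ne H$ and $F=F_1\cap F_2$ with $F_i$ implicative filters implies $F=F_1$ or $F=F_2$. $X(H)$ is the set of irreducible implicative filters, ordered by inclusion; $\varphi_H(a)=\{P\in X(H):a\in P\}$. $X(H)$ is regarded as a Hilbert space with base $\kappa_H=\{\varphi_H(a)^c:a\in H\}$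 and the topology generated by it. $X(H)^+$ is the Heyting algebra of upsets of $(X(H),\subseteq)$, with $U\Rightarrow V=(U\cap V^c]^c$, where $(Y]$ denotes generated downset; $H^*$ is the Heyting subalgebra of $X(H)^+$ generated by $\varphi_H(H)$ (a prelinear Heyting algebra, i.e. it satisfies $(x\to y)\vee(y\to x)=1$). For a topological space $(X,\tau)$, $\mathrm{sat}(Y)=\bigcap\{U\in\tau:Y\subseteq U\}$ and $x\leq_d y$ iff $y\in\overline{\{x\}}$. A Hilbert space ($H$-space) is a triple $(X,\tau,\kappa)$ with $(X,\tau)$ sober and $\kappa$ a base of open compact sets such that $\mathrm{sat}(U\cap V^c)\in\kappa$ for all $U,V\in\kappa$. For $R\subseteq X_1\times X_2$, $R(x)=\{y:(x,y)\in R\}$ and $R^{-1}(U)=\{x:R(x)\cap U\neq\emptyset\}$. An $H$-functional relation from $(X_1,\tau_1,\kappa_1)$ to $(X_2,\tau_2,\kappa_2)$ is $R\subseteq X_1\times X_2$ with $R^{-1}(U)\in\kappa_1$ for $U\in\kappa_2$, $R(x)$ closed for all $x$, and such that $(x,y)\in R$ implies there is $z\in\overline{\{x\}}$ with $R(z)=\overline{\{y\}}$. A root system is a poset in which $[x)=\{y:x\le y\}$ is a chain for every $x$. $\mathsf{PHS_0}$ is the category whose objects are $H$-spaces $(X,\tau,\kappa)$ with $(X,\leq_d)$ a root system and $X\in\kappa$, and whose morphisms are $H$-functional relations with $R(x)\ne\emptyset$ for all $x$ (composition is composition of relations, the identity is $\leq_d$). $\mathrm{PEs}$ is the category of Esakia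 spaces whose underlying poset is a root system, with continuous p-morphisms (order-preserving $f$ with $f([x))=[f(x))$ for all $x$); it is dual to the category of prelinear Heyting algebras via $A\mapsto X(A)$, where for a Heyting algebra $A$, $X(A)$ is the Esakia space of prime filters (equivalently, irreducible implicative filters) ordered by inclusion. *)

theory Defs
  imports "HOL-Analysis.Analysis"
begin

section \<open>Hilbert algebras\<close>

record 'a hilbert =
  hcarrier :: "'a set"
  himp :: "'a \<Rightarrow> 'a \<Rightarrow> 'a"
  hone :: 'a

record 'a bhilbert = "'a hilbert" +
  hzero :: 'a

definition hilbert_algebra :: "('a, 'm) hilbert_scheme \<Rightarrow> bool" where
  "hilbert_algebra H \<longleftrightarrow>
     hone H \<in> hcarrier H \<and>
     (\<forall>a\<in>hcarrier H. \<forall>b\<in>hcarrier H. himp H a b \<in> hcarrier H) \<and>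
     (\<forall>a\<in>hcarrier H. \<forall>b\<in>hcarrier H. himp H a (himp H b a) = hone H) \<and>
     (\<forall>a\<in>hcarrier H. \<forall>b\<in>hcarrier H. \<forall>c\<in>hcarrier H.
        himp H (himp H a (himp H b c)) (himp H (himp H a b) (himp H a c)) = hone H) \<and>
     (\<forall>a\<in>hcarrier H. \<forall>b\<in>hcarrier H.
        himp H a b = hone H \<longrightarrow> himp H b a = hone H \<longrightarrow> a = b)"

definition hle :: "('a, 'm) hilbert_scheme \<Rightarrow> 'a \<Rightarrow> 'a \<Rightarrow> bool" where
  "hle H a b \<longleftrightarrow> himp H a b = hone H"

definition hilbert_chain :: "('a, 'm) hilbert_scheme \<Rightarrow> bool" where
  "hilbert_chain H \<longleftrightarrow> hilbert_algebra H \<and>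
     (\<forall>a\<in>hcarrier H. \<forall>b\<in>hcarrier H. hle H a b \<or> hle H b a)"

datatype hterm = HVar nat | HOne | HImp hterm hterm

primrec heval :: "('a, 'm) hilbert_scheme \<Rightarrow> (nat \<Rightarrow> 'a) \<Rightarrow> hterm \<Rightarrow> 'a" where
  "heval H v (HVar n) = v n"
| "heval H v HOne = hone H"
| "heval H v (HImp s t) = himp H (heval H v s) (heval H v t)"

definition satisfies_identity :: "('a, 'm) hilbert_scheme \<Rightarrow> hterm \<Rightarrow> hterm \<Rightarrow> bool" where
  "satisfies_identity H s t \<longleftrightarrow>
     (\<forall>v. range v \<subseteq> hcarrier H \<longrightarrow> heval H v s = heval H v t)"

text \<open>The variety generated by the Hilbert chains consists of the algebras satisfying every
  identity that holds in all Hilbert chains. It is enough to let the chains range over those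
  whose carrier is a set of natural numbers: an identity that fails in some chain fails in a
  countable subchain. The lemma \<open>satisfies_identity_all_chains\<close> below makes this precise.\<close>

definition prelinear_hilbert :: "('a, 'm) hilbert_scheme \<Rightarrow> bool" where
  "prelinear_hilbert H \<longleftrightarrow> hilbert_algebra H \<and>
     (\<forall>s t. (\<forall>C :: nat hilbert. hilbert_chain C \<longrightarrow> satisfies_identity C s t) \<longrightarrow>
        satisfies_identity H s t)"

instance hterm :: countable
  by countable_datatype

lemma heval_closed:
  assumes "hilbert_algebra H" "range v \<subseteq> hcarrier H"
  shows "heval H v t \<in> hcarrier H"
  using assms by (induction t) (auto simp: hilbert_algebra_def)

lemma satisfies_identity_all_chains:
  fixes C :: "('c, 'm) hilbert_scheme"
  assumes nat: "\<forall>D :: nat hilbert. hilbert_chain D \<longrightarrow> satisfies_identity D s t"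
    and C: "hilbert_chain C"
  shows "satisfies_identity C s t"
  unfolding satisfies_identity_def
proof (intro allI impI)
  fix v :: "nat \<Rightarrow> 'c"
  assume v: "range v \<subseteq> hcarrier C"
  define S where "S = range (heval C v)"
  define f where "f = to_nat_on S"
  define g where "g = inv_into S f"
  define D :: "nat hilbert" where
    "D = \<lparr>hcarrier = f ` S, himp = (\<lambda>m n. f (himp C (g m) (g n))), hone = f (hone C)\<rparr>"
  have alg: "hilbert_algebra C" using C by (simp add: hilbert_chain_def)
  have "countable S" by (simp add: S_def)
  then have inj: "inj_on f S" unfolding f_def by (rule inj_on_to_nat_on)
  then have gf [simp]: "g (f x) = x" if "x \<in> S" for x
    using that by (simp add: g_def)
  have f_eq [simp]: "f x = f y \<longleftrightarrow> x = y" if "x \<in> S" "y \<in> S" for x y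
    using inj that by (auto dest: inj_onD)
  have S_sub: "S \<subseteq> hcarrier C" using heval_closed[OF alg v] by (auto simp: S_def)
  have ev_in: "heval C v u \<in> S" for u by (simp add: S_def)
  have one [simp]: "hone C \<in> S" using ev_in[of HOne] by simp
  have imp [simp]: "himp C x y \<in> S" if xy: "x \<in> S" "y \<in> S" for x y
  proof -
    obtain p q where "x = heval C v p" "y = heval C v q" using xy unfolding S_def by blast
    then show ?thesis using ev_in[of "HImp p q"] by simp
  qed
  have sel [simp]: "hcarrier D = f ` S" "hone D = f (hone C)"
    "himp D m n = f (himp C (g m) (g n))" for m n by (simp_all add: D_def)
  have chain: "himp C a b = hone C \<or> himp C b a = hone C" if "a \<in> S" "b \<in> S" for a b
    using that C S_sub by (auto simp: hilbert_chain_def hle_def)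
  have subalg: "a \<in> hcarrier C" if "a \<in> S" for a using that S_sub by blast
  have "hilbert_algebra D"
    unfolding hilbert_algebra_def
  proof (intro conjI ballI impI)
    fix m n assume "m \<in> hcarrier D" "n \<in> hcarrier D"
    then obtain a b where ab: "a \<in> S" "b \<in> S" and mn: "m = f a" "n = f b" by auto
    show "himp D m n \<in> hcarrier D" using ab mn by simp
    show "himp D m (himp D n m) = hone D"
      using ab mn alg subalg by (simp add: hilbert_algebra_def)
    show "m = n" if "himp D m n = hone D" "himp D n m = hone D"
    proof -
      have "himp C a b = hone C" "himp C b a = hone C" using that ab mn by simp_all
      then show ?thesis using ab mn alg subalg unfolding hilbert_algebra_def by metis
    qed
    fix k assume "k \<in> hcarrier D"
    then obtain c where "c \<in> S" "k = f c" by auto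
    then show "himp D (himp D m (himp D n k)) (himp D (himp D m n) (himp D m k)) = hone D"
      using ab mn alg subalg by (simp add: hilbert_algebra_def)
  qed (simp add: imageI)
  moreover have "hle D m n \<or> hle D n m" if mn: "m \<in> hcarrier D" "n \<in> hcarrier D" for m n
  proof -
    obtain a b where "a \<in> S" "b \<in> S" "m = f a" "n = f b" using mn by auto
    then show ?thesis using chain[of a b] by (simp add: hle_def)
  qed
  ultimately have sat: "satisfies_identity D s t"
    using nat by (simp add: hilbert_chain_def)
  have vS: "v n \<in> S" for n using ev_in[of "HVar n"] by simp
  have ev: "heval D (f \<circ> v) u = f (heval C v u)" for u
    by (induction u) (simp_all add: ev_in)
  have "range (f \<circ> v) \<subseteq> hcarrier D" using vS by (auto simp: image_subset_iff)
  then have "heval D (f \<circ> v) s = heval D (f \<circ> v) t"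
    using sat by (simp only: satisfies_identity_def)
  then have "f (heval C v s) = f (heval C v t)" by (simp only: ev)
  then show "heval C v s = heval C v t"
    by (simp add: ev_in)
qed

definition PHil0_obj :: "'a bhilbert \<Rightarrow> bool" where
  "PHil0_obj H \<longleftrightarrow> prelinear_hilbert H \<and>
     hzero H \<in> hcarrier H \<and> (\<forall>a\<in>hcarrier H. hle H (hzero H) a)"

definition implicative_filter :: "('a, 'm) hilbert_scheme \<Rightarrow> 'a set \<Rightarrow> bool" where
  "implicative_filter H F \<longleftrightarrow> F \<subseteq> hcarrier H \<and> hone H \<in> F \<and>
     (\<forall>a\<in>hcarrier H. \<forall>b\<in>hcarrier H. a \<in> F \<longrightarrow> himp H a b \<in> F \<longrightarrow> b \<in> F)"

definition irreducible_filters :: "('a, 'm) hilbert_scheme \<Rightarrow> 'a set set" where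
  "irreducible_filters H = {F. implicative_filter H F \<and> F \<noteq> hcarrier H \<and>
     (\<forall>F1 F2. implicative_filter H F1 \<longrightarrow> implicative_filter H F2 \<longrightarrow> F = F1 \<inter> F2 \<longrightarrow>
        F = F1 \<or> F = F2)}"

definition hphi :: "('a, 'm) hilbert_scheme \<Rightarrow> 'a \<Rightarrow> 'a set set" where
  "hphi H a = {P \<in> irreducible_filters H. a \<in> P}"


section \<open>Hilbert spaces and the category of PHS0-spaces\<close>

definition inclusion_on :: "'a set set \<Rightarrow> ('a set) rel" where
  "inclusion_on S = {(P, Q). P \<in> S \<and> Q \<in> S \<and> P \<subseteq> Q}"

definition root_system :: "'a set \<Rightarrow> 'a rel \<Rightarrow> bool" where
  "root_system A r \<longleftrightarrow> partial_order_on A r \<and> (\<forall>x\<in>A. total_on (r `` {x}) r)"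

definition irreducible_closedin :: "'a topology \<Rightarrow> 'a set \<Rightarrow> bool" where
  "irreducible_closedin X C \<longleftrightarrow> closedin X C \<and> C \<noteq> {} \<and>
     (\<forall>C1 C2. closedin X C1 \<longrightarrow> closedin X C2 \<longrightarrow> C = C1 \<union> C2 \<longrightarrow> C = C1 \<or> C = C2)"

definition sober_space :: "'a topology \<Rightarrow> bool" where
  "sober_space X \<longleftrightarrow>
     (\<forall>C. irreducible_closedin X C \<longrightarrow> (\<exists>!x. x \<in> topspace X \<and> X closure_of {x} = C))"

definition sat :: "'a topology \<Rightarrow> 'a set \<Rightarrow> 'a set" where
  "sat X Y = \<Inter>{U. openin X U \<and> Y \<subseteq> U}"

definition dual_specialization :: "'a topology \<Rightarrow> 'a rel" where
  "dual_specialization X = {(x, y). x \<in> topspace X \<and> y \<in> X closure_of {x}}"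

record 'a hspace =
  hs_top :: "'a topology"
  hs_base :: "'a set set"

abbreviation hs_points :: "'a hspace \<Rightarrow> 'a set" where
  "hs_points S \<equiv> topspace (hs_top S)"

definition H_space :: "'a hspace \<Rightarrow> bool" where
  "H_space S \<longleftrightarrow> sober_space (hs_top S) \<and>
     openin (hs_top S) = arbitrary union_of (\<lambda>U. U \<in> hs_base S) \<and>
     (\<forall>U\<in>hs_base S. compactin (hs_top S) U) \<and>
     (\<forall>U\<in>hs_base S. \<forall>V\<in>hs_base S.
        sat (hs_top S) (U \<inter> (hs_points S - V)) \<in> hs_base S)"

definition H_functional_relation :: "'a hspace \<Rightarrow> 'b hspace \<Rightarrow> ('a \<times> 'b) set \<Rightarrow> bool" where
  "H_functional_relation S1 S2 R \<longleftrightarrow>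
     R \<subseteq> hs_points S1 \<times> hs_points S2 \<and>
     (\<forall>U\<in>hs_base S2. R\<inverse> `` U \<in> hs_base S1) \<and>
     (\<forall>x\<in>hs_points S1. closedin (hs_top S2) (R `` {x})) \<and>
     (\<forall>(x, y)\<in>R. \<exists>z \<in> hs_top S1 closure_of {x}. R `` {z} = hs_top S2 closure_of {y})"

definition PHS0_obj :: "'a hspace \<Rightarrow> bool" where
  "PHS0_obj S \<longleftrightarrow> H_space S \<and>
     root_system (hs_points S) (dual_specialization (hs_top S)) \<and> hs_points S \<in> hs_base S"

definition PHS0_hom :: "'a hspace \<Rightarrow> 'b hspace \<Rightarrow> ('a \<times> 'b) set set" where
  "PHS0_hom S1 S2 =
     {R. H_functional_relation S1 S2 R \<and> (\<forall>x\<in>hs_points S1. R `` {x} \<noteq> {})}"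

text \<open>Composition in this category is relational composition: the composite of \<open>R\<close> followed by
  \<open>S\<close> is \<^term>\<open>R O S\<close>. The identity of \<open>S\<close> is \<open>dual_specialization (hs_top S)\<close>.\<close>

definition PHS0_isomorphic :: "'a hspace \<Rightarrow> 'b hspace \<Rightarrow> bool" where
  "PHS0_isomorphic S1 S2 \<longleftrightarrow> PHS0_obj S1 \<and> PHS0_obj S2 \<and>
     (\<exists>R\<in>PHS0_hom S1 S2. \<exists>R'\<in>PHS0_hom S2 S1.
        R O R' = dual_specialization (hs_top S1) \<and> R' O R = dual_specialization (hs_top S2))"

text \<open>HOL cannot quantify over types inside a formula, so the category is taken over a universe
  \<open>'q\<close>: the candidate product and all test objects have their points in \<open>'q\<close>. The factors may live
  in other types. For finite factors the product is finite, so any infinite \<open>'q\<close> contains a copy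
  of it and the universal property below determines it up to isomorphism; a finite \<open>'q\<close> may be
  too small.\<close>

definition PHS0_product ::
  "'q hspace \<Rightarrow> ('q \<times> 'a) set \<Rightarrow> ('q \<times> 'b) set \<Rightarrow> 'a hspace \<Rightarrow> 'b hspace \<Rightarrow> bool" where
  "PHS0_product Q R1 R2 S1 S2 \<longleftrightarrow>
     PHS0_obj S1 \<and> PHS0_obj S2 \<and> PHS0_obj Q \<and>
     R1 \<in> PHS0_hom Q S1 \<and> R2 \<in> PHS0_hom Q S2 \<and>
     (\<forall>(T :: 'q hspace) F1 F2.
        PHS0_obj T \<longrightarrow> F1 \<in> PHS0_hom T S1 \<longrightarrow> F2 \<in> PHS0_hom T S2 \<longrightarrow>
        (\<exists>!M. M \<in> PHS0_hom T Q \<and> M O R1 = F1 \<and> M O R2 = F2))"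

definition X_hilbert :: "('a, 'm) hilbert_scheme \<Rightarrow> ('a set) hspace" where
  "X_hilbert H =
     (let \<kappa> = {irreducible_filters H - hphi H a | a. a \<in> hcarrier H}
      in \<lparr>hs_top = topology_generated_by \<kappa>, hs_base = \<kappa>\<rparr>)"


section \<open>Heyting algebras and Esakia spaces\<close>

record 'a heyting =
  hey_carrier :: "'a set"
  hey_meet :: "'a \<Rightarrow> 'a \<Rightarrow> 'a"
  hey_join :: "'a \<Rightarrow> 'a \<Rightarrow> 'a"
  hey_imp :: "'a \<Rightarrow> 'a \<Rightarrow> 'a"
  hey_bot :: 'a
  hey_top :: 'a

definition upset_imp :: "'a set \<Rightarrow> 'a rel \<Rightarrow> 'a set \<Rightarrow> 'a set \<Rightarrow> 'a set" where
  "upset_imp A r U V = A - r\<inverse> `` (U \<inter> (A - V))"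

inductive_set heyting_generated :: "('a, 'm) hilbert_scheme \<Rightarrow> 'a set set set"
  for H :: "('a, 'm) hilbert_scheme" where
  gen: "a \<in> hcarrier H \<Longrightarrow> hphi H a \<in> heyting_generated H"
| bot: "{} \<in> heyting_generated H"
| top: "irreducible_filters H \<in> heyting_generated H"
| meet: "U \<in> heyting_generated H \<Longrightarrow> V \<in> heyting_generated H \<Longrightarrow> U \<inter> V \<in> heyting_generated H"
| join: "U \<in> heyting_generated H \<Longrightarrow> V \<in> heyting_generated H \<Longrightarrow> U \<union> V \<in> heyting_generated H"
| imp: "U \<in> heyting_generated H \<Longrightarrow> V \<in> heyting_generated H \<Longrightarrow>
     upset_imp (irreducible_filters H) (inclusion_on (irreducible_filters H)) U V
       \<in> heyting_generated H"

definition star :: "('a, 'm) hilbert_scheme \<Rightarrow> ('a set set) heyting" where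
  "star H =
     \<lparr>hey_carrier = heyting_generated H,
      hey_meet = (\<inter>),
      hey_join = (\<union>),
      hey_imp = upset_imp (irreducible_filters H) (inclusion_on (irreducible_filters H)),
      hey_bot = {},
      hey_top = irreducible_filters H\<rparr>"

definition hey_le :: "'a heyting \<Rightarrow> 'a \<Rightarrow> 'a \<Rightarrow> bool" where
  "hey_le A a b \<longleftrightarrow> hey_meet A a b = a"

definition prime_filters :: "'a heyting \<Rightarrow> 'a set set" where
  "prime_filters A = {F. F \<subseteq> hey_carrier A \<and> F \<noteq> hey_carrier A \<and> hey_top A \<in> F \<and>
     (\<forall>a\<in>F. \<forall>b\<in>hey_carrier A. hey_le A a b \<longrightarrow> b \<in> F) \<and>
     (\<forall>a\<in>F. \<forall>b\<in>F. hey_meet A a b \<in> F) \<and>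
     (\<forall>a\<in>hey_carrier A. \<forall>b\<in>hey_carrier A. hey_join A a b \<in> F \<longrightarrow> a \<in> F \<or> b \<in> F)}"

definition pphi :: "'a heyting \<Rightarrow> 'a \<Rightarrow> 'a set set" where
  "pphi A a = {P \<in> prime_filters A. a \<in> P}"

record 'a ordspace =
  os_top :: "'a topology"
  os_ord :: "'a rel"

abbreviation os_points :: "'a ordspace \<Rightarrow> 'a set" where
  "os_points E \<equiv> topspace (os_top E)"

definition clopenin :: "'a topology \<Rightarrow> 'a set \<Rightarrow> bool" where
  "clopenin X U \<longleftrightarrow> openin X U \<and> closedin X U"

definition esakia_space :: "'a ordspace \<Rightarrow> bool" where
  "esakia_space E \<longleftrightarrow> compact_space (os_top E) \<and> partial_order_on (os_points E) (os_ord E) \<and>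
     (\<forall>x\<in>os_points E. \<forall>y\<in>os_points E. (x, y) \<notin> os_ord E \<longrightarrow>
        (\<exists>U. clopenin (os_top E) U \<and> os_ord E `` U \<subseteq> U \<and> x \<in> U \<and> y \<notin> U)) \<and>
     (\<forall>U. clopenin (os_top E) U \<longrightarrow> clopenin (os_top E) ((os_ord E)\<inverse> `` U))"

definition PEs_obj :: "'a ordspace \<Rightarrow> bool" where
  "PEs_obj E \<longleftrightarrow> esakia_space E \<and> root_system (os_points E) (os_ord E)"

text \<open>Morphisms are extensional functions, so that equality of morphisms is equality on the
  points of the domain. Composition is \<^const>\<open>compose\<close> on the points of the domain.\<close>

definition PEs_hom :: "'a ordspace \<Rightarrow> 'b ordspace \<Rightarrow> ('a \<Rightarrow> 'b) set" where
  "PEs_hom E1 E2 = {f \<in> extensional (os_points E1).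
     continuous_map (os_top E1) (os_top E2) f \<and>
     (\<forall>(x, y)\<in>os_ord E1. (f x, f y) \<in> os_ord E2) \<and>
     (\<forall>x\<in>os_points E1. f ` (os_ord E1 `` {x}) = os_ord E2 `` {f x})}"

text \<open>As for \<^const>\<open>PHS0_product\<close>, the candidate product and all test objects have their points
  in the universe \<open>'p\<close>.\<close>

definition PEs_product ::
  "'p ordspace \<Rightarrow> ('p \<Rightarrow> 'a) \<Rightarrow> ('p \<Rightarrow> 'b) \<Rightarrow> 'a ordspace \<Rightarrow> 'b ordspace \<Rightarrow> bool" where
  "PEs_product E p1 p2 E1 E2 \<longleftrightarrow>
     PEs_obj E1 \<and> PEs_obj E2 \<and> PEs_obj E \<and>
     p1 \<in> PEs_hom E E1 \<and> p2 \<in> PEs_hom E E2 \<and>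
     (\<forall>(T :: 'p ordspace) f1 f2.
        PEs_obj T \<longrightarrow> f1 \<in> PEs_hom T E1 \<longrightarrow> f2 \<in> PEs_hom T E2 \<longrightarrow>
        (\<exists>!h. h \<in> PEs_hom T E \<and>
           compose (os_points T) p1 h = f1 \<and> compose (os_points T) p2 h = f2))"

definition X_heyting :: "'a heyting \<Rightarrow> ('a set) ordspace" where
  "X_heyting A =
     \<lparr>os_top = topology_generated_by
        ({pphi A a | a. a \<in> hey_carrier A} \<union>
         {prime_filters A - pphi A a | a. a \<in> hey_carrier A}),
      os_ord = inclusion_on (prime_filters A)\<rparr>"

end

theory Submission
  imports Defs
begin

text \<open>
  Both products are built on one poset, which can be described explicitly. Let \<open>A\<close> and \<open>B\<close> be finite
  root systems. A pair of p-morphisms from a root system to \<open>A\<close> and \<open>B\<close> sends the chain above a point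
  \<open>t\<close> to a chain in \<open>A \<times> B\<close> whose projections are upsets, and this chain, called a staircase here,
  records all that the pair says about \<open>t\<close>. The staircases, ordered by prolongation downwards, form a
  finite root system, the coordinates of the least point of a staircase are p-morphisms to \<open>A\<close> and \<open>B\<close>,
  and every pair of p-morphisms factors uniquely through them (\<open>lift\<close>, \<open>lift_p_morphism\<close>,
  \<open>lift_unique\<close>).

  With the discrete topology the staircases are therefore the product of finite Esakia root systems;
  only the continuity of the lift has to be checked (\<open>staircase_PEs_product\<close>).

  In the category of Hilbert spaces over root systems, a morphism \<open>R\<close> is determined by a p-morphism \<open>f\<close>
  under which inverse images of basic sets are basic, because each \<open>R(x)\<close> is an irreducible closed set
  and has a generic point \<open>f x\<close> (\<open>PHS0_homD\<close>). So the staircases are again the product, provided that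
  they carry a suitable base. The least family of downsets that makes the projections morphisms and is
  closed under \<open>(U \<inter> V\<^sup>c]\<close> satisfies the universal property because inverse images under p-morphisms
  preserve this operation (\<open>p_morphism_vimage_downset\<close>), and the point is that it is a base of the
  topology of all downsets. This follows from a general fact about finite root systems, that a
  separating family of downsets that contains the whole root system and is closed under this
  operation contains all principal downsets (\<open>principal_downset_in_base\<close>), and from the fact that
  this family separates staircases (\<open>product_base_separates\<close>).

  Finally, for a finite algebra \<open>H\<close> the Heyting algebra \<open>star H\<close> consists of all upsets of the
  spectrum of \<open>H\<close>, so that the prime spectrum of \<open>star H\<close> is isomorphic to the spectrum of \<open>H\<close> as a poset
  (\<open>evaluation_iso\<close>). Hence the two products have isomorphic posets of staircases, and
  the structure of one of them can be carried over to the points of the other (\<open>PHS0_transport\<close>).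
  Prelinearity makes the spectrum of \<open>H\<close> a root system (\<open>irreducible_filters_root_system\<close>).
\<close>

section \<open>Finite posets and p-morphisms\<close>

lemma partial_order_onD:
  assumes "partial_order_on A r"
  shows "r \<subseteq> A \<times> A" "\<And>x. x \<in> A \<Longrightarrow> (x, x) \<in> r"
    "\<And>x y z. (x, y) \<in> r \<Longrightarrow> (y, z) \<in> r \<Longrightarrow> (x, z) \<in> r"
    "\<And>x y. (x, y) \<in> r \<Longrightarrow> (y, x) \<in> r \<Longrightarrow> x = y"
  using assms by (auto simp: order_on_defs refl_on_def antisym_def elim: transE)

lemma partial_order_onI:
  assumes "r \<subseteq> A \<times> A" "\<And>x. x \<in> A \<Longrightarrow> (x, x) \<in> r"
    "\<And>x y z. (x, y) \<in> r \<Longrightarrow> (y, z) \<in> r \<Longrightarrow> (x, z) \<in> r"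
    "\<And>x y. (x, y) \<in> r \<Longrightarrow> (y, x) \<in> r \<Longrightarrow> x = y"
  shows "partial_order_on A r"
  using assms unfolding order_on_defs refl_on_def antisym_def trans_def by blast

lemma finite_maximal_above:
  assumes po: "partial_order_on A r" and "finite C" "C \<subseteq> A" "x \<in> C"
  shows "\<exists>m\<in>C. (x, m) \<in> r \<and> (\<forall>y\<in>C. (m, y) \<in> r \<longrightarrow> y = m)"
  using assms(2-)
proof (induction "card {y \<in> C. (x, y) \<in> r}" arbitrary: x rule: less_induct)
  case less
  note po = partial_order_onD[OF po]
  show ?case
  proof (cases "\<forall>y\<in>C. (x, y) \<in> r \<longrightarrow> y = x")
    case True
    then show ?thesis using less.prems po(2) by blast
  next
    case False
    then obtain y where y: "y \<in> C" "(x, y) \<in> r" "y \<noteq> x" by blast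
    have "{z \<in> C. (y, z) \<in> r} \<subset> {z \<in> C. (x, z) \<in> r}"
      using y less.prems po by blast
    then have "card {z \<in> C. (y, z) \<in> r} < card {z \<in> C. (x, z) \<in> r}"
      using less.prems by (intro psubset_card_mono) auto
    then obtain m where "m \<in> C" "(y, m) \<in> r" "\<forall>z\<in>C. (m, z) \<in> r \<longrightarrow> z = m"
      using less.hyps less.prems y by blast
    then show ?thesis using y po(3) by blast
  qed
qed

lemma finite_chain_greatest:
  assumes po: "partial_order_on A r" and C: "finite C" "C \<subseteq> A" "C \<noteq> {}"
    and chain: "\<And>x y. x \<in> C \<Longrightarrow> y \<in> C \<Longrightarrow> (x, y) \<in> r \<or> (y, x) \<in> r"
  shows "\<exists>m\<in>C. \<forall>c\<in>C. (c, m) \<in> r"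
proof -
  obtain x where "x \<in> C" using C by blast
  then obtain m where "m \<in> C" "\<forall>y\<in>C. (m, y) \<in> r \<longrightarrow> y = m"
    using finite_maximal_above[OF po C(1,2)] by blast
  then show ?thesis using chain po by (metis partial_order_onD(2) C(2) subsetD)
qed

lemma finite_chain_least:
  assumes po: "partial_order_on A r" and C: "finite C" "C \<subseteq> A" "C \<noteq> {}"
    and chain: "\<And>x y. x \<in> C \<Longrightarrow> y \<in> C \<Longrightarrow> (x, y) \<in> r \<or> (y, x) \<in> r"
  shows "\<exists>m\<in>C. \<forall>c\<in>C. (m, c) \<in> r"
  using finite_chain_greatest[of A "r\<inverse>" C] assms by (auto simp: partial_order_on_converse)

lemma root_systemD:
  assumes "root_system A r"
  shows "partial_order_on A r"
    "\<And>x y z. (x, y) \<in> r \<Longrightarrow> (x, z) \<in> r \<Longrightarrow> (y, z) \<in> r \<or> (z, y) \<in> r"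
proof -
  show po: "partial_order_on A r" using assms by (simp add: root_system_def)
  fix x y z assume yz: "(x, y) \<in> r" "(x, z) \<in> r"
  then have "x \<in> A" "y \<in> A" using partial_order_onD(1)[OF po] by auto
  then have "total_on (r `` {x}) r" using assms by (simp add: root_system_def)
  then show "(y, z) \<in> r \<or> (z, y) \<in> r"
    using yz partial_order_onD(2)[OF po \<open>y \<in> A\<close>] by (cases "y = z") (auto simp: total_on_def)
qed

lemma root_systemI:
  assumes "partial_order_on A r"
    "\<And>x y z. (x, y) \<in> r \<Longrightarrow> (x, z) \<in> r \<Longrightarrow> (y, z) \<in> r \<or> (z, y) \<in> r"
  shows "root_system A r"
proof -
  have "total_on (r `` {x}) r" for x
    using assms(2) by (auto simp: total_on_def)
  then show ?thesis using assms(1) by (simp add: root_system_def)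
qed

definition p_morphism :: "'a set \<Rightarrow> 'a rel \<Rightarrow> 'b set \<Rightarrow> 'b rel \<Rightarrow> ('a \<Rightarrow> 'b) \<Rightarrow> bool" where
  "p_morphism A r B s f \<longleftrightarrow> f ` A \<subseteq> B \<and> (\<forall>x\<in>A. f ` (r `` {x}) = s `` {f x})"

lemma p_morphismD:
  assumes "p_morphism A r B s f" "x \<in> A"
  shows "f x \<in> B" "f ` (r `` {x}) = s `` {f x}" "(x, y) \<in> r \<Longrightarrow> (f x, f y) \<in> s"
    "(f x, z) \<in> s \<Longrightarrow> \<exists>y. (x, y) \<in> r \<and> f y = z"
proof -
  show "f x \<in> B" and eq: "f ` (r `` {x}) = s `` {f x}"
    using assms unfolding p_morphism_def by auto
  show "(f x, f y) \<in> s" if "(x, y) \<in> r" using imageI[of y "r `` {x}" f] that eq by simp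
  show "\<exists>y. (x, y) \<in> r \<and> f y = z" if "(f x, z) \<in> s"
  proof -
    have "z \<in> f ` (r `` {x})" using that eq by simp
    then show ?thesis by blast
  qed
qed

lemma p_morphism_cong:
  assumes "q \<subseteq> S \<times> S" "\<And>x. x \<in> S \<Longrightarrow> f x = g x"
  shows "p_morphism S q D t f \<longleftrightarrow> p_morphism S q D t g"
proof -
  have "f ` (q `` {x}) = g ` (q `` {x})" for x
    using assms by (intro image_cong) auto
  then show ?thesis using assms(2) unfolding p_morphism_def by (auto simp: image_subset_iff)
qed

lemma p_morphism_compose:
  assumes f: "p_morphism A r B s f" and g: "p_morphism B s C t g"
  shows "p_morphism A r C t (g \<circ> f)"
proof -
  have "(g \<circ> f) ` (r `` {x}) = t `` {(g \<circ> f) x}" if "x \<in> A" for x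
    using p_morphismD(2)[OF f that] p_morphismD(2)[OF g p_morphismD(1)[OF f that]]
    by (metis image_comp comp_apply)
  then show ?thesis using f g unfolding p_morphism_def by (auto simp: image_subset_iff)
qed

text \<open>Taking inverse images under a p-morphism commutes with taking downsets. This is why the
  operation \<open>(U \<inter> V\<^sup>c]\<close> on families of downsets is preserved by inverse images.\<close>

lemma p_morphism_vimage_downset:
  assumes f: "p_morphism A r B s f" and r: "r \<subseteq> A \<times> A"
  shows "{x \<in> A. f x \<in> s\<inverse> `` U} = r\<inverse> `` {x \<in> A. f x \<in> U}"
proof (intro equalityI subsetI)
  fix x assume "x \<in> {x \<in> A. f x \<in> s\<inverse> `` U}"
  then obtain u where u: "x \<in> A" "(f x, u) \<in> s" "u \<in> U" by blast
  then obtain y where "(x, y) \<in> r" "f y = u" using p_morphismD(4)[OF f] by blast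
  then show "x \<in> r\<inverse> `` {x \<in> A. f x \<in> U}" using u r by blast
next
  fix x assume "x \<in> r\<inverse> `` {x \<in> A. f x \<in> U}"
  then obtain y where "(x, y) \<in> r" "f y \<in> U" by blast
  then show "x \<in> {x \<in> A. f x \<in> s\<inverse> `` U}"
    using p_morphismD(3)[OF f, of x y] r by blast
qed


section \<open>Staircases\<close>

definition prod_ord :: "'a rel \<Rightarrow> 'b rel \<Rightarrow> ('a \<times> 'b) rel" where
  "prod_ord r s = {((a, b), (a', b')). (a, a') \<in> r \<and> (b, b') \<in> s}"

lemma prod_ord_iff:
  "(c, d) \<in> prod_ord r s \<longleftrightarrow> (fst c, fst d) \<in> r \<and> (snd c, snd d) \<in> s"
  by (auto simp: prod_ord_def)

lemma partial_order_on_prod_ord: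
  assumes "partial_order_on A r" "partial_order_on B s"
  shows "partial_order_on (A \<times> B) (prod_ord r s)"
proof (rule partial_order_onI)
  note r = partial_order_onD[OF assms(1)] and s = partial_order_onD[OF assms(2)]
  show "prod_ord r s \<subseteq> (A \<times> B) \<times> (A \<times> B)" using r(1) s(1) by (auto simp: prod_ord_def)
  show "(x, x) \<in> prod_ord r s" if "x \<in> A \<times> B" for x
    using that r(2) s(2) by (auto simp: prod_ord_def)
  show "(x, z) \<in> prod_ord r s" if "(x, y) \<in> prod_ord r s" "(y, z) \<in> prod_ord r s" for x y z
    using that r(3) s(3) unfolding prod_ord_iff by blast
  show "x = y" if "(x, y) \<in> prod_ord r s" "(y, x) \<in> prod_ord r s" for x y
    using that r(4) s(4) unfolding prod_ord_iff by (metis prod_eqI)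
qed

text \<open>A staircase is a path that descends through the product of two posets and whose projections
  leave out nothing above their least points. Staircases are the possible shapes of the image
  \<open>{(f\<^sub>1 u, f\<^sub>2 u) | u. t \<le> u}\<close> of a pair of p-morphisms that start at a root system.\<close>

definition staircases :: "'a rel \<Rightarrow> 'b rel \<Rightarrow> 'a set \<Rightarrow> 'b set \<Rightarrow> ('a \<times> 'b) set set" where
  "staircases r s A B = {C. C \<noteq> {} \<and> C \<subseteq> A \<times> B \<and>
     (\<forall>c\<in>C. \<forall>d\<in>C. (c, d) \<in> prod_ord r s \<or> (d, c) \<in> prod_ord r s) \<and>
     r `` (fst ` C) \<subseteq> fst ` C \<and> s `` (snd ` C) \<subseteq> snd ` C}"

text \<open>The points of the product are indexed by \<open>st\<close> rather than being staircases, so that they can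
  live in any type with enough elements. The order makes a staircase smaller when it is prolonged
  downwards.\<close>

locale staircase_poset =
  fixes A :: "'a set" and r :: "'a rel" and B :: "'b set" and s :: "'b rel"
    and P :: "'w set" and st :: "'w \<Rightarrow> ('a \<times> 'b) set"
  assumes finite_factors: "finite A" "finite B"
    and factors: "partial_order_on A r" "partial_order_on B s"
    and st_bij: "bij_betw st P (staircases r s A B)"
begin

abbreviation le :: "'a \<times> 'b \<Rightarrow> 'a \<times> 'b \<Rightarrow> bool" (infix "\<preceq>" 50) where
  "c \<preceq> d \<equiv> (c, d) \<in> prod_ord r s"

definition leq :: "'w rel" where
  "leq = {(v, w). v \<in> P \<and> w \<in> P \<and> st w \<subseteq> st v \<and> (\<forall>d\<in>st w. \<forall>c\<in>st v. d \<preceq> c \<longrightarrow> c \<in> st w)}"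

definition foot :: "'w \<Rightarrow> 'a \<times> 'b" where
  "foot w = (SOME m. m \<in> st w \<and> (\<forall>c\<in>st w. m \<preceq> c))"

definition proj1 :: "'w \<Rightarrow> 'a" where "proj1 w = fst (foot w)"
definition proj2 :: "'w \<Rightarrow> 'b" where "proj2 w = snd (foot w)"

lemmas le_order = partial_order_onD[OF partial_order_on_prod_ord[OF factors]]

lemma stD:
  assumes "w \<in> P"
  shows "st w \<noteq> {}" "st w \<subseteq> A \<times> B" "\<And>c d. c \<in> st w \<Longrightarrow> d \<in> st w \<Longrightarrow> c \<preceq> d \<or> d \<preceq> c"
    "\<And>c x. c \<in> st w \<Longrightarrow> (fst c, x) \<in> r \<Longrightarrow> \<exists>y. (x, y) \<in> st w"
    "\<And>c y. c \<in> st w \<Longrightarrow> (snd c, y) \<in> s \<Longrightarrow> \<exists>x. (x, y) \<in> st w"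
proof -
  have *: "st w \<in> staircases r s A B" using st_bij assms by (auto simp: bij_betw_def)
  then show "st w \<noteq> {}" "st w \<subseteq> A \<times> B"
    "\<And>c d. c \<in> st w \<Longrightarrow> d \<in> st w \<Longrightarrow> c \<preceq> d \<or> d \<preceq> c"
    unfolding staircases_def by auto
  fix c assume c: "c \<in> st w"
  show "\<exists>y. (x, y) \<in> st w" if "(fst c, x) \<in> r" for x
  proof -
    have "x \<in> fst ` st w" using * c that unfolding staircases_def by blast
    then show ?thesis by auto
  qed
  show "\<exists>x. (x, y) \<in> st w" if "(snd c, y) \<in> s" for y
  proof -
    have "y \<in> snd ` st w" using * c that unfolding staircases_def by blast
    then show ?thesis by auto
  qed
qed

lemma st_eqD: "v \<in> P \<Longrightarrow> w \<in> P \<Longrightarrow> st v = st w \<Longrightarrow> v = w"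
  using st_bij by (auto simp: bij_betw_def inj_on_def)

lemma st_surj: "C \<in> staircases r s A B \<Longrightarrow> \<exists>w\<in>P. st w = C"
  using bij_betw_imp_surj_on[OF st_bij] by (metis imageE)

lemma finite_st: "w \<in> P \<Longrightarrow> finite (st w)"
  using stD(2) finite_factors by (meson finite_SigmaI finite_subset)

lemma finite_points: "finite P"
proof -
  have "staircases r s A B \<subseteq> Pow (A \<times> B)" by (auto simp: staircases_def)
  then have "finite (staircases r s A B)"
    by (rule finite_subset) (simp add: finite_factors)
  then show ?thesis using st_bij bij_betw_finite by blast
qed

lemma foot:
  assumes "w \<in> P"
  shows "foot w \<in> st w" "\<And>c. c \<in> st w \<Longrightarrow> foot w \<preceq> c"
proof -
  have "\<exists>m. m \<in> st w \<and> (\<forall>c\<in>st w. m \<preceq> c)"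
    using finite_chain_least[OF partial_order_on_prod_ord[OF factors] finite_st[OF assms] stD(2,1,3)[OF assms]]
    by blast
  then have "foot w \<in> st w \<and> (\<forall>c\<in>st w. foot w \<preceq> c)"
    unfolding foot_def by (rule someI_ex)
  then show "foot w \<in> st w" "\<And>c. c \<in> st w \<Longrightarrow> foot w \<preceq> c" by auto
qed

lemma foot_unique: "w \<in> P \<Longrightarrow> m \<in> st w \<Longrightarrow> (\<And>c. c \<in> st w \<Longrightarrow> m \<preceq> c) \<Longrightarrow> foot w = m"
  using foot le_order(4) by blast

lemma leqD:
  assumes "(v, w) \<in> leq"
  shows "v \<in> P" "w \<in> P" "st w \<subseteq> st v" "\<And>c d. d \<in> st w \<Longrightarrow> c \<in> st v \<Longrightarrow> d \<preceq> c \<Longrightarrow> c \<in> st w"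
  using assms by (auto simp: leq_def)

lemma leq_partial_order: "partial_order_on P leq"
proof (rule partial_order_onI)
  show "leq \<subseteq> P \<times> P" "\<And>x. x \<in> P \<Longrightarrow> (x, x) \<in> leq" by (auto simp: leq_def)
  show "(x, z) \<in> leq" if "(x, y) \<in> leq" "(y, z) \<in> leq" for x y z
    using leqD[OF that(1)] leqD[OF that(2)] unfolding leq_def by blast
  show "x = y" if "(x, y) \<in> leq" "(y, x) \<in> leq" for x y
    using leqD[OF that(1)] leqD[OF that(2)] st_eqD by blast
qed

lemma leq_root_system: "root_system P leq"
proof (rule root_systemI[OF leq_partial_order])
  fix u v w assume v: "(u, v) \<in> leq" and w: "(u, w) \<in> leq"
  note v = leqD[OF v] and w = leqD[OF w]
  have "st v \<subseteq> st w \<or> st w \<subseteq> st v"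
    using v w stD(3)[OF v(1)] by (meson subset_iff)
  then show "(v, w) \<in> leq \<or> (w, v) \<in> leq" using v w unfolding leq_def by blast
qed

text \<open>The staircases above \<open>w\<close> are the parts of \<open>w\<close> above one of its points.\<close>

lemma upper_part:
  assumes w: "w \<in> P" and c: "c \<in> st w"
  shows "\<exists>v. (w, v) \<in> leq \<and> foot v = c \<and> st v = {d \<in> st w. c \<preceq> d}"
proof -
  let ?D = "{d \<in> st w. c \<preceq> d}"
  note w' = stD[OF w]
  have cc: "c \<in> ?D" using c w'(2) le_order(2) by blast
  have fst: "x \<in> fst ` ?D" if d: "d \<in> ?D" and x: "(fst d, x) \<in> r" for d x
  proof -
    obtain y where y: "(x, y) \<in> st w" using w'(4) d x by blast
    show ?thesis
    proof (cases "c \<preceq> (x, y)")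
      case True then show ?thesis using y by force
    next
      case False
      then have "(x, y) \<preceq> c" using w'(3) y c by blast
      then have "(x, fst d) \<in> r"
        using d partial_order_onD(3)[OF factors(1), of x "fst c" "fst d"] by (simp add: prod_ord_iff)
      then have "x = fst d" using x partial_order_onD(4)[OF factors(1)] by blast
      then show ?thesis using d by blast
    qed
  qed
  have snd: "y \<in> snd ` ?D" if d: "d \<in> ?D" and y: "(snd d, y) \<in> s" for d y
  proof -
    obtain x where x: "(x, y) \<in> st w" using w'(5) d y by blast
    show ?thesis
    proof (cases "c \<preceq> (x, y)")
      case True then show ?thesis using x by force
    next
      case False
      then have "(x, y) \<preceq> c" using w'(3) x c by blast
      then have "(y, snd d) \<in> s"
        using d partial_order_onD(3)[OF factors(2), of y "snd c" "snd d"] by (simp add: prod_ord_iff)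
      then have "y = snd d" using y partial_order_onD(4)[OF factors(2)] by blast
      then show ?thesis using d by blast
    qed
  qed
  have "?D \<in> staircases r s A B"
    unfolding staircases_def using cc w'(2,3) fst snd by blast
  then obtain v where v: "v \<in> P" "st v = ?D" using st_surj by blast
  have "(w, v) \<in> leq" using v w le_order(3) unfolding leq_def by blast
  moreover have "foot v = c" by (rule foot_unique[OF v(1)]) (use v cc in simp_all)
  ultimately show ?thesis using v by blast
qed

lemma st_eq_feet:
  assumes w: "w \<in> P"
  shows "st w = foot ` (leq `` {w})"
proof (intro equalityI subsetI)
  show "c \<in> foot ` (leq `` {w})" if "c \<in> st w" for c
    using upper_part[OF w that] by blast
  show "c \<in> st w" if "c \<in> foot ` (leq `` {w})" for c
    using that foot(1) leqD(2,3) by blast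
qed

lemma leq_iff_foot: "(v, w) \<in> leq \<Longrightarrow> st w = {d \<in> st v. foot w \<preceq> d}"
  using leqD foot by blast

lemma proj1_p_morphism: "p_morphism P leq A r proj1"
  unfolding p_morphism_def
proof (intro conjI ballI)
  show "proj1 ` P \<subseteq> A" using foot(1) stD(2) by (fastforce simp: proj1_def)
  fix w assume w: "w \<in> P"
  have "proj1 ` (leq `` {w}) = fst ` st w"
    using st_eq_feet[OF w] by (simp add: proj1_def image_image)
  also have "\<dots> = r `` {proj1 w}"
  proof (intro equalityI subsetI)
    show "x \<in> r `` {proj1 w}" if "x \<in> fst ` st w" for x
      using that foot(2)[OF w] by (auto simp: proj1_def prod_ord_iff)
    fix x assume "x \<in> r `` {proj1 w}"
    then obtain y where "(x, y) \<in> st w" using stD(4)[OF w foot(1)[OF w]] by (auto simp: proj1_def)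
    then show "x \<in> fst ` st w" by force
  qed
  finally show "proj1 ` (leq `` {w}) = r `` {proj1 w}" .
qed

lemma proj2_p_morphism: "p_morphism P leq B s proj2"
  unfolding p_morphism_def
proof (intro conjI ballI)
  show "proj2 ` P \<subseteq> B" using foot(1) stD(2) by (fastforce simp: proj2_def)
  fix w assume w: "w \<in> P"
  have "proj2 ` (leq `` {w}) = snd ` st w"
    using st_eq_feet[OF w] by (simp add: proj2_def image_image)
  also have "\<dots> = s `` {proj2 w}"
  proof (intro equalityI subsetI)
    show "y \<in> s `` {proj2 w}" if "y \<in> snd ` st w" for y
      using that foot(2)[OF w] by (auto simp: proj2_def prod_ord_iff)
    fix y assume "y \<in> s `` {proj2 w}"
    then obtain x where "(x, y) \<in> st w" using stD(5)[OF w foot(1)[OF w]] by (auto simp: proj2_def)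
    then show "y \<in> snd ` st w" by force
  qed
  finally show "proj2 ` (leq `` {w}) = s `` {proj2 w}" .
qed

text \<open>Universal property among root systems: a pair of p-morphisms sends the chain above a point
  \<open>t\<close> to a staircase, and a p-morphism that induces the pair has no choice but to send \<open>t\<close> there.\<close>

definition lift :: "'t rel \<Rightarrow> ('t \<Rightarrow> 'a) \<Rightarrow> ('t \<Rightarrow> 'b) \<Rightarrow> 't \<Rightarrow> 'w" where
  "lift q f g t = inv_into P st ((\<lambda>u. (f u, g u)) ` (q `` {t}))"

lemma pair_mono:
  assumes "q \<subseteq> T \<times> T" "p_morphism T q A r f" "p_morphism T q B s g" "(u, v) \<in> q"
  shows "(f u, g u) \<preceq> (f v, g v)"
proof -
  have "u \<in> T" using assms(1,4) by blast
  then show ?thesis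
    using p_morphismD(3)[OF assms(2) _ assms(4)] p_morphismD(3)[OF assms(3) _ assms(4)]
    by (simp add: prod_ord_iff)
qed

lemma lift:
  assumes q: "root_system T q"
    and f: "p_morphism T q A r f" and g: "p_morphism T q B s g" and t: "t \<in> T"
  shows "lift q f g t \<in> P" "st (lift q f g t) = (\<lambda>u. (f u, g u)) ` (q `` {t})"
    "proj1 (lift q f g t) = f t" "proj2 (lift q f g t) = g t"
proof -
  note q' = partial_order_onD[OF root_systemD(1)[OF q]]
  let ?C = "(\<lambda>u. (f u, g u)) ` (q `` {t})"
  note mono = pair_mono[OF q'(1) f g]
  have "r `` (fst ` ?C) \<subseteq> fst ` ?C"
  proof -
    have "fst ` ?C = r `` {f t}" using p_morphismD(2)[OF f t] by (simp add: image_image)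
    then show ?thesis using partial_order_onD(3)[OF factors(1)] by auto
  qed
  moreover have "s `` (snd ` ?C) \<subseteq> snd ` ?C"
  proof -
    have "snd ` ?C = s `` {g t}" using p_morphismD(2)[OF g t] by (simp add: image_image)
    then show ?thesis using partial_order_onD(3)[OF factors(2)] by auto
  qed
  moreover have "?C \<subseteq> A \<times> B"
    using q'(1) p_morphismD(1)[OF f] p_morphismD(1)[OF g] by auto
  moreover have "c \<preceq> d \<or> d \<preceq> c" if "c \<in> ?C" "d \<in> ?C" for c d
    using that mono root_systemD(2)[OF q, of t] by blast
  ultimately have C: "?C \<in> staircases r s A B"
    unfolding staircases_def using q'(2)[OF t] by blast
  then show P: "lift q f g t \<in> P" and st: "st (lift q f g t) = ?C"
    unfolding lift_def using st_bij by (auto simp: bij_betw_def inv_into_into f_inv_into_f)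
  have "foot (lift q f g t) = (f t, g t)"
  proof (rule foot_unique[OF P])
    show "(f t, g t) \<in> st (lift q f g t)" using st q'(2)[OF t] by blast
    show "(f t, g t) \<preceq> c" if "c \<in> st (lift q f g t)" for c
      using that mono unfolding st by blast
  qed
  then show "proj1 (lift q f g t) = f t" "proj2 (lift q f g t) = g t"
    by (simp_all add: proj1_def proj2_def)
qed

lemma lift_p_morphism:
  assumes q: "root_system T q"
    and f: "p_morphism T q A r f" and g: "p_morphism T q B s g"
  shows "p_morphism T q P leq (lift q f g)"
  unfolding p_morphism_def
proof (intro conjI ballI equalityI subsetI)
  note q' = partial_order_onD[OF root_systemD(1)[OF q]] and l = lift[OF q f g]
  note mono = pair_mono[OF q'(1) f g]
  show "w \<in> P" if "w \<in> lift q f g ` T" for w by (rule imageE[OF that]) (simp add: l(1))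
  fix t assume t: "t \<in> T"
  \<comment> \<open>If \<open>u\<close> and \<open>u'\<close> lie above \<open>t\<close> and \<open>u'\<close> is mapped above \<open>u\<close>, then \<open>u'\<close> is above \<open>u\<close> or has
    the same image: the points above \<open>t\<close> form a chain.\<close>
  have part: "st (lift q f g u) = {d \<in> st (lift q f g t). (f u, g u) \<preceq> d}" if u: "(t, u) \<in> q" for u
  proof (intro equalityI subsetI)
    have uT: "u \<in> T" using u q'(1) by blast
    show "d \<in> {d \<in> st (lift q f g t). (f u, g u) \<preceq> d}" if d: "d \<in> st (lift q f g u)" for d
    proof -
      obtain v where v: "(u, v) \<in> q" "d = (f v, g v)"
        using d unfolding l(2)[OF uT] by blast
      have "(t, v) \<in> q" using q'(3)[OF u v(1)] .
      then show ?thesis using l(2)[OF t] v mono[OF v(1)] by auto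
    qed
    fix d assume "d \<in> {d \<in> st (lift q f g t). (f u, g u) \<preceq> d}"
    then obtain v where v: "(t, v) \<in> q" "d = (f v, g v)" "(f u, g u) \<preceq> (f v, g v)"
      using l(2)[OF t] by auto
    show "d \<in> st (lift q f g u)"
    proof (cases "(u, v) \<in> q")
      case True then show ?thesis using v l(2)[OF uT] by auto
    next
      case False
      then have "(v, u) \<in> q" using root_systemD(2)[OF q u v(1)] by simp
      then have "(f v, g v) \<preceq> (f u, g u)" by (rule mono)
      then have "d = (f u, g u)" using v le_order(4) by blast
      then show ?thesis using l(2)[OF uT] q'(2)[OF uT] by auto
    qed
  qed
  have up: "(lift q f g t, lift q f g u) \<in> leq" if u: "(t, u) \<in> q" for u
    using part[OF u] l(1) t u q'(1) le_order(3) unfolding leq_def by blast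
  show "w \<in> leq `` {lift q f g t}" if "w \<in> lift q f g ` (q `` {t})" for w
    using that up by blast
  fix w assume "w \<in> leq `` {lift q f g t}"
  then have w: "(lift q f g t, w) \<in> leq" by simp
  have "foot w \<in> st (lift q f g t)" using foot(1) leqD(2,3)[OF w] by blast
  then obtain u where u: "(t, u) \<in> q" "foot w = (f u, g u)" using l(2)[OF t] by auto
  have "st w = st (lift q f g u)" using leq_iff_foot[OF w] part[OF u(1)] u(2) by simp
  then have "w = lift q f g u" using st_eqD leqD(2)[OF w] leqD(2)[OF up[OF u(1)]] by blast
  then show "w \<in> lift q f g ` (q `` {t})" using u by blast
qed

lemma lift_unique:
  assumes q: "q \<subseteq> T \<times> T"
    and h: "p_morphism T q P leq h" and t: "t \<in> T"
    and fg: "\<And>u. u \<in> T \<Longrightarrow> proj1 (h u) = f u" "\<And>u. u \<in> T \<Longrightarrow> proj2 (h u) = g u"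
  shows "h t = lift q f g t"
proof -
  have foot: "foot (h u) = (f u, g u)" if "u \<in> T" for u
    using fg[OF that] by (simp add: proj1_def proj2_def prod_eq_iff)
  have hP: "h t \<in> P" using p_morphismD(1)[OF h t] .
  have "st (h t) = foot ` (leq `` {h t})" using st_eq_feet[OF hP] .
  also have "\<dots> = foot ` h ` (q `` {t})" using p_morphismD(2)[OF h t] by simp
  also have "\<dots> = (\<lambda>u. (f u, g u)) ` (q `` {t})"
    unfolding image_image using foot q by (intro image_cong) auto
  finally have "lift q f g t = inv_into P st (st (h t))" by (simp add: lift_def)
  then show ?thesis using hP st_bij by (simp add: bij_betw_def)
qed

end

section \<open>The category of root-system Hilbert spaces\<close>

lemma closure_of_singleton:
  "x \<in> topspace X \<Longrightarrow> X closure_of {x} = dual_specialization X `` {x}"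
  by (auto simp: dual_specialization_def)

lemma dual_specialization_iff:
  "(x, y) \<in> dual_specialization X \<longleftrightarrow>
     x \<in> topspace X \<and> y \<in> topspace X \<and> (\<forall>U. openin X U \<longrightarrow> y \<in> U \<longrightarrow> x \<in> U)"
  by (auto simp: dual_specialization_def in_closure_of)

lemma openin_downset:
  "openin X U \<Longrightarrow> (x, y) \<in> dual_specialization X \<Longrightarrow> y \<in> U \<Longrightarrow> x \<in> U"
  by (auto simp: dual_specialization_iff)

lemma closedin_upset:
  "closedin X C \<Longrightarrow> (x, y) \<in> dual_specialization X \<Longrightarrow> x \<in> C \<Longrightarrow> y \<in> C"
  unfolding closedin_def dual_specialization_iff by blast

lemma sat_eq_downset:
  assumes "Y \<subseteq> topspace X"
  shows "sat X Y = (dual_specialization X)\<inverse> `` Y"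
proof (intro equalityI subsetI)
  fix x assume x: "x \<in> sat X Y"
  show "x \<in> (dual_specialization X)\<inverse> `` Y"
  proof (rule ccontr)
    assume not: "x \<notin> (dual_specialization X)\<inverse> `` Y"
    have xX: "x \<in> topspace X" using x assms unfolding sat_def by blast
    let ?U = "topspace X - X closure_of {x}"
    have "openin X ?U" by (intro openin_diff) simp_all
    moreover have "Y \<subseteq> ?U" using not assms closure_of_singleton[OF xX] by auto
    ultimately have "x \<in> ?U" using x unfolding sat_def by blast
    then show False using closure_of_subset[of "{x}" X] xX by auto
  qed
next
  fix x assume "x \<in> (dual_specialization X)\<inverse> `` Y"
  then show "x \<in> sat X Y" unfolding sat_def using openin_downset by fastforce
qed

abbreviation hs_ord :: "'a hspace \<Rightarrow> 'a rel" where
  "hs_ord S \<equiv> dual_specialization (hs_top S)"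

lemma PHS0_objD:
  assumes "PHS0_obj S"
  shows "root_system (hs_points S) (hs_ord S)" "hs_points S \<in> hs_base S"
    "sober_space (hs_top S)"
    "\<And>U. U \<in> hs_base S \<Longrightarrow> openin (hs_top S) U"
    "\<And>U x. openin (hs_top S) U \<Longrightarrow> x \<in> U \<Longrightarrow> \<exists>V\<in>hs_base S. x \<in> V \<and> V \<subseteq> U"
    "\<And>U V. U \<in> hs_base S \<Longrightarrow> V \<in> hs_base S \<Longrightarrow> (hs_ord S)\<inverse> `` (U - V) \<in> hs_base S"
proof -
  have H: "H_space S" using assms by (simp add: PHS0_obj_def)
  show "root_system (hs_points S) (hs_ord S)" "hs_points S \<in> hs_base S"
    using assms by (auto simp: PHS0_obj_def)
  show "sober_space (hs_top S)" using H by (simp add: H_space_def)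
  have "openin (hs_top S) = arbitrary union_of (\<lambda>U. U \<in> hs_base S)"
    using H by (simp add: H_space_def)
  then have *: "\<forall>V. V \<in> hs_base S \<longrightarrow> openin (hs_top S) V"
    "\<forall>U x. openin (hs_top S) U \<and> x \<in> U \<longrightarrow> (\<exists>V. V \<in> hs_base S \<and> x \<in> V \<and> V \<subseteq> U)"
    unfolding openin_topology_base_unique by simp_all
  show op: "\<And>U. U \<in> hs_base S \<Longrightarrow> openin (hs_top S) U" using *(1) by simp
  show "\<exists>V\<in>hs_base S. x \<in> V \<and> V \<subseteq> U" if "openin (hs_top S) U" "x \<in> U" for U x
    using *(2) that by blast
  fix U V assume UV: "U \<in> hs_base S" "V \<in> hs_base S"
  have U: "U \<subseteq> hs_points S" using op[OF UV(1)] by (rule openin_subset)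
  then have "U \<inter> (hs_points S - V) = U - V" by blast
  moreover have "sat (hs_top S) (U \<inter> (hs_points S - V)) \<in> hs_base S"
    using H UV by (simp add: H_space_def)
  ultimately show "(hs_ord S)\<inverse> `` (U - V) \<in> hs_base S"
    using sat_eq_downset[of "U - V" "hs_top S"] U by (metis Diff_subset subset_trans)
qed

text \<open>In a root system the closed set \<open>R(x)\<close> is a chain, because its points are the generators of
  the sets \<open>R(z)\<close> for \<open>z\<close> in the chain above \<open>x\<close>. Hence it is irreducible, and sobriety provides a
  generic point \<open>f x\<close>. Morphisms are therefore p-morphisms in disguise.\<close>

definition base_morphism :: "'a hspace \<Rightarrow> 'b hspace \<Rightarrow> ('a \<Rightarrow> 'b) \<Rightarrow> bool" where
  "base_morphism T S f \<longleftrightarrow>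
     p_morphism (hs_points T) (hs_ord T) (hs_points S) (hs_ord S) f \<and>
     (\<forall>U\<in>hs_base S. {t \<in> hs_points T. f t \<in> U} \<in> hs_base T)"

definition above_graph :: "'a hspace \<Rightarrow> 'b hspace \<Rightarrow> ('a \<Rightarrow> 'b) \<Rightarrow> ('a \<times> 'b) set" where
  "above_graph T S f = {(t, y). t \<in> hs_points T \<and> (f t, y) \<in> hs_ord S}"

lemma PHS0_homD:
  assumes "PHS0_obj T" "PHS0_obj S" and F: "F \<in> PHS0_hom T S"
  shows "\<exists>f. base_morphism T S f \<and> F = above_graph T S f"
proof -
  note T = PHS0_objD[OF assms(1)] and S = PHS0_objD[OF assms(2)]
  note poT = partial_order_onD[OF root_systemD(1)[OF T(1)]]
  note poS = partial_order_onD[OF root_systemD(1)[OF S(1)]]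
  have sub: "F \<subseteq> hs_points T \<times> hs_points S"
    and pre: "\<And>U. U \<in> hs_base S \<Longrightarrow> F\<inverse> `` U \<in> hs_base T"
    and cl: "\<And>x. x \<in> hs_points T \<Longrightarrow> closedin (hs_top S) (F `` {x})"
    and ne: "\<And>x. x \<in> hs_points T \<Longrightarrow> F `` {x} \<noteq> {}"
    and ex: "\<And>x y. (x, y) \<in> F \<Longrightarrow>
      \<exists>z \<in> hs_top T closure_of {x}. F `` {z} = hs_top S closure_of {y}"
    using F by (auto simp: PHS0_hom_def H_functional_relation_def)
  have ex: "\<exists>z. (x, z) \<in> hs_ord T \<and> F `` {z} = hs_ord S `` {y}" if "(x, y) \<in> F" for x y
  proof -
    have "x \<in> hs_points T" "y \<in> hs_points S" using sub that by auto
    then show ?thesis using ex[OF that] closure_of_singleton by (metis Image_singleton_iff)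
  qed
  \<comment> \<open>The sets \<open>F(x)\<close> decrease along the order: inverse images of basic sets are open, hence
    downsets.\<close>
  have anti: "y \<in> F `` {x}" if xz: "(x, z) \<in> hs_ord T" and y: "y \<in> F `` {z}" for x y z
  proof (rule ccontr)
    assume not: "y \<notin> F `` {x}"
    have x: "x \<in> hs_points T" using xz poT(1) by blast
    have "openin (hs_top S) (hs_points S - F `` {x})" using cl[OF x] by (simp add: closedin_def)
    moreover have "y \<in> hs_points S - F `` {x}" using not y sub by blast
    ultimately obtain U where U: "U \<in> hs_base S" "y \<in> U" "U \<subseteq> hs_points S - F `` {x}"
      using S(5) by blast
    have "openin (hs_top T) (F\<inverse> `` U)" using pre[OF U(1)] T(4) by blast
    moreover have "z \<in> F\<inverse> `` U" using y U by blast
    ultimately have "x \<in> F\<inverse> `` U" using openin_downset xz by metis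
    then show False using U by blast
  qed
  have generic: "\<exists>y\<in>hs_points S. F `` {x} = hs_ord S `` {y}" if x: "x \<in> hs_points T" for x
  proof -
    have "irreducible_closedin (hs_top S) (F `` {x})"
      unfolding irreducible_closedin_def
    proof (intro conjI allI impI cl[OF x] ne[OF x])
      fix C1 C2 assume C: "closedin (hs_top S) C1" "closedin (hs_top S) C2" "F `` {x} = C1 \<union> C2"
      show "F `` {x} = C1 \<or> F `` {x} = C2"
      proof (rule ccontr)
        assume "\<not> (F `` {x} = C1 \<or> F `` {x} = C2)"
        then obtain y1 y2 where y: "y1 \<in> C1" "y1 \<notin> C2" "y2 \<in> C2" "y2 \<notin> C1"
          "(x, y1) \<in> F" "(x, y2) \<in> F" using C(3) by blast
        obtain z1 where z1: "(x, z1) \<in> hs_ord T" "F `` {z1} = hs_ord S `` {y1}"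
          using ex[OF y(5)] by blast
        obtain z2 where z2: "(x, z2) \<in> hs_ord T" "F `` {z2} = hs_ord S `` {y2}"
          using ex[OF y(6)] by blast
        have yS: "y1 \<in> hs_points S" "y2 \<in> hs_points S" using y sub by auto
        have "(z1, z2) \<in> hs_ord T \<or> (z2, z1) \<in> hs_ord T"
          using root_systemD(2)[OF T(1)] z1 z2 by blast
        then have "(y1, y2) \<in> hs_ord S \<or> (y2, y1) \<in> hs_ord S"
          using anti[of z1 z2 y2] anti[of z2 z1 y1] poS(2) yS z1(2) z2(2) by auto
        then show False using closedin_upset C y by metis
      qed
    qed
    then obtain y where "y \<in> hs_points S" "hs_top S closure_of {y} = F `` {x}"
      using S(3) unfolding sober_space_def by blast
    then show ?thesis using closure_of_singleton by metis
  qed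
  define f where "f x = (SOME y. y \<in> hs_points S \<and> F `` {x} = hs_ord S `` {y})" for x
  have f: "f x \<in> hs_points S" "F `` {x} = hs_ord S `` {f x}" if "x \<in> hs_points T" for x
    using someI_ex[of "\<lambda>y. y \<in> hs_points S \<and> F `` {x} = hs_ord S `` {y}"] generic[OF that]
    unfolding f_def by blast+
  have "F = above_graph T S f"
    using sub f(2) unfolding above_graph_def by blast
  moreover have "p_morphism (hs_points T) (hs_ord T) (hs_points S) (hs_ord S) f"
    unfolding p_morphism_def
  proof (intro conjI ballI equalityI subsetI)
    show "y \<in> hs_points S" if "y \<in> f ` hs_points T" for y
      by (rule imageE[OF that]) (simp add: f(1))
    fix x assume x: "x \<in> hs_points T"
    show "y \<in> hs_ord S `` {f x}" if y: "y \<in> f ` (hs_ord T `` {x})" for y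
    proof -
      obtain z where z: "(x, z) \<in> hs_ord T" "y = f z" using y by blast
      then have zT: "z \<in> hs_points T" using poT(1) by blast
      have "y \<in> F `` {z}" using f[OF zT] poS(2) z by blast
      then show ?thesis using anti[OF z(1)] f(2)[OF x] by blast
    qed
    fix y assume y: "y \<in> hs_ord S `` {f x}"
    then have "(x, y) \<in> F" using f(2)[OF x] by blast
    then obtain z where z: "(x, z) \<in> hs_ord T" "F `` {z} = hs_ord S `` {y}" using ex by blast
    have zT: "z \<in> hs_points T" and yS: "y \<in> hs_points S" using z(1) y poT(1) poS(1) by auto
    have "hs_ord S `` {f z} = hs_ord S `` {y}" using f(2)[OF zT] z(2) by simp
    then have "f z = y" using poS(2)[OF yS] poS(2)[OF f(1)[OF zT]] poS(4) by blast
    then show "y \<in> f ` (hs_ord T `` {x})" using z(1) by blast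
  qed
  moreover have "{t \<in> hs_points T. f t \<in> U} \<in> hs_base T" if U: "U \<in> hs_base S" for U
  proof -
    have "F\<inverse> `` U = {t \<in> hs_points T. f t \<in> U}"
    proof (intro equalityI subsetI)
      fix t assume "t \<in> F\<inverse> `` U"
      then obtain u where u: "(t, u) \<in> F" "u \<in> U" by blast
      then have t: "t \<in> hs_points T" using sub by blast
      then have "(f t, u) \<in> hs_ord S" using f(2) u by blast
      then show "t \<in> {t \<in> hs_points T. f t \<in> U}" using openin_downset S(4)[OF U] u t by fast
    next
      fix t assume t: "t \<in> {t \<in> hs_points T. f t \<in> U}"
      then have "(t, f t) \<in> F" using f[of t] poS(2) by blast
      then show "t \<in> F\<inverse> `` U" using t by blast
    qed
    then show ?thesis using pre[OF U] by simp
  qed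
  ultimately show ?thesis unfolding base_morphism_def by blast
qed

lemma base_morphismD:
  assumes "base_morphism T S f"
  shows "p_morphism (hs_points T) (hs_ord T) (hs_points S) (hs_ord S) f"
    "\<And>U. U \<in> hs_base S \<Longrightarrow> {t \<in> hs_points T. f t \<in> U} \<in> hs_base T"
    "\<And>t. t \<in> hs_points T \<Longrightarrow> f t \<in> hs_points S"
  using assms unfolding base_morphism_def p_morphism_def by auto

lemma above_graph_in_PHS0_hom:
  assumes "PHS0_obj T" "PHS0_obj S" and f: "base_morphism T S f"
  shows "above_graph T S f \<in> PHS0_hom T S"
proof -
  note S = PHS0_objD[OF assms(2)]
  note poT = partial_order_onD[OF root_systemD(1)[OF PHS0_objD(1)[OF assms(1)]]]
  note poS = partial_order_onD[OF root_systemD(1)[OF S(1)]]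
  note f = base_morphismD[OF f]
  have img: "above_graph T S f `` {t} = hs_top S closure_of {f t}" if "t \<in> hs_points T" for t
    using that f(3) closure_of_singleton[of "f t" "hs_top S"] unfolding above_graph_def by auto
  have pre: "(above_graph T S f)\<inverse> `` U = {t \<in> hs_points T. f t \<in> U}" if U: "U \<in> hs_base S" for U
  proof (intro equalityI subsetI)
    show "t \<in> {t \<in> hs_points T. f t \<in> U}" if "t \<in> (above_graph T S f)\<inverse> `` U" for t
      using that openin_downset[OF S(4)[OF U]] unfolding above_graph_def by blast
    show "t \<in> (above_graph T S f)\<inverse> `` U" if "t \<in> {t \<in> hs_points T. f t \<in> U}" for t
      using that f(3) poS(2) unfolding above_graph_def by blast
  qed
  have ex: "\<exists>z \<in> hs_top T closure_of {x}. above_graph T S f `` {z} = hs_top S closure_of {y}"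
    if xy: "(x, y) \<in> above_graph T S f" for x y
  proof -
    have x: "x \<in> hs_points T" and "(f x, y) \<in> hs_ord S" using xy by (auto simp: above_graph_def)
    then obtain z where z: "(x, z) \<in> hs_ord T" "f z = y" using p_morphismD(4)[OF f(1)] by blast
    then have "z \<in> hs_points T" using poT(1) by blast
    then have "above_graph T S f `` {z} = hs_top S closure_of {y}" using img z by simp
    then show ?thesis using z(1) closure_of_singleton[OF x] by blast
  qed
  have "above_graph T S f \<subseteq> hs_points T \<times> hs_points S"
    using poS(1) unfolding above_graph_def by blast
  moreover have "above_graph T S f `` {t} \<noteq> {}" if "t \<in> hs_points T" for t
    using poS(2) f(3) that unfolding above_graph_def by blast
  moreover have "closedin (hs_top S) (above_graph T S f `` {t})" if "t \<in> hs_points T" for t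
    using img[OF that] by simp
  ultimately show ?thesis
    using pre f(2) ex unfolding PHS0_hom_def H_functional_relation_def by auto
qed

lemma base_morphism_compose:
  assumes f: "base_morphism T S f" and g: "base_morphism S U g"
  shows "base_morphism T U (g \<circ> f)"
proof -
  have "{t \<in> hs_points T. (g \<circ> f) t \<in> V} \<in> hs_base T" if "V \<in> hs_base U" for V
  proof -
    have "{t \<in> hs_points T. (g \<circ> f) t \<in> V} = {t \<in> hs_points T. f t \<in> {x \<in> hs_points S. g x \<in> V}}"
      using base_morphismD(3)[OF f] by auto
    then show ?thesis using base_morphismD(2)[OF f base_morphismD(2)[OF g that]] by simp
  qed
  then show ?thesis
    unfolding base_morphism_def
    using p_morphism_compose base_morphismD(1)[OF f] base_morphismD(1)[OF g] by blast
qed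

lemma above_graph_compose:
  assumes f: "base_morphism T S f" and g: "base_morphism S U g" and "PHS0_obj S" "PHS0_obj U"
  shows "above_graph T S f O above_graph S U g = above_graph T U (g \<circ> f)"
proof (intro equalityI subsetI)
  note poS = partial_order_onD[OF root_systemD(1)[OF PHS0_objD(1)[OF assms(3)]]]
  note poU = partial_order_onD[OF root_systemD(1)[OF PHS0_objD(1)[OF assms(4)]]]
  fix p assume "p \<in> above_graph T S f O above_graph S U g"
  then obtain x y z where p: "p = (x, z)" "x \<in> hs_points T" "(f x, y) \<in> hs_ord S" "(g y, z) \<in> hs_ord U"
    by (auto simp: above_graph_def)
  have "f x \<in> hs_points S" using poS(1) p(3) by blast
  then have "(g (f x), g y) \<in> hs_ord U" using p_morphismD(3)[OF base_morphismD(1)[OF g]] p(3) by blast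
  then show "p \<in> above_graph T U (g \<circ> f)" using p poU(3) by (auto simp: above_graph_def)
next
  note poS = partial_order_onD[OF root_systemD(1)[OF PHS0_objD(1)[OF assms(3)]]]
  fix p assume "p \<in> above_graph T U (g \<circ> f)"
  then obtain x z where p: "p = (x, z)" "x \<in> hs_points T" "(g (f x), z) \<in> hs_ord U"
    by (auto simp: above_graph_def)
  have "f x \<in> hs_points S" using base_morphismD(3)[OF f p(2)] .
  then show "p \<in> above_graph T S f O above_graph S U g"
    using p poS(2) by (auto simp: above_graph_def intro!: relcompI)
qed

lemma above_graph_eqD:
  assumes "above_graph T S f = above_graph T S g" "PHS0_obj S"
    "f t \<in> hs_points S" "g t \<in> hs_points S" "t \<in> hs_points T"
  shows "f t = g t"
proof -
  note poS = partial_order_onD[OF root_systemD(1)[OF PHS0_objD(1)[OF assms(2)]]]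
  have "(t, f t) \<in> above_graph T S f" "(t, g t) \<in> above_graph T S g"
    using assms(3-5) poS(2) by (simp_all add: above_graph_def)
  then have "(t, f t) \<in> above_graph T S g" "(t, g t) \<in> above_graph T S f"
    using assms(1) by simp_all
  then show ?thesis using poS(4) by (auto simp: above_graph_def)
qed

lemma above_graph_cong:
  "(\<And>t. t \<in> hs_points T \<Longrightarrow> f t = g t) \<Longrightarrow> above_graph T S f = above_graph T S g"
  by (auto simp: above_graph_def)

lemma above_graph_id:
  assumes "PHS0_obj S"
  shows "above_graph S S id = hs_ord S"
  using partial_order_onD(1)[OF root_systemD(1)[OF PHS0_objD(1)[OF assms]]]
  by (auto simp: above_graph_def)

lemma base_morphism_id:
  assumes "PHS0_obj S"
  shows "base_morphism S S id"
proof -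
  have "{t \<in> hs_points S. t \<in> U} = U" if "U \<in> hs_base S" for U
    using openin_subset[OF PHS0_objD(4)[OF assms that]] by auto
  then show ?thesis by (auto simp: base_morphism_def p_morphism_def)
qed

lemma PHS0_isomorphic_points:
  assumes "PHS0_isomorphic S1 S2"
  shows "\<exists>f. bij_betw f (hs_points S1) (hs_points S2)"
proof -
  have o: "PHS0_obj S1" "PHS0_obj S2" using assms by (auto simp: PHS0_isomorphic_def)
  obtain R R' where R: "R \<in> PHS0_hom S1 S2" "R' \<in> PHS0_hom S2 S1"
    "R O R' = hs_ord S1" "R' O R = hs_ord S2"
    using assms by (auto simp: PHS0_isomorphic_def)
  obtain f where f: "base_morphism S1 S2 f" "R = above_graph S1 S2 f"
    using PHS0_homD[OF o R(1)] by blast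
  obtain g where g: "base_morphism S2 S1 g" "R' = above_graph S2 S1 g"
    using PHS0_homD[OF o(2,1) R(2)] by blast
  have "above_graph S1 S1 (g \<circ> f) = above_graph S1 S1 id"
    using R(3) f g above_graph_compose[OF f(1) g(1) o(2,1)] above_graph_id[OF o(1)] by simp
  then have gf: "g (f x) = x" if "x \<in> hs_points S1" for x
    using above_graph_eqD[of S1 S1 "g \<circ> f" id x] o that base_morphismD(3)[OF f(1)]
      base_morphismD(3)[OF g(1)] by simp
  have "above_graph S2 S2 (f \<circ> g) = above_graph S2 S2 id"
    using R(4) f g above_graph_compose[OF g(1) f(1) o] above_graph_id[OF o(2)] by simp
  then have fg: "f (g x) = x" if "x \<in> hs_points S2" for x
    using above_graph_eqD[of S2 S2 "f \<circ> g" id x] o that base_morphismD(3)[OF f(1)]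
      base_morphismD(3)[OF g(1)] by simp
  have "bij_betw f (hs_points S1) (hs_points S2)"
    by (rule bij_betw_byWitness[where f' = g])
      (use gf fg base_morphismD(3)[OF f(1)] base_morphismD(3)[OF g(1)] in auto)
  then show ?thesis by blast
qed

lemma PHS0_hom_compose:
  assumes "PHS0_obj T" "PHS0_obj S" "PHS0_obj U" and M: "M \<in> PHS0_hom T S" and N: "N \<in> PHS0_hom S U"
  shows "M O N \<in> PHS0_hom T U"
proof -
  obtain f where f: "base_morphism T S f" "M = above_graph T S f"
    using PHS0_homD[OF assms(1,2) M] by blast
  obtain g where g: "base_morphism S U g" "N = above_graph S U g"
    using PHS0_homD[OF assms(2,3) N] by blast
  show ?thesis
    using above_graph_in_PHS0_hom[OF assms(1,3) base_morphism_compose[OF f(1) g(1)]]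
      above_graph_compose[OF f(1) g(1) assms(2,3)] f(2) g(2) by simp
qed

lemma PHS0_hom_id: "PHS0_obj S \<Longrightarrow> hs_ord S \<in> PHS0_hom S S"
  using above_graph_in_PHS0_hom[OF _ _ base_morphism_id] above_graph_id by metis

lemma PHS0_id_left:
  assumes "PHS0_obj T" "PHS0_obj S" "M \<in> PHS0_hom T S"
  shows "hs_ord T O M = M"
proof -
  obtain f where f: "base_morphism T S f" "M = above_graph T S f"
    using PHS0_homD[OF assms] by blast
  show ?thesis
    using above_graph_compose[OF base_morphism_id[OF assms(1)] f(1) assms(1,2)] f(2)
      above_graph_id[OF assms(1)] by simp
qed

lemma PHS0_product_unique:
  fixes Q Q' :: "'q hspace"
  assumes Q: "PHS0_product Q R1 R2 S1 S2" and Q': "PHS0_product Q' R1' R2' S1 S2"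
  shows "PHS0_isomorphic Q Q'"
proof -
  have S: "PHS0_obj S1" "PHS0_obj S2" using Q by (auto simp: PHS0_product_def)
  have half: "\<exists>M\<in>PHS0_hom Q Q'. \<exists>N\<in>PHS0_hom Q' Q. M O R1' = R1 \<and> M O R2' = R2 \<and>
      N O R1 = R1' \<and> N O R2 = R2' \<and> M O N = hs_ord Q"
    if P: "PHS0_product Q R1 R2 S1 S2" and P': "PHS0_product Q' R1' R2' S1 S2"
    for Q Q' :: "'q hspace" and R1 R2 R1' R2'
  proof -
    have o: "PHS0_obj Q" "PHS0_obj Q'" "R1 \<in> PHS0_hom Q S1" "R2 \<in> PHS0_hom Q S2"
      "R1' \<in> PHS0_hom Q' S1" "R2' \<in> PHS0_hom Q' S2"
      using P P' by (auto simp: PHS0_product_def)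
    have univ: "\<exists>!M. M \<in> PHS0_hom T Q \<and> M O R1 = F1 \<and> M O R2 = F2"
      if "PHS0_obj T" "F1 \<in> PHS0_hom T S1" "F2 \<in> PHS0_hom T S2" for T :: "'q hspace" and F1 F2
      using P that by (simp add: PHS0_product_def)
    have univ': "\<exists>!M. M \<in> PHS0_hom T Q' \<and> M O R1' = F1 \<and> M O R2' = F2"
      if "PHS0_obj T" "F1 \<in> PHS0_hom T S1" "F2 \<in> PHS0_hom T S2" for T :: "'q hspace" and F1 F2
      using P' that by (simp add: PHS0_product_def)
    obtain M where M: "M \<in> PHS0_hom Q Q'" "M O R1' = R1" "M O R2' = R2"
      using univ'[OF o(1,3,4)] by blast
    obtain N where N: "N \<in> PHS0_hom Q' Q" "N O R1 = R1'" "N O R2 = R2'"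
      using univ[OF o(2,5,6)] by blast
    have "M O N \<in> PHS0_hom Q Q" using PHS0_hom_compose[OF o(1,2,1) M(1) N(1)] .
    moreover have "(M O N) O R1 = R1" "(M O N) O R2 = R2" using M N by (simp_all add: O_assoc)
    moreover have "hs_ord Q \<in> PHS0_hom Q Q" "hs_ord Q O R1 = R1" "hs_ord Q O R2 = R2"
      using PHS0_hom_id[OF o(1)] PHS0_id_left[OF o(1) S(1) o(3)] PHS0_id_left[OF o(1) S(2) o(4)]
      by simp_all
    ultimately have "M O N = hs_ord Q" using univ[OF o(1,3,4)] by blast
    then show ?thesis using M N by blast
  qed
  have o: "PHS0_obj Q" "PHS0_obj Q'" using Q Q' by (auto simp: PHS0_product_def)
  obtain M N where M: "M \<in> PHS0_hom Q Q'" "M O R1' = R1" "M O R2' = R2" "M O N = hs_ord Q"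
    and N: "N \<in> PHS0_hom Q' Q" "N O R1 = R1'" "N O R2 = R2'"
    using half[OF Q Q'] by blast
  have "N O M = hs_ord Q'"
  proof -
    obtain N' M' where *: "N' \<in> PHS0_hom Q' Q" "M' \<in> PHS0_hom Q Q'" "N' O R1 = R1'" "N' O R2 = R2'"
      "M' O R1' = R1" "M' O R2' = R2" "N' O M' = hs_ord Q'"
      using half[OF Q' Q] by blast
    have h: "R1 \<in> PHS0_hom Q S1" "R2 \<in> PHS0_hom Q S2" "R1' \<in> PHS0_hom Q' S1" "R2' \<in> PHS0_hom Q' S2"
      using Q Q' by (auto simp: PHS0_product_def)
    have "\<exists>!M. M \<in> PHS0_hom Q' Q \<and> M O R1 = R1' \<and> M O R2 = R2'"
      using Q o h by (simp add: PHS0_product_def)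
    then have "N' = N" using * N by blast
    moreover have "\<exists>!M. M \<in> PHS0_hom Q Q' \<and> M O R1' = R1 \<and> M O R2' = R2"
      using Q' o h by (simp add: PHS0_product_def)
    then have "M' = M" using * M by blast
    ultimately show ?thesis using * by simp
  qed
  then show ?thesis using M N o unfolding PHS0_isomorphic_def by blast
qed

text \<open>A bijection \<open>b\<close> from the points of a space to a set carries the topology and the base over,
  and then the graphs above \<open>b\<close> and above its inverse are mutually inverse morphisms.\<close>

lemma PHS0_transport:
  assumes Q: "PHS0_obj Q" and b: "bij_betw b (hs_points Q) Z"
  shows "\<exists>\<tau> \<kappa>. topspace \<tau> = Z \<and> PHS0_obj \<lparr>hs_top = \<tau>, hs_base = \<kappa>\<rparr> \<and>
    PHS0_isomorphic Q \<lparr>hs_top = \<tau>, hs_base = \<kappa>\<rparr>"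
proof -
  let ?X = "hs_top Q" let ?A = "hs_points Q"
  define c where "c = inv_into ?A b"
  have cb: "c (b x) = x" "b x \<in> Z" if "x \<in> ?A" for x
    using b that by (auto simp: c_def bij_betw_def)
  have bc: "b (c z) = z" "c z \<in> ?A" if "z \<in> Z" for z
    using b that by (auto simp: c_def bij_betw_def f_inv_into_f inv_into_into)
  define \<tau> where "\<tau> = pullback_topology Z c ?X"
  define S where "S = \<lparr>hs_top = \<tau>, hs_base = (`) b ` hs_base Q\<rparr>"
  have sel [simp]: "hs_top S = \<tau>" "hs_base S = (`) b ` hs_base Q" by (simp_all add: S_def)
  have Z [simp]: "topspace \<tau> = Z"
    using bc by (auto simp: \<tau>_def topspace_pullback_topology)
  have im: "b ` U = c -` U \<inter> Z" if "U \<subseteq> ?A" for U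
    using that cb bc by (auto simp: image_iff) (metis subsetD)+
  have opn: "openin \<tau> V \<longleftrightarrow> (\<exists>U. openin ?X U \<and> V = b ` U)" for V
    unfolding \<tau>_def openin_pullback_topology using im openin_subset by metis
  have ord: "(y, z) \<in> dual_specialization \<tau> \<longleftrightarrow> y \<in> Z \<and> z \<in> Z \<and> (c y, c z) \<in> hs_ord Q" for y z
  proof -
    have "z \<in> b ` U \<longleftrightarrow> c z \<in> U" if "openin ?X U" "z \<in> Z" for U z
      using im[OF openin_subset[OF that(1)]] that(2) by auto
    then have "(\<forall>V. openin \<tau> V \<longrightarrow> z \<in> V \<longrightarrow> y \<in> V) \<longleftrightarrow> (\<forall>U. openin ?X U \<longrightarrow> c z \<in> U \<longrightarrow> c y \<in> U)"
      if "y \<in> Z" "z \<in> Z" using that unfolding opn by metis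
    then show ?thesis unfolding dual_specialization_iff Z using bc(2) by blast
  qed
  have hom: "homeomorphic_map ?X \<tau> b"
  proof (rule homeomorphic_maps_imp_map)
    show "homeomorphic_maps ?X \<tau> b c"
      unfolding homeomorphic_maps_def
    proof (intro conjI)
      have "openin \<tau> {z \<in> Z. c z \<in> U}" if "openin ?X U" for U
        unfolding \<tau>_def openin_pullback_topology using that by blast
      then show "continuous_map \<tau> ?X c" unfolding continuous_map_def using bc(2) by simp
      have "{x \<in> ?A. b x \<in> b ` U} = U" if "openin ?X U" for U
      proof (intro equalityI subsetI)
        show "x \<in> U" if "x \<in> {x \<in> ?A. b x \<in> b ` U}" for x
          using that openin_subset[OF \<open>openin ?X U\<close>] bij_betw_imp_inj_on[OF b]
            inj_on_image_mem_iff[of b ?A x U] by simp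
        show "x \<in> {x \<in> ?A. b x \<in> b ` U}" if "x \<in> U" for x
          using that openin_subset[OF \<open>openin ?X U\<close>] by blast
      qed
      then show "continuous_map ?X \<tau> b" unfolding continuous_map_def opn using cb(2) by force
    qed (use cb bc in auto)
  qed
  note Q' = PHS0_objD[OF Q]
  have po: "root_system Z (dual_specialization \<tau>)"
  proof (rule root_systemI)
    note poQ = partial_order_onD[OF root_systemD(1)[OF Q'(1)]]
    show "partial_order_on Z (dual_specialization \<tau>)"
    proof (rule partial_order_onI)
      show "dual_specialization \<tau> \<subseteq> Z \<times> Z" using ord by auto
      show "(x, x) \<in> dual_specialization \<tau>" if "x \<in> Z" for x using ord that bc(2) poQ(2) by simp
      show "(x, z) \<in> dual_specialization \<tau>"
        if "(x, y) \<in> dual_specialization \<tau>" "(y, z) \<in> dual_specialization \<tau>" for x y z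
        using that ord poQ(3) by blast
      show "x = y" if "(x, y) \<in> dual_specialization \<tau>" "(y, x) \<in> dual_specialization \<tau>" for x y
        using that ord poQ(4) bc(1) by metis
    qed
    show "(y, z) \<in> dual_specialization \<tau> \<or> (z, y) \<in> dual_specialization \<tau>"
      if "(x, y) \<in> dual_specialization \<tau>" "(x, z) \<in> dual_specialization \<tau>" for x y z
      using that root_systemD(2)[OF Q'(1), of "c x" "c y" "c z"] unfolding ord by blast
  qed
  have bcim: "b ` c ` C = C" if "C \<subseteq> Z" for C
    using that bc(1) by (force simp: image_image)
  have cbim: "c ` b ` D = D" if "D \<subseteq> ?A" for D
    using that cb(1) by (force simp: image_image)
  have closed: "closedin ?X D \<longleftrightarrow> closedin \<tau> (b ` D)" if "D \<subseteq> ?A" for D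
    using homeomorphic_map_closedness_eq[OF hom] that by blast
  have sober: "sober_space \<tau>"
    unfolding sober_space_def
  proof (intro allI impI)
    fix C assume C: "irreducible_closedin \<tau> C"
    then have CZ: "C \<subseteq> Z" using closedin_subset Z unfolding irreducible_closedin_def by metis
    have cA: "c ` C \<subseteq> ?A" using CZ bc(2) by blast
    have "irreducible_closedin ?X (c ` C)"
      unfolding irreducible_closedin_def
    proof (intro conjI allI impI)
      show "closedin ?X (c ` C)" using C closed[OF cA] bcim[OF CZ] by (simp add: irreducible_closedin_def)
      show "c ` C \<noteq> {}" using C by (simp add: irreducible_closedin_def)
      fix C1 C2 assume C12: "closedin ?X C1" "closedin ?X C2" "c ` C = C1 \<union> C2"
      then have sub: "C1 \<subseteq> ?A" "C2 \<subseteq> ?A" using closedin_subset by blast+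
      have "C = b ` C1 \<union> b ` C2" using C12(3) bcim[OF CZ] by (metis image_Un)
      then have "C = b ` C1 \<or> C = b ` C2"
        using C C12 closed[OF sub(1)] closed[OF sub(2)] unfolding irreducible_closedin_def by blast
      then show "c ` C = C1 \<or> c ` C = C2" using cbim sub by metis
    qed
    then obtain x where x: "x \<in> ?A" "?X closure_of {x} = c ` C"
      using Q'(3) unfolding sober_space_def by blast
    have "\<tau> closure_of (b ` {x}) = b ` (?X closure_of {x})"
      using homeomorphic_map_closure_of[OF hom] x(1) by blast
    then have bx: "\<tau> closure_of {b x} = C" using x(2) bcim[OF CZ] by simp
    show "\<exists>!z. z \<in> topspace \<tau> \<and> \<tau> closure_of {z} = C"
    proof (intro ex1I conjI)
      show "b x \<in> topspace \<tau>" using cb(2) x(1) by simp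
      show "\<tau> closure_of {b x} = C" by (rule bx)
      fix z assume z: "z \<in> topspace \<tau> \<and> \<tau> closure_of {z} = C"
      have "z \<in> \<tau> closure_of {z}" "b x \<in> \<tau> closure_of {b x}"
        using closure_of_subset[of "{z}" \<tau>] closure_of_subset[of "{b x}" \<tau>] z cb(2)[OF x(1)] by auto
      then have "(b x, z) \<in> dual_specialization \<tau>" "(z, b x) \<in> dual_specialization \<tau>"
        using z bx cb(2)[OF x(1)] unfolding dual_specialization_def by auto
      then show "z = b x" using partial_order_onD(4)[OF root_systemD(1)[OF po]] by blast
    qed
  qed
  have baseA: "U \<subseteq> ?A" if "U \<in> hs_base Q" for U using openin_subset[OF Q'(4)[OF that]] .
  have "H_space S"
    unfolding H_space_def sel Z
  proof (intro conjI ballI)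
    show "sober_space \<tau>" by (rule sober)
    show "openin \<tau> = arbitrary union_of (\<lambda>U. U \<in> (`) b ` hs_base Q)"
      unfolding openin_topology_base_unique
    proof (intro conjI allI impI)
      show "openin \<tau> V" if "V \<in> (`) b ` hs_base Q" for V using that Q'(4) opn by blast
      fix V z assume V: "openin \<tau> V \<and> z \<in> V"
      then obtain U where U: "openin ?X U" "V = b ` U" using opn by blast
      then obtain x where x: "x \<in> U" "z = b x" using V by blast
      obtain W where "W \<in> hs_base Q" "x \<in> W" "W \<subseteq> U" using Q'(5)[OF U(1) x(1)] by blast
      then show "\<exists>W. W \<in> (`) b ` hs_base Q \<and> z \<in> W \<and> W \<subseteq> V" using U x by blast
    qed
    show "compactin \<tau> V" if V: "V \<in> (`) b ` hs_base Q" for V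
    proof -
      obtain U where U: "U \<in> hs_base Q" "V = b ` U" using V by blast
      then have "compactin ?X U" using Q by (simp add: PHS0_obj_def H_space_def)
      then show ?thesis using image_compactin homeomorphic_imp_continuous_map[OF hom] U(2) by blast
    qed
    fix V1 V2 assume "V1 \<in> (`) b ` hs_base Q" "V2 \<in> (`) b ` hs_base Q"
    then obtain U1 U2 where U: "U1 \<in> hs_base Q" "V1 = b ` U1" "U2 \<in> hs_base Q" "V2 = b ` U2" by blast
    have sub: "U1 \<subseteq> ?A" "U2 \<subseteq> ?A" using baseA U by auto
    have eq: "V1 \<inter> (Z - V2) = b ` (U1 - U2)"
      using U sub b unfolding bij_betw_def by (auto dest: inj_onD)
    have "sat \<tau> (b ` (U1 - U2)) = (dual_specialization \<tau>)\<inverse> `` (b ` (U1 - U2))"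
      by (rule sat_eq_downset) (use sub cb(2) in auto)
    also have "\<dots> = b ` ((hs_ord Q)\<inverse> `` (U1 - U2))"
    proof (intro equalityI subsetI)
      fix z assume "z \<in> (dual_specialization \<tau>)\<inverse> `` (b ` (U1 - U2))"
      then obtain u where u: "u \<in> U1 - U2" "(z, b u) \<in> dual_specialization \<tau>" by blast
      then have "z \<in> Z" "(c z, u) \<in> hs_ord Q" using ord cb(1) sub by auto
      then show "z \<in> b ` ((hs_ord Q)\<inverse> `` (U1 - U2))" using u(1) bc(1) by (intro image_eqI[of _ _ "c z"]) auto
    next
      fix z assume "z \<in> b ` ((hs_ord Q)\<inverse> `` (U1 - U2))"
      then obtain x u where x: "z = b x" "(x, u) \<in> hs_ord Q" "u \<in> U1 - U2" by blast
      then have "x \<in> ?A" "u \<in> ?A" using partial_order_onD(1)[OF root_systemD(1)[OF Q'(1)]] by auto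
      then have "(z, b u) \<in> dual_specialization \<tau>" using x ord cb by simp
      then show "z \<in> (dual_specialization \<tau>)\<inverse> `` (b ` (U1 - U2))" using x(3) by blast
    qed
    finally show "sat \<tau> (V1 \<inter> (Z - V2)) \<in> (`) b ` hs_base Q"
      using eq Q'(6)[OF U(1,3)] by simp
  qed
  moreover have "Z \<in> (`) b ` hs_base Q" using Q'(2) b by (auto simp: bij_betw_def)
  ultimately have S: "PHS0_obj S" using po by (simp add: PHS0_obj_def)
  have f: "base_morphism Q S b"
    unfolding base_morphism_def p_morphism_def sel Z
  proof (intro conjI ballI)
    show "b ` ?A \<subseteq> Z" using cb(2) by blast
    show "b ` (hs_ord Q `` {x}) = dual_specialization \<tau> `` {b x}" if x: "x \<in> ?A" for x
    proof (intro equalityI subsetI)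
      show "z \<in> dual_specialization \<tau> `` {b x}" if z: "z \<in> b ` (hs_ord Q `` {x})" for z
      proof -
        obtain y where y: "(x, y) \<in> hs_ord Q" "z = b y" using z by blast
        then have "y \<in> ?A" using partial_order_onD(1)[OF root_systemD(1)[OF Q'(1)]] by blast
        then show ?thesis using y ord cb x by simp
      qed
      show "z \<in> b ` (hs_ord Q `` {x})" if "z \<in> dual_specialization \<tau> `` {b x}" for z
        using that ord bc cb x by (intro image_eqI[of _ _ "c z"]) auto
    qed
    show "{t \<in> ?A. b t \<in> V} \<in> hs_base Q" if V: "V \<in> (`) b ` hs_base Q" for V
    proof -
      obtain U where U: "U \<in> hs_base Q" "V = b ` U" using V by blast
      have "{t \<in> ?A. b t \<in> V} = U"
        using U(2) baseA[OF U(1)] b unfolding bij_betw_def by (auto dest: inj_onD)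
      then show ?thesis using U(1) by simp
    qed
  qed
  have g: "base_morphism S Q c"
    unfolding base_morphism_def p_morphism_def sel Z
  proof (intro conjI ballI)
    show "c ` Z \<subseteq> ?A" using bc(2) by blast
    show "c ` (dual_specialization \<tau> `` {z}) = hs_ord Q `` {c z}" if z: "z \<in> Z" for z
    proof (intro equalityI subsetI)
      show "x \<in> hs_ord Q `` {c z}" if "x \<in> c ` (dual_specialization \<tau> `` {z})" for x
        using that ord by auto
      fix x assume x: "x \<in> hs_ord Q `` {c z}"
      then have "x \<in> ?A" using partial_order_onD(1)[OF root_systemD(1)[OF Q'(1)]] by blast
      then show "x \<in> c ` (dual_specialization \<tau> `` {z})"
        using ord cb x z by (intro image_eqI[of _ _ "b x"]) auto
    qed
    show "{t \<in> Z. c t \<in> U} \<in> (`) b ` hs_base Q" if U: "U \<in> hs_base Q" for U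
    proof -
      have "{t \<in> Z. c t \<in> U} = b ` U" using im[OF baseA[OF U]] by auto
      then show ?thesis using U by blast
    qed
  qed
  have "above_graph Q S b O above_graph S Q c = hs_ord Q"
    using above_graph_compose[OF f g S Q] above_graph_id[OF Q] above_graph_cong[of Q "c \<circ> b" id Q] cb(1) by simp
  moreover have "above_graph S Q c O above_graph Q S b = hs_ord S"
    using above_graph_compose[OF g f Q S] above_graph_id[OF S] above_graph_cong[of S "b \<circ> c" id S] bc(1) by simp
  ultimately have "PHS0_isomorphic Q S"
    using Q S above_graph_in_PHS0_hom[OF Q S f] above_graph_in_PHS0_hom[OF S Q g]
    unfolding PHS0_isomorphic_def by blast
  then show ?thesis using S Z unfolding S_def by blast
qed

section \<open>Finite spaces\<close>

definition alexandrov :: "'a set \<Rightarrow> 'a rel \<Rightarrow> 'a topology" where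
  "alexandrov A r = topology (\<lambda>U. U \<subseteq> A \<and> r\<inverse> `` U \<subseteq> U)"

lemma openin_alexandrov: "openin (alexandrov A r) U \<longleftrightarrow> U \<subseteq> A \<and> r\<inverse> `` U \<subseteq> U"
proof -
  have "istopology (\<lambda>U. U \<subseteq> A \<and> r\<inverse> `` U \<subseteq> U)"
    unfolding istopology_def by blast
  then show ?thesis by (simp add: alexandrov_def)
qed

lemma topspace_alexandrov [simp]:
  assumes "r \<subseteq> A \<times> A"
  shows "topspace (alexandrov A r) = A"
proof
  show "topspace (alexandrov A r) \<subseteq> A" unfolding topspace_def openin_alexandrov by blast
  have "openin (alexandrov A r) A" using assms by (auto simp: openin_alexandrov)
  then show "A \<subseteq> topspace (alexandrov A r)" by (rule openin_subset)
qed

lemma dual_specialization_alexandrov: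
  assumes "partial_order_on A r"
  shows "dual_specialization (alexandrov A r) = r"
proof -
  note r = partial_order_onD[OF assms]
  have "(x, y) \<in> dual_specialization (alexandrov A r) \<longleftrightarrow> (x, y) \<in> r" for x y
  proof
    assume xy: "(x, y) \<in> dual_specialization (alexandrov A r)"
    then have y: "y \<in> A" using r(1) by (simp add: dual_specialization_iff)
    have "openin (alexandrov A r) (r\<inverse> `` {y})"
      unfolding openin_alexandrov using r(1,3) by blast
    moreover have "y \<in> r\<inverse> `` {y}" using r(2)[OF y] by blast
    ultimately have "x \<in> r\<inverse> `` {y}" using xy unfolding dual_specialization_iff by blast
    then show "(x, y) \<in> r" by blast
  next
    assume "(x, y) \<in> r"
    then show "(x, y) \<in> dual_specialization (alexandrov A r)"
      using r(1) unfolding dual_specialization_iff topspace_alexandrov[OF r(1)] openin_alexandrov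
      by blast
  qed
  then show ?thesis by auto
qed

lemma sober_space_alexandrov:
  assumes po: "partial_order_on A r" and fin: "finite A"
  shows "sober_space (alexandrov A r)"
  unfolding sober_space_def
proof (intro allI impI)
  note r = partial_order_onD[OF po]
  let ?X = "alexandrov A r"
  have cl: "?X closure_of {x} = r `` {x}" if "x \<in> A" for x
    using closure_of_singleton[of x ?X] that dual_specialization_alexandrov[OF po] r(1) by simp
  have closed: "closedin ?X C \<longleftrightarrow> C \<subseteq> A \<and> r `` C \<subseteq> C" for C
    unfolding closedin_def openin_alexandrov topspace_alexandrov[OF r(1)] using r(1) by blast
  fix C assume C: "irreducible_closedin ?X C"
  then have C': "C \<subseteq> A" "r `` C \<subseteq> C" "C \<noteq> {}" by (auto simp: irreducible_closedin_def closed)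
  have "partial_order_on A (r\<inverse>)" using po by (simp add: partial_order_on_converse)
  then obtain m where m: "m \<in> C" "\<forall>y\<in>C. (y, m) \<in> r \<longrightarrow> y = m"
    using finite_maximal_above[of A "r\<inverse>" C] finite_subset[OF C'(1) fin] C'(1,3) by blast
  \<comment> \<open>\<open>C\<close> is the union of the closed sets \<open>r `` {m}\<close> and \<open>?C2\<close>, and the latter misses \<open>m\<close>.\<close>
  let ?C2 = "r `` (C - r `` {m})"
  have mm: "(m, m) \<in> r" using m(1) C'(1) r(2) by blast
  have "C = r `` {m} \<union> ?C2" using C' m(1) r(2) by blast
  moreover have "closedin ?X (r `` {m})" "closedin ?X ?C2" unfolding closed using r(1,3) by blast+
  moreover have "m \<notin> ?C2" using m mm C' by blast
  ultimately have "C = r `` {m}" using C m(1) unfolding irreducible_closedin_def by blast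
  then have "?X closure_of {m} = C" "m \<in> A" using cl m(1) C'(1) by auto
  moreover have "x = m" if "x \<in> A" "?X closure_of {x} = C" for x
  proof -
    have "r `` {x} = r `` {m}" using that cl[OF that(1)] \<open>C = r `` {m}\<close> by simp
    then have "(x, m) \<in> r" "(m, x) \<in> r" using mm r(2)[OF that(1)] by auto
    then show ?thesis using r(4) by blast
  qed
  ultimately show "\<exists>!x. x \<in> topspace ?X \<and> ?X closure_of {x} = C"
    unfolding topspace_alexandrov[OF r(1)] by blast
qed

text \<open>On a finite root system, a family of downsets that contains the whole set and is closed under
  \<open>(U \<inter> V\<^sup>c]\<close> contains every principal downset as soon as it separates points.
  The operation removes from \<open>U\<close> the trees whose root is in \<open>V\<close> and keeps the others. So it is
  enough to find a member in which \<open>w\<close> is a root, and then to remove the other trees.\<close>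

lemma principal_downset_in_base:
  assumes fin: "finite A" and rs: "root_system A r" and A: "A \<in> \<kappa>"
    and down: "\<And>U. U \<in> \<kappa> \<Longrightarrow> U \<subseteq> A \<and> r\<inverse> `` U \<subseteq> U"
    and diff: "\<And>U V. U \<in> \<kappa> \<Longrightarrow> V \<in> \<kappa> \<Longrightarrow> r\<inverse> `` (U - V) \<in> \<kappa>"
    and sep: "\<And>x y. x \<in> A \<Longrightarrow> y \<in> A \<Longrightarrow> (x, y) \<notin> r \<Longrightarrow> \<exists>V\<in>\<kappa>. y \<in> V \<and> x \<notin> V"
    and w: "w \<in> A"
  shows "r\<inverse> `` {w} \<in> \<kappa>"
proof -
  note po = root_systemD(1)[OF rs]
  note r = partial_order_onD[OF po]
  define good where "good U \<longleftrightarrow> U \<in> \<kappa> \<and> w \<in> U \<and> (\<forall>v\<in>U. (w, v) \<in> r \<longrightarrow> v = w)" for U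
  \<comment> \<open>If \<open>w\<close> is not a root of \<open>A\<close>, a member that contains \<open>w\<close> but not its upper cover \<open>m\<close> has \<open>w\<close> as
    a root.\<close>
  have "\<exists>U. good U"
  proof (cases "\<exists>v\<in>A. (w, v) \<in> r \<and> v \<noteq> w")
    case False
    then show ?thesis using A w unfolding good_def by blast
  next
    case True
    let ?S = "{v \<in> A. (w, v) \<in> r \<and> v \<noteq> w}"
    have "\<exists>m\<in>?S. \<forall>v\<in>?S. (m, v) \<in> r"
      using True root_systemD(2)[OF rs] by (intro finite_chain_least[OF po]) (use fin in auto)
    then obtain m where m: "m \<in> A" "(w, m) \<in> r" "m \<noteq> w" "\<forall>v\<in>?S. (m, v) \<in> r" by blast
    then have "(m, w) \<notin> r" using r(4) by blast
    then obtain V where V: "V \<in> \<kappa>" "w \<in> V" "m \<notin> V" using sep m(1) w by blast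
    have "v = w" if "v \<in> V" "(w, v) \<in> r" for v
      using that down[OF V(1)] V(3) m(4) by blast
    then show ?thesis using V unfolding good_def by blast
  qed
  then obtain U where U: "good U" and least: "\<And>V. good V \<Longrightarrow> card U \<le> card V"
    using ex_has_least_nat[of good _ card] by blast
  have Uk: "U \<in> \<kappa>" "w \<in> U" "\<forall>v\<in>U. (w, v) \<in> r \<longrightarrow> v = w" using U by (auto simp: good_def)
  have U': "U \<subseteq> A" "r\<inverse> `` U \<subseteq> U" "finite U" using down[OF Uk(1)] finite_subset[OF _ fin] by auto
  have "(x, w) \<in> r" if x: "x \<in> U" for x
  proof (rule ccontr)
    assume not: "(x, w) \<notin> r"
    obtain m where m: "m \<in> U" "(x, m) \<in> r" "\<forall>y\<in>U. (m, y) \<in> r \<longrightarrow> y = m"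
      using finite_maximal_above[OF po U'(3,1) x] by blast
    have "m \<noteq> w" using m(2) not by blast
    then have "(w, m) \<notin> r" using Uk(3) m(1) by blast
    then obtain V where V: "V \<in> \<kappa>" "m \<in> V" "w \<notin> V" using sep w m(1) U'(1) by blast
    let ?U = "r\<inverse> `` (U - V)"
    have sub: "?U \<subseteq> U" using U'(2) by blast
    have "w \<in> ?U" using Uk(2) V(3) r(2)[OF w] by blast
    then have "good ?U" using diff[OF Uk(1) V(1)] Uk(3) sub unfolding good_def by blast
    moreover have "m \<notin> ?U" using m(3) V(2) by blast
    then have "card ?U < card U" using sub m(1) U'(3) by (intro psubset_card_mono) auto
    ultimately show False using least by fastforce
  qed
  then have "U = r\<inverse> `` {w}" using Uk(2) U'(2) by blast
  then show ?thesis using Uk(1) by simp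
qed

lemma finite_PHS0_objI:
  assumes fin: "finite A" and rs: "root_system A r" and A: "A \<in> \<kappa>"
    and down: "\<And>U. U \<in> \<kappa> \<Longrightarrow> U \<subseteq> A \<and> r\<inverse> `` U \<subseteq> U"
    and diff: "\<And>U V. U \<in> \<kappa> \<Longrightarrow> V \<in> \<kappa> \<Longrightarrow> r\<inverse> `` (U - V) \<in> \<kappa>"
    and sep: "\<And>x y. x \<in> A \<Longrightarrow> y \<in> A \<Longrightarrow> (x, y) \<notin> r \<Longrightarrow> \<exists>V\<in>\<kappa>. y \<in> V \<and> x \<notin> V"
  shows "PHS0_obj \<lparr>hs_top = alexandrov A r, hs_base = \<kappa>\<rparr>"
proof -
  note po = root_systemD(1)[OF rs]
  note r = partial_order_onD[OF po]
  let ?X = "alexandrov A r"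
  have base: "openin ?X = arbitrary union_of (\<lambda>U. U \<in> \<kappa>)"
    unfolding openin_topology_base_unique
  proof (intro conjI allI impI)
    show "openin ?X V" if "V \<in> \<kappa>" for V using down[OF that] by (simp add: openin_alexandrov)
    fix U x assume U: "openin ?X U \<and> x \<in> U"
    then have "U \<subseteq> A" "r\<inverse> `` U \<subseteq> U" by (auto simp: openin_alexandrov)
    moreover have "r\<inverse> `` {x} \<in> \<kappa>"
      using principal_downset_in_base[OF fin rs A down diff sep] U calculation(1) by blast
    moreover have "x \<in> r\<inverse> `` {x}" using U calculation(1) r(2) by blast
    ultimately show "\<exists>V. V \<in> \<kappa> \<and> x \<in> V \<and> V \<subseteq> U" using U by blast
  qed
  have "compactin ?X U" if "U \<in> \<kappa>" for U
    using down[OF that] finite_subset[OF _ fin] r(1) by (intro finite_imp_compactin) auto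
  moreover have "sat ?X (U \<inter> (A - V)) \<in> \<kappa>" if "U \<in> \<kappa>" "V \<in> \<kappa>" for U V
  proof -
    have "U \<inter> (A - V) = U - V" using down[OF that(1)] by blast
    moreover have "sat ?X (U - V) = r\<inverse> `` (U - V)"
      using sat_eq_downset[of "U - V" ?X] down[OF that(1)] r(1) dual_specialization_alexandrov[OF po]
      by auto
    ultimately show ?thesis using diff[OF that] by simp
  qed
  ultimately show ?thesis
    using base sober_space_alexandrov[OF po fin] r(1) rs A dual_specialization_alexandrov[OF po]
    by (simp add: PHS0_obj_def H_space_def)
qed


section \<open>The product in the category of root-system Hilbert spaces\<close>

context staircase_poset
begin

text \<open>The least family that makes both projections morphisms. It is preserved by inverse images
  under every lift, because the two generating families and the operation are.\<close>

inductive_set product_base :: "'a set set \<Rightarrow> 'b set set \<Rightarrow> 'w set set"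
  for \<kappa>1 :: "'a set set" and \<kappa>2 :: "'b set set" where
  left: "U \<in> \<kappa>1 \<Longrightarrow> {w \<in> P. proj1 w \<in> U} \<in> product_base \<kappa>1 \<kappa>2"
| right: "V \<in> \<kappa>2 \<Longrightarrow> {w \<in> P. proj2 w \<in> V} \<in> product_base \<kappa>1 \<kappa>2"
| diff: "U \<in> product_base \<kappa>1 \<kappa>2 \<Longrightarrow> V \<in> product_base \<kappa>1 \<kappa>2 \<Longrightarrow>
    leq\<inverse> `` (U - V) \<in> product_base \<kappa>1 \<kappa>2"

lemma product_base_downset:
  assumes U: "U \<in> product_base \<kappa>1 \<kappa>2"
    and down1: "\<And>U. U \<in> \<kappa>1 \<Longrightarrow> r\<inverse> `` U \<subseteq> U" and down2: "\<And>V. V \<in> \<kappa>2 \<Longrightarrow> s\<inverse> `` V \<subseteq> V"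
  shows "U \<subseteq> P \<and> leq\<inverse> `` U \<subseteq> U"
  using U
proof induction
  note leq = partial_order_onD[OF leq_partial_order]
  case (left U)
  have "v \<in> P \<and> proj1 v \<in> U" if "(v, w) \<in> leq" "proj1 w \<in> U" for v w
    using that p_morphismD(3)[OF proj1_p_morphism _ that(1)] leqD(1)[OF that(1)] down1[OF left] by blast
  then show ?case by blast
next
  case (right V)
  have "v \<in> P \<and> proj2 v \<in> V" if "(v, w) \<in> leq" "proj2 w \<in> V" for v w
    using that p_morphismD(3)[OF proj2_p_morphism _ that(1)] leqD(1)[OF that(1)] down2[OF right] by blast
  then show ?case by blast
next
  case (diff U V)
  then show ?case using partial_order_onD(1,3)[OF leq_partial_order] by blast
qed

text \<open>Since a staircase is a chain, the two points given are comparable, and the lower one is \<open>(x, y)\<close>.\<close>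

lemma staircase_row_column:
  assumes w: "w \<in> P"
    and x: "(x, y') \<in> st w" "(y, y') \<in> s" and y: "(x', y) \<in> st w" "(x, x') \<in> r"
  shows "(x, y) \<in> st w"
proof (cases "(x, y') \<preceq> (x', y)")
  case True
  then have "y = y'" using x(2) partial_order_onD(4)[OF factors(2)] unfolding prod_ord_iff by auto
  then show ?thesis using x by simp
next
  case False
  then have "(x', y) \<preceq> (x, y')" using stD(3)[OF w x(1) y(1)] by blast
  then have "x = x'" using y(2) partial_order_onD(4)[OF factors(1)] unfolding prod_ord_iff by auto
  then show ?thesis using y by simp
qed

lemma greatest_in_row:
  assumes w: "w \<in> P" and ne: "(x0, y) \<in> st w"
  shows "\<exists>x. (x, y) \<in> st w \<and> (x0, x) \<in> r \<and> (\<forall>d\<in>st w. (snd d, y) \<in> s \<longrightarrow> (fst d, x) \<in> r)"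
proof -
  let ?R = "{d \<in> st w. (snd d, y) \<in> s}"
  have po: "partial_order_on (A \<times> B) (prod_ord r s)"
    by (rule partial_order_on_prod_ord[OF factors])
  have y: "y \<in> B" using ne stD(2)[OF w] by blast
  have in_R: "(x0, y) \<in> ?R" using ne partial_order_onD(2)[OF factors(2) y] by simp
  have "\<exists>m\<in>?R. \<forall>d\<in>?R. d \<preceq> m"
    by (rule finite_chain_greatest[OF po]) (use finite_st[OF w] stD(2,3)[OF w] in_R in auto)
  then obtain m where m: "m \<in> st w" "(snd m, y) \<in> s" "\<forall>d\<in>?R. d \<preceq> m" by blast
  have "(y, snd m) \<in> s" "(x0, fst m) \<in> r" using m(3) in_R unfolding prod_ord_iff by auto
  then have "m = (fst m, y)" using m(2) partial_order_onD(4)[OF factors(2)] by (simp add: prod_eq_iff)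
  then show ?thesis using m \<open>(x0, fst m) \<in> r\<close> unfolding prod_ord_iff by (metis (no_types, lifting) mem_Collect_eq)
qed

lemma greatest_in_column:
  assumes w: "w \<in> P" and ne: "(x, y0) \<in> st w"
  shows "\<exists>y. (x, y) \<in> st w \<and> (y0, y) \<in> s \<and> (\<forall>d\<in>st w. (fst d, x) \<in> r \<longrightarrow> (snd d, y) \<in> s)"
proof -
  let ?R = "{d \<in> st w. (fst d, x) \<in> r}"
  have po: "partial_order_on (A \<times> B) (prod_ord r s)"
    by (rule partial_order_on_prod_ord[OF factors])
  have x: "x \<in> A" using ne stD(2)[OF w] by blast
  have in_R: "(x, y0) \<in> ?R" using ne partial_order_onD(2)[OF factors(1) x] by simp
  have "\<exists>m\<in>?R. \<forall>d\<in>?R. d \<preceq> m"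
    by (rule finite_chain_greatest[OF po]) (use finite_st[OF w] stD(2,3)[OF w] in_R in auto)
  then obtain m where m: "m \<in> st w" "(fst m, x) \<in> r" "\<forall>d\<in>?R. d \<preceq> m" by blast
  have "(x, fst m) \<in> r" "(y0, snd m) \<in> s" using m(3) in_R unfolding prod_ord_iff by auto
  then have "m = (x, snd m)" using m(2) partial_order_onD(4)[OF factors(1)] by (simp add: prod_eq_iff)
  then show ?thesis using m \<open>(y0, snd m) \<in> s\<close> unfolding prod_ord_iff by (metis (no_types, lifting) mem_Collect_eq)
qed

lemma downset_by_point:
  "leq\<inverse> `` {v \<in> P. Q (foot v)} = {v \<in> P. \<exists>d\<in>st v. Q d}"
proof (intro equalityI subsetI)
  fix v assume "v \<in> leq\<inverse> `` {v \<in> P. Q (foot v)}"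
  then obtain u where "(v, u) \<in> leq" "Q (foot u)" by blast
  then show "v \<in> {v \<in> P. \<exists>d\<in>st v. Q d}" using leqD(1,2,3) foot(1) by blast
next
  fix v assume "v \<in> {v \<in> P. \<exists>d\<in>st v. Q d}"
  then obtain d where d: "v \<in> P" "d \<in> st v" "Q d" by blast
  then obtain u where "(v, u) \<in> leq" "foot u = d" using upper_part by blast
  then show "v \<in> leq\<inverse> `` {v \<in> P. Q (foot v)}" using d(3) leqD(2) by blast
qed

text \<open>Let \<open>w\<close> belong to every member that contains \<open>w'\<close>. Besides the inverse images under the
  projections, the members used are \<open>{v. \<exists>d\<in>st v. fst d \<le> a \<and> \<not> snd d \<le> b}\<close> and the downset of
  \<open>{v. proj2 v \<le> b \<and> (\<forall>d\<in>st v. fst d \<le> a \<longrightarrow> snd d \<le> b)}\<close>, and their mirror images. The former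
  show that \<open>w\<close> runs through all points of \<open>w'\<close>: for \<open>(x, y) \<in> st w'\<close>, the highest points of \<open>w\<close> in
  the column \<open>x\<close> and in the row \<open>y\<close> are at least \<open>(x, y)\<close>, so that \<open>staircase_row_column\<close> applies.
  The latter show in the same way that \<open>w\<close> has no other points above the foot of \<open>w'\<close>.\<close>

lemma product_base_separates:
  assumes k1: "\<And>a. a \<in> A \<Longrightarrow> r\<inverse> `` {a} \<in> \<kappa>1" and k2: "\<And>b. b \<in> B \<Longrightarrow> s\<inverse> `` {b} \<in> \<kappa>2"
    and w: "w \<in> P" "w' \<in> P"
    and all: "\<And>V. V \<in> product_base \<kappa>1 \<kappa>2 \<Longrightarrow> w' \<in> V \<Longrightarrow> w \<in> V"
  shows "(w, w') \<in> leq"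
proof -
  note r = partial_order_onD[OF factors(1)] and s = partial_order_onD[OF factors(2)]
  define L1 where "L1 a = {v \<in> P. (proj1 v, a) \<in> r}" for a
  define L2 where "L2 b = {v \<in> P. (proj2 v, b) \<in> s}" for b
  define D1 where "D1 a b = {v \<in> P. \<exists>d\<in>st v. (fst d, a) \<in> r \<and> (snd d, b) \<notin> s}" for a b
  define D2 where "D2 a b = {v \<in> P. \<exists>d\<in>st v. (snd d, b) \<in> s \<and> (fst d, a) \<notin> r}" for a b
  have L1: "L1 a \<in> product_base \<kappa>1 \<kappa>2" if "a \<in> A" for a
    using product_base.left[OF k1[OF that]] by (simp add: L1_def)
  have L2: "L2 b \<in> product_base \<kappa>1 \<kappa>2" if "b \<in> B" for b
    using product_base.right[OF k2[OF that]] by (simp add: L2_def)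
  have D1: "D1 a b \<in> product_base \<kappa>1 \<kappa>2" if "a \<in> A" "b \<in> B" for a b
  proof -
    have "L1 a - L2 b = {v \<in> P. (fst (foot v), a) \<in> r \<and> (snd (foot v), b) \<notin> s}"
      by (auto simp: L1_def L2_def proj1_def proj2_def)
    then have "leq\<inverse> `` (L1 a - L2 b) = D1 a b"
      using downset_by_point[of "\<lambda>d. (fst d, a) \<in> r \<and> (snd d, b) \<notin> s"] by (simp add: D1_def)
    then show ?thesis using product_base.diff[OF L1[OF that(1)] L2[OF that(2)]] by simp
  qed
  have D2: "D2 a b \<in> product_base \<kappa>1 \<kappa>2" if "a \<in> A" "b \<in> B" for a b
  proof -
    have "L2 b - L1 a = {v \<in> P. (snd (foot v), b) \<in> s \<and> (fst (foot v), a) \<notin> r}"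
      by (auto simp: L1_def L2_def proj1_def proj2_def)
    then have "leq\<inverse> `` (L2 b - L1 a) = D2 a b"
      using downset_by_point[of "\<lambda>d. (snd d, b) \<in> s \<and> (fst d, a) \<notin> r"] by (simp add: D2_def)
    then show ?thesis using product_base.diff[OF L2[OF that(2)] L1[OF that(1)]] by simp
  qed
  obtain a' b' where foot': "foot w' = (a', b')" by fastforce
  have ab': "(a', b') \<in> st w'" "a' \<in> A" "b' \<in> B"
    using foot(1)[OF w(2)] stD(2)[OF w(2)] foot' by auto
  have below: "foot w \<preceq> (a', b')"
  proof -
    have "w' \<in> L1 a'" "w' \<in> L2 b'" using w(2) foot' r(2) s(2) ab' by (auto simp: L1_def L2_def proj1_def proj2_def)
    then have "w \<in> L1 a'" "w \<in> L2 b'" using all L1 L2 ab' by blast+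
    then show ?thesis by (simp add: L1_def L2_def proj1_def proj2_def prod_ord_iff)
  qed
  have foot_le': "(a', fst d) \<in> r" "(b', snd d) \<in> s" if "d \<in> st w'" for d
    using foot(2)[OF w(2) that] foot' unfolding prod_ord_iff by auto
  have sub: "st w' \<subseteq> st w"
  proof
    fix d assume d: "d \<in> st w'"
    obtain x y where xy: "d = (x, y)" by fastforce
    have xA: "x \<in> A" "y \<in> B" using d xy stD(2)[OF w(2)] by auto
    have "(fst (foot w), x) \<in> r" "(snd (foot w), y) \<in> s"
      using foot_le'[OF d] below r(3) s(3) xy unfolding prod_ord_iff by auto
    then obtain x0 y0 where ne: "(x0, y) \<in> st w" "(x, y0) \<in> st w"
      using stD(4)[OF w(1) foot(1)[OF w(1)]] stD(5)[OF w(1) foot(1)[OF w(1)]] by blast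
    obtain x' y' where x': "(x', y) \<in> st w" "\<forall>d\<in>st w. (snd d, y) \<in> s \<longrightarrow> (fst d, x') \<in> r"
      and y': "(x, y') \<in> st w" "\<forall>d\<in>st w. (fst d, x) \<in> r \<longrightarrow> (snd d, y') \<in> s"
      using greatest_in_row[OF w(1) ne(1)] greatest_in_column[OF w(1) ne(2)] by blast
    have A': "x' \<in> A" "y' \<in> B" using x'(1) y'(1) stD(2)[OF w(1)] by auto
    have "(x, x') \<in> r"
    proof (rule ccontr)
      assume "(x, x') \<notin> r"
      then have "w' \<in> D2 x' y" using d xy w(2) s(2)[OF xA(2)] by (force simp: D2_def)
      then have "w \<in> D2 x' y" using all D2[OF A'(1) xA(2)] by blast
      then show False using x'(2) by (auto simp: D2_def)
    qed
    moreover have "(y, y') \<in> s"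
    proof (rule ccontr)
      assume "(y, y') \<notin> s"
      then have "w' \<in> D1 x y'" using d xy w(2) r(2)[OF xA(1)] by (force simp: D1_def)
      then have "w \<in> D1 x y'" using all D1[OF xA(1) A'(2)] by blast
      then show False using y'(2) by (auto simp: D1_def)
    qed
    ultimately show "d \<in> st w" using staircase_row_column[OF w(1)] x'(1) y'(1) xy by blast
  qed
  have upper: "c \<in> st w'" if c: "c \<in> st w" and dc: "d \<in> st w'" "d \<preceq> c" for c d
  proof -
    obtain x y where xy: "c = (x, y)" by fastforce
    have xA: "x \<in> A" "y \<in> B" using c xy stD(2)[OF w(1)] by auto
    have "(fst (foot w'), x) \<in> r" "(snd (foot w'), y) \<in> s"
      using foot_le'[OF dc(1)] dc(2) r(3) s(3) xy foot' unfolding prod_ord_iff by auto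
    then obtain x0 y0 where ne: "(x0, y) \<in> st w'" "(x, y0) \<in> st w'"
      using stD(4)[OF w(2) foot(1)[OF w(2)]] stD(5)[OF w(2) foot(1)[OF w(2)]] by blast
    obtain x' y' where x': "(x', y) \<in> st w'" "\<forall>d\<in>st w'. (snd d, y) \<in> s \<longrightarrow> (fst d, x') \<in> r"
      and y': "(x, y') \<in> st w'" "\<forall>d\<in>st w'. (fst d, x) \<in> r \<longrightarrow> (snd d, y') \<in> s"
      using greatest_in_row[OF w(2) ne(1)] greatest_in_column[OF w(2) ne(2)] by blast
    have A': "x' \<in> A" "y' \<in> B" using x'(1) y'(1) stD(2)[OF w(2)] by auto
    have "(x, x') \<in> r"
    proof (rule ccontr)
      assume not: "(x, x') \<notin> r"
      have "w' \<in> L1 x' - D2 x' y"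
        using w(2) foot_le'(1)[OF x'(1)] x'(2) foot' by (auto simp: L1_def D2_def proj1_def)
      then have "w' \<in> leq\<inverse> `` (L1 x' - D2 x' y)"
        using partial_order_onD(2)[OF leq_partial_order w(2)] by blast
      then have "w \<in> leq\<inverse> `` (L1 x' - D2 x' y)"
        using all product_base.diff[OF L1[OF A'(1)] D2[OF A'(1) xA(2)]] by blast
      then obtain u where u: "(w, u) \<in> leq" "(fst (foot u), x') \<in> r" "u \<notin> D2 x' y"
        by (auto simp: L1_def proj1_def)
      have uP: "u \<in> P" using leqD(2)[OF u(1)] .
      \<comment> \<open>Either \<open>c\<close> lies above the foot of \<open>u\<close>, hence belongs to \<open>u\<close>, or it lies below it and so
        its first coordinate is at most \<open>x'\<close>.\<close>
      have "foot u \<preceq> c \<or> c \<preceq> foot u"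
        using stD(3)[OF w(1)] c foot(1)[OF uP] leqD(3)[OF u(1)] by blast
      then show False
      proof
        assume "foot u \<preceq> c"
        then have "c \<in> st u" using leqD(4)[OF u(1) foot(1)[OF uP] c] by blast
        then show False using u(3) uP not xy s(2)[OF xA(2)] by (force simp: D2_def)
      next
        assume "c \<preceq> foot u"
        then have "(x, x') \<in> r" using u(2) r(3) xy unfolding prod_ord_iff by auto
        then show False using not by blast
      qed
    qed
    moreover have "(y, y') \<in> s"
    proof (rule ccontr)
      assume not: "(y, y') \<notin> s"
      have "w' \<in> L2 y' - D1 x y'"
        using w(2) foot_le'(2)[OF y'(1)] y'(2) foot' by (auto simp: L2_def D1_def proj2_def)
      then have "w' \<in> leq\<inverse> `` (L2 y' - D1 x y')"
        using partial_order_onD(2)[OF leq_partial_order w(2)] by blast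
      then have "w \<in> leq\<inverse> `` (L2 y' - D1 x y')"
        using all product_base.diff[OF L2[OF A'(2)] D1[OF xA(1) A'(2)]] by blast
      then obtain u where u: "(w, u) \<in> leq" "(snd (foot u), y') \<in> s" "u \<notin> D1 x y'"
        by (auto simp: L2_def proj2_def)
      have uP: "u \<in> P" using leqD(2)[OF u(1)] .
      have "foot u \<preceq> c \<or> c \<preceq> foot u"
        using stD(3)[OF w(1)] c foot(1)[OF uP] leqD(3)[OF u(1)] by blast
      then show False
      proof
        assume "foot u \<preceq> c"
        then have "c \<in> st u" using leqD(4)[OF u(1) foot(1)[OF uP] c] by blast
        then show False using u(3) uP not xy r(2)[OF xA(1)] by (force simp: D1_def)
      next
        assume "c \<preceq> foot u"
        then have "(y, y') \<in> s" using u(2) s(3) xy unfolding prod_ord_iff by auto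
        then show False using not by blast
      qed
    qed
    ultimately show "c \<in> st w'" using staircase_row_column[OF w(2)] x'(1) y'(1) xy by blast
  qed
  show ?thesis using w sub upper unfolding leq_def by blast
qed

end

lemma finite_principal_downset:
  assumes S: "PHS0_obj S" and fin: "finite (hs_points S)" and a: "a \<in> hs_points S"
  shows "(hs_ord S)\<inverse> `` {a} \<in> hs_base S"
proof (rule principal_downset_in_base[OF fin _ _ _ _ _ a])
  note S' = PHS0_objD[OF S]
  show "root_system (hs_points S) (hs_ord S)" "hs_points S \<in> hs_base S" using S' by auto
  show "U \<subseteq> hs_points S \<and> (hs_ord S)\<inverse> `` U \<subseteq> U" if "U \<in> hs_base S" for U
    using openin_subset[OF S'(4)[OF that]] openin_downset[OF S'(4)[OF that]] by blast
  show "(hs_ord S)\<inverse> `` (U - V) \<in> hs_base S" if "U \<in> hs_base S" "V \<in> hs_base S" for U V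
    using S'(6) that .
  show "\<exists>V\<in>hs_base S. y \<in> V \<and> x \<notin> V"
    if xy: "x \<in> hs_points S" "y \<in> hs_points S" "(x, y) \<notin> hs_ord S" for x y
  proof -
    obtain U where U: "openin (hs_top S) U" "y \<in> U" "x \<notin> U"
      using xy by (auto simp: dual_specialization_iff)
    then show ?thesis using S'(5)[OF U(1,2)] by blast
  qed
qed

text \<open>The poset of the product depends only on the posets of the factors. The bases of the factors
  determine only the base of the product.\<close>

lemma staircase_PHS0_product:
  fixes S1 :: "'a hspace" and S2 :: "'b hspace" and P :: "'w set"
  assumes S: "PHS0_obj S1" "PHS0_obj S2" and fin: "finite (hs_points S1)" "finite (hs_points S2)"
    and st: "bij_betw st P (staircases (hs_ord S1) (hs_ord S2) (hs_points S1) (hs_points S2))"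
  shows "\<exists>(Q :: 'w hspace) R1 R2. PHS0_product Q R1 R2 S1 S2 \<and> hs_points Q = P"
proof -
  note S1 = PHS0_objD[OF S(1)] and S2 = PHS0_objD[OF S(2)]
  interpret staircase_poset "hs_points S1" "hs_ord S1" "hs_points S2" "hs_ord S2" P st
    by unfold_locales (use fin st root_systemD(1)[OF S1(1)] root_systemD(1)[OF S2(1)] in auto)
  let ?\<kappa> = "product_base (hs_base S1) (hs_base S2)"
  define Q where "Q = \<lparr>hs_top = alexandrov P leq, hs_base = ?\<kappa>\<rparr>"
  have down: "U \<subseteq> P \<and> leq\<inverse> `` U \<subseteq> U" if "U \<in> ?\<kappa>" for U
  proof (rule product_base_downset[OF that])
    show "(hs_ord S1)\<inverse> `` U \<subseteq> U" if "U \<in> hs_base S1" for U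
      using openin_downset[OF S1(4)[OF that]] by blast
    show "(hs_ord S2)\<inverse> `` V \<subseteq> V" if "V \<in> hs_base S2" for V
      using openin_downset[OF S2(4)[OF that]] by blast
  qed
  have P: "P \<in> ?\<kappa>"
  proof -
    have "{w \<in> P. proj1 w \<in> hs_points S1} = P" using p_morphismD(1)[OF proj1_p_morphism] by blast
    then show ?thesis using product_base.left[OF S1(2), of "hs_base S2"] by simp
  qed
  have sep: "\<exists>V\<in>?\<kappa>. w' \<in> V \<and> w \<notin> V" if "w \<in> P" "w' \<in> P" "(w, w') \<notin> leq" for w w'
    using product_base_separates[OF finite_principal_downset[OF S(1) fin(1)]
        finite_principal_downset[OF S(2) fin(2)] that(1,2)] that(3) by blast
  have Q: "PHS0_obj Q"
    unfolding Q_def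
    by (rule finite_PHS0_objI[OF finite_points leq_root_system P down product_base.diff sep])
  have sel [simp]: "hs_points Q = P" "hs_ord Q = leq" "hs_base Q = ?\<kappa>"
    using partial_order_onD(1)[OF leq_partial_order] dual_specialization_alexandrov[OF leq_partial_order]
    by (simp_all add: Q_def)
  have p1: "base_morphism Q S1 proj1"
    unfolding base_morphism_def sel using proj1_p_morphism product_base.left by blast
  have p2: "base_morphism Q S2 proj2"
    unfolding base_morphism_def sel using proj2_p_morphism product_base.right by blast
  let ?R1 = "above_graph Q S1 proj1" and ?R2 = "above_graph Q S2 proj2"
  have univ: "\<exists>!M. M \<in> PHS0_hom T Q \<and> M O ?R1 = F1 \<and> M O ?R2 = F2"
    if T: "PHS0_obj T" and F: "F1 \<in> PHS0_hom T S1" "F2 \<in> PHS0_hom T S2"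
    for T :: "'w hspace" and F1 F2
  proof -
    note T' = PHS0_objD[OF T]
    note poT = partial_order_onD[OF root_systemD(1)[OF T'(1)]]
    obtain f where f: "base_morphism T S1 f" "F1 = above_graph T S1 f"
      using PHS0_homD[OF T S(1) F(1)] by blast
    obtain g where g: "base_morphism T S2 g" "F2 = above_graph T S2 g"
      using PHS0_homD[OF T S(2) F(2)] by blast
    note fp = base_morphismD(1)[OF f(1)] and gp = base_morphismD(1)[OF g(1)]
    let ?h = "lift (hs_ord T) f g"
    note l = lift[OF T'(1) fp gp] and hp = lift_p_morphism[OF T'(1) fp gp]
    have "{t \<in> hs_points T. ?h t \<in> U} \<in> hs_base T" if "U \<in> ?\<kappa>" for U
      using that
    proof induction
      case (left U)
      have "{t \<in> hs_points T. ?h t \<in> {w \<in> P. proj1 w \<in> U}} = {t \<in> hs_points T. f t \<in> U}"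
        using l(1,3) by auto
      then show ?case using base_morphismD(2)[OF f(1) left] by simp
    next
      case (right V)
      have "{t \<in> hs_points T. ?h t \<in> {w \<in> P. proj2 w \<in> V}} = {t \<in> hs_points T. g t \<in> V}"
        using l(1,4) by auto
      then show ?case using base_morphismD(2)[OF g(1) right] by simp
    next
      case (diff U V)
      have "{t \<in> hs_points T. ?h t \<in> leq\<inverse> `` (U - V)} =
        (hs_ord T)\<inverse> `` ({t \<in> hs_points T. ?h t \<in> U} - {t \<in> hs_points T. ?h t \<in> V})"
        unfolding p_morphism_vimage_downset[OF hp poT(1)] by (rule arg_cong[where f = "Image _"]) auto
      then show ?case using T'(6)[OF diff.IH] by simp
    qed
    then have h: "base_morphism T Q ?h" unfolding base_morphism_def using hp by simp
    have comp: "above_graph T Q k O ?R1 = above_graph T S1 (proj1 \<circ> k)"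
      "above_graph T Q k O ?R2 = above_graph T S2 (proj2 \<circ> k)" if "base_morphism T Q k" for k
      using above_graph_compose[OF that p1 Q S(1)] above_graph_compose[OF that p2 Q S(2)] by auto
    show ?thesis
    proof (rule ex1I)
      show "above_graph T Q ?h \<in> PHS0_hom T Q \<and> above_graph T Q ?h O ?R1 = F1 \<and>
          above_graph T Q ?h O ?R2 = F2"
        using above_graph_in_PHS0_hom[OF T Q h] comp[OF h] f(2) g(2) l(3,4)
          above_graph_cong[of T "proj1 \<circ> ?h" f S1] above_graph_cong[of T "proj2 \<circ> ?h" g S2] by simp
      fix M assume M: "M \<in> PHS0_hom T Q \<and> M O ?R1 = F1 \<and> M O ?R2 = F2"
      then obtain k where k: "base_morphism T Q k" "M = above_graph T Q k"
        using PHS0_homD[OF T Q] by blast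
      note kP = base_morphismD(3)[OF k(1)]
      have "proj1 (k t) = f t" "proj2 (k t) = g t" if "t \<in> hs_points T" for t
      proof -
        have "above_graph T S1 (proj1 \<circ> k) = above_graph T S1 f"
          "above_graph T S2 (proj2 \<circ> k) = above_graph T S2 g"
          using M comp[OF k(1)] k(2) f(2) g(2) by auto
        then show "proj1 (k t) = f t" "proj2 (k t) = g t"
          using above_graph_eqD[of T S1 "proj1 \<circ> k" f t] above_graph_eqD[of T S2 "proj2 \<circ> k" g t]
            S that kP[OF that] base_morphismD(3)[OF p1] base_morphismD(3)[OF p2]
            base_morphismD(3)[OF f(1) that] base_morphismD(3)[OF g(1) that] by simp_all
      qed
      moreover have "p_morphism (hs_points T) (hs_ord T) P leq k"
        using base_morphismD(1)[OF k(1)] by simp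
      ultimately have "k t = ?h t" if "t \<in> hs_points T" for t
        using lift_unique[OF poT(1) _ that] by blast
      then show "M = above_graph T Q ?h" using above_graph_cong k(2) by metis
    qed
  qed
  have "PHS0_product Q ?R1 ?R2 S1 S2"
    unfolding PHS0_product_def
    using S Q above_graph_in_PHS0_hom[OF Q S(1) p1] above_graph_in_PHS0_hom[OF Q S(2) p2] univ by blast
  then show ?thesis using sel(1) by blast
qed

section \<open>The product of finite Esakia root systems\<close>

lemma PEs_objD:
  assumes "PEs_obj E"
  shows "root_system (os_points E) (os_ord E)"
    "\<And>U. clopenin (os_top E) U \<Longrightarrow> clopenin (os_top E) ((os_ord E)\<inverse> `` U)"
  using assms by (auto simp: PEs_obj_def esakia_space_def)

lemma PEs_hom_iff:
  assumes "PEs_obj E1"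
  shows "f \<in> PEs_hom E1 E2 \<longleftrightarrow> f \<in> extensional (os_points E1) \<and>
    continuous_map (os_top E1) (os_top E2) f \<and>
    p_morphism (os_points E1) (os_ord E1) (os_points E2) (os_ord E2) f"
proof -
  note po = partial_order_onD[OF root_systemD(1)[OF PEs_objD(1)[OF assms]]]
  have "(f x, f y) \<in> os_ord E2"
    if "\<forall>x\<in>os_points E1. f ` (os_ord E1 `` {x}) = os_ord E2 `` {f x}" "(x, y) \<in> os_ord E1" for x y
  proof -
    have "f y \<in> f ` (os_ord E1 `` {x})" using that(2) by blast
    moreover have "x \<in> os_points E1" using that(2) po(1) by blast
    ultimately show ?thesis using that(1) by simp
  qed
  then show ?thesis
    unfolding PEs_hom_def p_morphism_def using continuous_map_image_subset_topspace[of "os_top E1" "os_top E2" f]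
    by (auto simp: case_prod_unfold)
qed

lemma finite_PEs_objI:
  assumes fin: "finite A" and rs: "root_system A r"
  shows "PEs_obj \<lparr>os_top = discrete_topology A, os_ord = r\<rparr>"
proof -
  note po = root_systemD(1)[OF rs]
  note r = partial_order_onD[OF po]
  have "\<exists>U. clopenin (discrete_topology A) U \<and> r `` U \<subseteq> U \<and> x \<in> U \<and> y \<notin> U"
    if "x \<in> A" "y \<in> A" "(x, y) \<notin> r" for x y
  proof (intro exI conjI)
    show "clopenin (discrete_topology A) (r `` {x})" using r(1) by (auto simp: clopenin_def)
    show "r `` (r `` {x}) \<subseteq> r `` {x}" using r(3) by blast
    show "x \<in> r `` {x}" "y \<notin> r `` {x}" using that r(2) by auto
  qed
  moreover have "clopenin (discrete_topology A) (r\<inverse> `` U)" for U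
    using r(1) by (auto simp: clopenin_def)
  ultimately show ?thesis
    using fin po rs by (simp add: PEs_obj_def esakia_space_def compact_space_discrete_topology)
qed

text \<open>In a test object the points with a given staircase form an open set: containing a point of the
  product is a clopen condition, because the downset of a clopen set is clopen.\<close>

lemma staircase_PEs_product:
  fixes E1 :: "'a ordspace" and E2 :: "'b ordspace" and P :: "'w set"
  assumes E: "PEs_obj E1" "PEs_obj E2" and fin: "finite (os_points E1)" "finite (os_points E2)"
    and discrete: "os_top E1 = discrete_topology (os_points E1)" "os_top E2 = discrete_topology (os_points E2)"
    and st: "bij_betw st P (staircases (os_ord E1) (os_ord E2) (os_points E1) (os_points E2))"
  shows "\<exists>(E :: 'w ordspace) p1 p2. PEs_product E p1 p2 E1 E2 \<and> os_points E = P"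
proof -
  let ?A = "os_points E1" and ?B = "os_points E2"
  interpret staircase_poset ?A "os_ord E1" ?B "os_ord E2" P st
    by unfold_locales
      (use fin st root_systemD(1)[OF PEs_objD(1)[OF E(1)]] root_systemD(1)[OF PEs_objD(1)[OF E(2)]] in auto)
  define E where "E = \<lparr>os_top = discrete_topology P, os_ord = leq\<rparr>"
  have obj: "PEs_obj E" unfolding E_def by (rule finite_PEs_objI[OF finite_points leq_root_system])
  have sel [simp]: "os_top E = discrete_topology P" "os_ord E = leq" "os_points E = P"
    by (simp_all add: E_def)
  define p1 where "p1 = restrict proj1 P"
  define p2 where "p2 = restrict proj2 P"
  have "p_morphism P leq ?A (os_ord E1) p1"
    using proj1_p_morphism p_morphism_cong[OF partial_order_onD(1)[OF leq_partial_order], of p1 proj1]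
    by (simp add: p1_def)
  then have p1: "p1 \<in> PEs_hom E E1"
    unfolding PEs_hom_iff[OF obj] by (auto simp: p1_def p_morphism_def)
  have "p_morphism P leq ?B (os_ord E2) p2"
    using proj2_p_morphism p_morphism_cong[OF partial_order_onD(1)[OF leq_partial_order], of p2 proj2]
    by (simp add: p2_def)
  then have p2: "p2 \<in> PEs_hom E E2"
    unfolding PEs_hom_iff[OF obj] by (auto simp: p2_def p_morphism_def)
  have univ: "\<exists>!h. h \<in> PEs_hom T E \<and> compose (os_points T) p1 h = f \<and> compose (os_points T) p2 h = g"
    if T: "PEs_obj T" and fg: "f \<in> PEs_hom T E1" "g \<in> PEs_hom T E2" for T :: "'w ordspace" and f g
  proof -
    let ?T = "os_points T" and ?q = "os_ord T"
    note q = PEs_objD(1)[OF T]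
    note q' = partial_order_onD[OF root_systemD(1)[OF q]]
    have f: "f \<in> extensional ?T" "continuous_map (os_top T) (os_top E1) f" "p_morphism ?T ?q ?A (os_ord E1) f"
      using fg(1) by (auto simp: PEs_hom_iff[OF T])
    have g: "g \<in> extensional ?T" "continuous_map (os_top T) (os_top E2) g" "p_morphism ?T ?q ?B (os_ord E2) g"
      using fg(2) by (auto simp: PEs_hom_iff[OF T])
    note l = lift[OF q f(3) g(3)]
    define h where "h = restrict (lift ?q f g) ?T"
    have h: "h t = lift ?q f g t" if "t \<in> ?T" for t using that by (simp add: h_def)
    have hp: "p_morphism ?T ?q P leq h"
      using lift_p_morphism[OF q f(3) g(3)] p_morphism_cong[OF q'(1), of h "lift ?q f g"] h by simp
    define D where "D c = {t \<in> ?T. c \<in> st (h t)}" for c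
    have D: "clopenin (os_top T) (D c)" if c: "c \<in> ?A \<times> ?B" for c
    proof -
      let ?F = "{u \<in> ?T. f u \<in> {fst c}} \<inter> {u \<in> ?T. g u \<in> {snd c}}"
      have "openin (os_top E1) {fst c}" "closedin (os_top E1) {fst c}"
        "openin (os_top E2) {snd c}" "closedin (os_top E2) {snd c}"
        using c by (subst discrete; auto)+
      then have "clopenin (os_top T) ?F"
        unfolding clopenin_def
        using openin_continuous_map_preimage[OF f(2)] openin_continuous_map_preimage[OF g(2)]
          closedin_continuous_map_preimage[OF f(2)] closedin_continuous_map_preimage[OF g(2)]
        by (meson openin_Int closedin_Int)
      then have "clopenin (os_top T) (?q\<inverse> `` ?F)" by (rule PEs_objD(2)[OF T])
      moreover have "?q\<inverse> `` ?F = D c"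
      proof (intro equalityI subsetI)
        fix t assume "t \<in> ?q\<inverse> `` ?F"
        then obtain u where u: "(t, u) \<in> ?q" "c = (f u, g u)" by (auto simp: prod_eq_iff)
        then have t: "t \<in> ?T" using q'(1) by blast
        then show "t \<in> D c" using u l(2)[OF t] h[OF t] by (auto simp: D_def)
      next
        fix t assume "t \<in> D c"
        then have t: "t \<in> ?T" and "c \<in> st (h t)" by (auto simp: D_def)
        then obtain u where "(t, u) \<in> ?q" "c = (f u, g u)" using l(2)[OF t] h[OF t] by auto
        then show "t \<in> ?q\<inverse> `` ?F" using q'(1) by auto
      qed
      ultimately show ?thesis by simp
    qed
    have fibre: "openin (os_top T) {t \<in> ?T. h t = w}" if w: "w \<in> P" for w
    proof -
      let ?K = "\<lambda>c. if c \<in> st w then D c else ?T - D c"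
      have "openin (os_top T) ((\<Inter>c\<in>?A \<times> ?B. ?K c) \<inter> ?T)"
      proof (rule openin_INT)
        show "finite (?A \<times> ?B)" using fin by simp
        show "openin (os_top T) (?K c)" if "c \<in> ?A \<times> ?B" for c
          using D[OF that] by (auto simp: clopenin_def)
      qed
      moreover have "(\<Inter>c\<in>?A \<times> ?B. ?K c) \<inter> ?T = {t \<in> ?T. h t = w}"
      proof (intro equalityI subsetI)
        fix t assume t: "t \<in> (\<Inter>c\<in>?A \<times> ?B. ?K c) \<inter> ?T"
        then have tT: "t \<in> ?T" by simp
        have hP: "h t \<in> P" using p_morphismD(1)[OF hp tT] .
        have "c \<in> st w \<longleftrightarrow> c \<in> st (h t)" if c: "c \<in> ?A \<times> ?B" for c
        proof -
          have "t \<in> ?K c" using t c by blast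
          then show ?thesis using tT by (cases "c \<in> st w") (simp_all add: D_def)
        qed
        then have "st w = st (h t)" using stD(2)[OF w] stD(2)[OF hP] by blast
        then show "t \<in> {t \<in> ?T. h t = w}" using st_eqD[OF w hP] tT by simp
      next
        fix t assume "t \<in> {t \<in> ?T. h t = w}"
        then show "t \<in> (\<Inter>c\<in>?A \<times> ?B. ?K c) \<inter> ?T" by (auto simp: D_def)
      qed
      ultimately show ?thesis by simp
    qed
    have "continuous_map (os_top T) (os_top E) h"
      unfolding continuous_map_def sel
    proof (intro conjI allI impI)
      show "h \<in> ?T \<rightarrow> topspace (discrete_topology P)" using p_morphismD(1)[OF hp] by simp
      fix U assume "openin (discrete_topology P) U"
      then have "openin (os_top T) (\<Union>w\<in>U. {t \<in> ?T. h t = w})"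
        using fibre by (intro openin_Union) auto
      moreover have "(\<Union>w\<in>U. {t \<in> ?T. h t = w}) = {t \<in> ?T. h t \<in> U}" by blast
      ultimately show "openin (os_top T) {t \<in> ?T. h t \<in> U}" by simp
    qed
    then have hom: "h \<in> PEs_hom T E" unfolding PEs_hom_iff[OF T] using hp by (simp add: h_def)
    show ?thesis
    proof (rule ex1I)
      have "compose ?T p1 h = f"
        by (rule extensionalityI[of _ ?T]) (use f(1) l(1,3) h in \<open>auto simp: compose_eq p1_def\<close>)
      moreover have "compose ?T p2 h = g"
        by (rule extensionalityI[of _ ?T]) (use g(1) l(1,4) h in \<open>auto simp: compose_eq p2_def\<close>)
      ultimately show "h \<in> PEs_hom T E \<and> compose ?T p1 h = f \<and> compose ?T p2 h = g" using hom by simp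
      fix k assume k: "k \<in> PEs_hom T E \<and> compose ?T p1 k = f \<and> compose ?T p2 k = g"
      then have k': "k \<in> extensional ?T" "p_morphism ?T ?q P leq k"
        by (auto simp: PEs_hom_iff[OF T])
      have "proj1 (k t) = f t" "proj2 (k t) = g t" if "t \<in> ?T" for t
      proof -
        have "p1 (k t) = f t" "p2 (k t) = g t"
          using k compose_eq[OF that, of p1 k] compose_eq[OF that, of p2 k] by auto
        then show "proj1 (k t) = f t" "proj2 (k t) = g t"
          using p_morphismD(1)[OF k'(2) that] by (simp_all add: p1_def p2_def)
      qed
      then have "k t = lift ?q f g t" if "t \<in> ?T" for t
        using lift_unique[OF q'(1) k'(2) that] by blast
      then show "k = h" using k'(1) h by (intro extensionalityI[of k ?T h]) (auto simp: h_def)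
    qed
  qed
  have "PEs_product E p1 p2 E1 E2"
    unfolding PEs_product_def using E obj p1 p2 univ by blast
  then show ?thesis using sel(3) by blast
qed

lemma PEs_hom_compose:
  assumes "PEs_obj E1" "PEs_obj E2" and f: "f \<in> PEs_hom E1 E2" and g: "g \<in> PEs_hom E2 E3"
  shows "compose (os_points E1) g f \<in> PEs_hom E1 E3"
proof -
  have c: "compose (os_points E1) g f x = (g \<circ> f) x" if "x \<in> os_points E1" for x
    using that by (simp add: compose_eq)
  have "continuous_map (os_top E1) (os_top E3) (g \<circ> f)"
    using f g by (auto simp: PEs_hom_def intro: continuous_map_compose)
  then have "continuous_map (os_top E1) (os_top E3) (compose (os_points E1) g f)"
    using continuous_map_eq c by metis
  moreover have "p_morphism (os_points E1) (os_ord E1) (os_points E3) (os_ord E3) (g \<circ> f)"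
    using f g p_morphism_compose unfolding PEs_hom_iff[OF assms(1)] PEs_hom_iff[OF assms(2)] by blast
  then have "p_morphism (os_points E1) (os_ord E1) (os_points E3) (os_ord E3) (compose (os_points E1) g f)"
    using p_morphism_cong[OF partial_order_onD(1)[OF root_systemD(1)[OF PEs_objD(1)[OF assms(1)]]], of _ "g \<circ> f"] c
    by metis
  ultimately show ?thesis by (simp add: PEs_hom_iff[OF assms(1)])
qed

lemma PEs_hom_id:
  assumes "PEs_obj E"
  shows "restrict id (os_points E) \<in> PEs_hom E E"
proof -
  let ?i = "restrict id (os_points E)"
  have "p_morphism (os_points E) (os_ord E) (os_points E) (os_ord E) id"
    by (simp add: p_morphism_def)
  then have "p_morphism (os_points E) (os_ord E) (os_points E) (os_ord E) ?i"
    using p_morphism_cong[OF partial_order_onD(1)[OF root_systemD(1)[OF PEs_objD(1)[OF assms]]], of ?i id]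
    by simp
  moreover have "continuous_map (os_top E) (os_top E) ?i"
    by (rule continuous_map_eq[of _ _ id]) auto
  ultimately show ?thesis by (simp add: PEs_hom_iff[OF assms])
qed

lemma PEs_product_bij_points:
  fixes E E' :: "'p ordspace"
  assumes E: "PEs_product E p1 p2 E1 E2" and E': "PEs_product E' p1' p2' E1 E2"
  shows "\<exists>f. bij_betw f (os_points E) (os_points E')"
proof -
  have half: "\<exists>h k. h \<in> PEs_hom E E' \<and> k \<in> PEs_hom E' E \<and>
      compose (os_points E) p1' h = p1 \<and> compose (os_points E) p2' h = p2 \<and>
      compose (os_points E') p1 k = p1' \<and> compose (os_points E') p2 k = p2' \<and>
      (\<forall>x\<in>os_points E. k (h x) = x)"
    if P: "PEs_product E p1 p2 E1 E2" and P': "PEs_product E' p1' p2' E1 E2"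
    for E E' :: "'p ordspace" and p1 p2 p1' p2'
  proof -
    have o: "PEs_obj E" "PEs_obj E'" "p1 \<in> PEs_hom E E1" "p2 \<in> PEs_hom E E2"
      "p1' \<in> PEs_hom E' E1" "p2' \<in> PEs_hom E' E2"
      using P P' by (auto simp: PEs_product_def)
    have univ: "\<exists>!h. h \<in> PEs_hom T E \<and> compose (os_points T) p1 h = f \<and> compose (os_points T) p2 h = g"
      if "PEs_obj T" "f \<in> PEs_hom T E1" "g \<in> PEs_hom T E2" for T :: "'p ordspace" and f g
      using P that by (simp add: PEs_product_def)
    have univ': "\<exists>!h. h \<in> PEs_hom T E' \<and> compose (os_points T) p1' h = f \<and> compose (os_points T) p2' h = g"
      if "PEs_obj T" "f \<in> PEs_hom T E1" "g \<in> PEs_hom T E2" for T :: "'p ordspace" and f g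
      using P' that by (simp add: PEs_product_def)
    obtain h where h: "h \<in> PEs_hom E E'" "compose (os_points E) p1' h = p1" "compose (os_points E) p2' h = p2"
      using univ'[OF o(1,3,4)] by blast
    obtain k where k: "k \<in> PEs_hom E' E" "compose (os_points E') p1 k = p1'" "compose (os_points E') p2 k = p2'"
      using univ[OF o(2,5,6)] by blast
    let ?kh = "compose (os_points E) k h" and ?i = "restrict id (os_points E)"
    have hx: "h x \<in> os_points E'" if "x \<in> os_points E" for x
      using h(1) that p_morphismD(1) unfolding PEs_hom_iff[OF o(1)] by metis
    have "p1 (k (h x)) = p1 x \<and> p2 (k (h x)) = p2 x" if x: "x \<in> os_points E" for x
    proof -
      have "p1 (k (h x)) = p1' (h x)" "p2 (k (h x)) = p2' (h x)"
        using k(2,3) hx[OF x] by (metis compose_eq)+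
      moreover have "p1' (h x) = p1 x" "p2' (h x) = p2 x" using h(2,3) x by (metis compose_eq)+
      ultimately show ?thesis by simp
    qed
    moreover have "p1 \<in> extensional (os_points E)" "p2 \<in> extensional (os_points E)"
      using o by (auto simp: PEs_hom_def)
    ultimately have "compose (os_points E) p1 ?kh = p1" "compose (os_points E) p2 ?kh = p2"
      by (auto intro!: extensionalityI[of _ "os_points E"] simp: compose_eq)
    moreover have "compose (os_points E) p1 ?i = p1" "compose (os_points E) p2 ?i = p2"
      using \<open>p1 \<in> extensional _\<close> \<open>p2 \<in> extensional _\<close>
      by (auto intro!: extensionalityI[of _ "os_points E"] simp: compose_eq)
    ultimately have "?kh = ?i"
      using univ[OF o(1,3,4)] PEs_hom_compose[OF o(1,2) h(1) k(1)] PEs_hom_id[OF o(1)] by blast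
    have "k (h x) = x" if x: "x \<in> os_points E" for x
      using fun_cong[OF \<open>?kh = ?i\<close>, of x] x by (simp add: compose_eq)
    then show ?thesis using h k by blast
  qed
  obtain h k where hk: "h \<in> PEs_hom E E'" "k \<in> PEs_hom E' E" "\<forall>x\<in>os_points E. k (h x) = x"
    using half[OF E E'] by blast
  obtain k' h' where hk': "k' \<in> PEs_hom E' E" "h' \<in> PEs_hom E E'" "\<forall>x\<in>os_points E'. h' (k' x) = x"
    using half[OF E' E] by blast
  have maps: "f ` os_points D \<subseteq> os_points D'" if "f \<in> PEs_hom D D'" for f and D D' :: "'p ordspace"
    using that continuous_map_image_subset_topspace unfolding PEs_hom_def by blast
  have inj: "inj_on h (os_points E)" "inj_on k' (os_points E')"
    using hk(3) hk'(3) by (metis inj_on_inverseI)+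
  then show ?thesis using Schroeder_Bernstein[OF inj(1) maps[OF hk(1)] inj(2) maps[OF hk'(1)]] by blast
qed

section \<open>Spectra of finite prelinear Hilbert algebras\<close>

locale hilbert =
  fixes H :: "('a, 'm) hilbert_scheme"
  assumes hilbert_algebra: "hilbert_algebra H"
begin

abbreviation imp (infixr "\<rightarrow>" 60) where "imp \<equiv> himp H"
abbreviation one ("\<one>") where "one \<equiv> hone H"
abbreviation carrier where "carrier \<equiv> hcarrier H"

lemma closed [simp]: "\<one> \<in> carrier" "a \<in> carrier \<Longrightarrow> b \<in> carrier \<Longrightarrow> a \<rightarrow> b \<in> carrier"
  using hilbert_algebra by (auto simp: hilbert_algebra_def)

lemma imp_weaken: "a \<in> carrier \<Longrightarrow> b \<in> carrier \<Longrightarrow> a \<rightarrow> (b \<rightarrow> a) = \<one>"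
  using hilbert_algebra by (auto simp: hilbert_algebra_def)

lemma imp_distrib: "a \<in> carrier \<Longrightarrow> b \<in> carrier \<Longrightarrow> c \<in> carrier \<Longrightarrow>
    (a \<rightarrow> (b \<rightarrow> c)) \<rightarrow> ((a \<rightarrow> b) \<rightarrow> (a \<rightarrow> c)) = \<one>"
  using hilbert_algebra by (auto simp: hilbert_algebra_def)

lemma antisym: "a \<in> carrier \<Longrightarrow> b \<in> carrier \<Longrightarrow> a \<rightarrow> b = \<one> \<Longrightarrow> b \<rightarrow> a = \<one> \<Longrightarrow> a = b"
  using hilbert_algebra by (auto simp: hilbert_algebra_def)

lemma imp_one [simp]:
  assumes "a \<in> carrier"
  shows "a \<rightarrow> \<one> = \<one>"
proof (rule antisym)
  show *: "\<one> \<rightarrow> (a \<rightarrow> \<one>) = \<one>" using imp_weaken[of \<one> a] assms by simp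
  show "(a \<rightarrow> \<one>) \<rightarrow> \<one> = \<one>" using imp_weaken[of "a \<rightarrow> \<one>" \<one>] * assms by simp
qed (use assms in simp_all)

lemma one_impD: "a \<in> carrier \<Longrightarrow> \<one> \<rightarrow> a = \<one> \<Longrightarrow> a = \<one>"
  using antisym[of a \<one>] by simp

lemma imp_self [simp]:
  assumes "a \<in> carrier"
  shows "a \<rightarrow> a = \<one>"
proof -
  have "\<one> \<rightarrow> (\<one> \<rightarrow> (a \<rightarrow> a)) = \<one>"
    using imp_distrib[of a \<one> a] imp_weaken[of a \<one>] assms by simp
  then have "\<one> \<rightarrow> (a \<rightarrow> a) = \<one>" by (rule one_impD[rotated]) (simp add: assms)
  then show ?thesis by (rule one_impD[rotated]) (simp add: assms)
qed

lemma one_imp [simp]: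
  assumes "a \<in> carrier"
  shows "\<one> \<rightarrow> a = a"
proof (rule antisym)
  have "\<one> \<rightarrow> (\<one> \<rightarrow> ((\<one> \<rightarrow> a) \<rightarrow> a)) = \<one>"
    using imp_distrib[of "\<one> \<rightarrow> a" \<one> a] assms by simp
  then have "\<one> \<rightarrow> ((\<one> \<rightarrow> a) \<rightarrow> a) = \<one>" by (rule one_impD[rotated]) (simp add: assms)
  then show "(\<one> \<rightarrow> a) \<rightarrow> a = \<one>" by (rule one_impD[rotated]) (simp add: assms)
  show "a \<rightarrow> (\<one> \<rightarrow> a) = \<one>" using imp_weaken assms by simp
qed (use assms in simp_all)

lemma comparable_prelinear:
  assumes "a \<in> carrier" "b \<in> carrier" "c \<in> carrier" "a \<rightarrow> b = \<one> \<or> b \<rightarrow> a = \<one>"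
  shows "((a \<rightarrow> b) \<rightarrow> c) \<rightarrow> (((b \<rightarrow> a) \<rightarrow> c) \<rightarrow> c) = \<one>"
  using assms by (auto simp: imp_weaken)

lemma filterD:
  assumes "implicative_filter H F"
  shows "F \<subseteq> carrier" "\<one> \<in> F"
    "\<And>a b. a \<in> F \<Longrightarrow> a \<rightarrow> b \<in> F \<Longrightarrow> b \<in> carrier \<Longrightarrow> b \<in> F"
proof -
  show F: "F \<subseteq> carrier" "\<one> \<in> F" using assms unfolding implicative_filter_def by blast+
  have mp: "\<forall>a\<in>carrier. \<forall>b\<in>carrier. a \<in> F \<longrightarrow> a \<rightarrow> b \<in> F \<longrightarrow> b \<in> F"
    using assms unfolding implicative_filter_def by (elim conjE)
  show "b \<in> F" if "a \<in> F" "a \<rightarrow> b \<in> F" "b \<in> carrier" for a b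
    by (rule mp[rule_format, OF subsetD[OF F(1) that(1)] that(3,1,2)])
qed

text \<open>The filter generated by \<open>F\<close> and \<open>a\<close>; that it has this simple form is the deduction theorem.\<close>

definition adjoin :: "'a set \<Rightarrow> 'a \<Rightarrow> 'a set" where
  "adjoin F a = {x \<in> carrier. a \<rightarrow> x \<in> F}"

lemma adjoin:
  assumes F: "implicative_filter H F" and a: "a \<in> carrier"
  shows "implicative_filter H (adjoin F a)" "F \<subseteq> adjoin F a" "a \<in> adjoin F a"
proof -
  note F' = filterD[OF F]
  have mp: "y \<in> adjoin F a" if "x \<in> adjoin F a" "x \<rightarrow> y \<in> adjoin F a" "y \<in> carrier" for x y
  proof -
    have x: "x \<in> carrier" "a \<rightarrow> x \<in> F" "a \<rightarrow> (x \<rightarrow> y) \<in> F" using that by (auto simp: adjoin_def)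
    have "(a \<rightarrow> (x \<rightarrow> y)) \<rightarrow> ((a \<rightarrow> x) \<rightarrow> (a \<rightarrow> y)) \<in> F" using imp_distrib[of a x y] F'(2) a x that by simp
    then have "(a \<rightarrow> x) \<rightarrow> (a \<rightarrow> y) \<in> F" using F'(3)[OF x(3)] a x that by simp
    then have "a \<rightarrow> y \<in> F" using F'(3)[OF x(2)] a that by simp
    then show ?thesis using that by (simp add: adjoin_def)
  qed
  show "implicative_filter H (adjoin F a)"
    unfolding implicative_filter_def
  proof (intro conjI ballI impI)
    show "adjoin F a \<subseteq> carrier" "\<one> \<in> adjoin F a" using F'(2) a by (auto simp: adjoin_def)
    show "y \<in> adjoin F a" if "y \<in> carrier" "x \<in> adjoin F a" "x \<rightarrow> y \<in> adjoin F a" for x y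
      using mp[OF that(2,3,1)] .
  qed
  show "F \<subseteq> adjoin F a"
  proof
    fix x assume x: "x \<in> F"
    then have xc: "x \<in> carrier" using F'(1) by blast
    have "x \<rightarrow> (a \<rightarrow> x) \<in> F" using imp_weaken[of x a] xc a F'(2) by simp
    then have "a \<rightarrow> x \<in> F" using F'(3)[OF x] xc a by simp
    then show "x \<in> adjoin F a" using xc by (simp add: adjoin_def)
  qed
  show "a \<in> adjoin F a" using a F'(2) by (simp add: adjoin_def)
qed

lemma irreducible_filtersD:
  assumes "P \<in> irreducible_filters H"
  shows "implicative_filter H P" "P \<noteq> carrier" "P \<subseteq> carrier"
    "\<And>F1 F2. implicative_filter H F1 \<Longrightarrow> implicative_filter H F2 \<Longrightarrow> P = F1 \<inter> F2 \<Longrightarrow> P = F1 \<or> P = F2"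
proof -
  show P: "implicative_filter H P" and "P \<noteq> carrier"
    "\<And>F1 F2. implicative_filter H F1 \<Longrightarrow> implicative_filter H F2 \<Longrightarrow> P = F1 \<inter> F2 \<Longrightarrow> P = F1 \<or> P = F2"
    using assms unfolding irreducible_filters_def by blast+
  show "P \<subseteq> carrier" using filterD(1)[OF P] .
qed

text \<open>Irreducibility plays the part of primeness: the filters \<open>adjoin P a\<close> and \<open>adjoin P b\<close> are larger
  than \<open>P\<close>, hence so is their intersection, and \<open>c\<close> can be taken from it.\<close>

lemma irreducible_join:
  assumes P: "P \<in> irreducible_filters H" and ab: "a \<in> carrier - P" "b \<in> carrier - P"
  shows "\<exists>c\<in>carrier - P. a \<rightarrow> c \<in> P \<and> b \<rightarrow> c \<in> P"
proof (rule ccontr)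
  note P' = irreducible_filtersD[OF P]
  have A: "implicative_filter H (adjoin P a)" "P \<subseteq> adjoin P a" "a \<in> adjoin P a"
    and B: "implicative_filter H (adjoin P b)" "P \<subseteq> adjoin P b" "b \<in> adjoin P b"
    using adjoin[OF P'(1)] ab by auto
  assume "\<not> ?thesis"
  then have "adjoin P a \<inter> adjoin P b \<subseteq> P" unfolding adjoin_def by blast
  then have "P = adjoin P a \<inter> adjoin P b" using A(2) B(2) by blast
  then have "P = adjoin P a \<or> P = adjoin P b" using P'(4) A(1) B(1) by blast
  then show False using A(3) B(3) ab by auto
qed

lemma irreducible_extension:
  assumes fin: "finite carrier" and F: "implicative_filter H F" and a: "a \<in> carrier - F"
  shows "\<exists>P\<in>irreducible_filters H. F \<subseteq> P \<and> a \<notin> P"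
proof -
  let ?S = "{F'. implicative_filter H F' \<and> F \<subseteq> F' \<and> a \<notin> F'}"
  have "?S \<subseteq> Pow carrier" using filterD(1) by blast
  then have "finite ?S" using fin finite_subset by blast
  moreover have "F \<in> ?S" using F a by blast
  ultimately have "\<exists>P\<in>?S. F \<subseteq> P \<and> (\<forall>F'\<in>?S. P \<subseteq> F' \<longrightarrow> P = F')"
    by (rule finite_has_maximal2)
  then obtain P where P: "P \<in> ?S" "\<forall>F'\<in>?S. P \<subseteq> F' \<longrightarrow> P = F'" by (elim bexE conjE)
  have max: "a \<in> F'" if "implicative_filter H F'" "P \<subseteq> F'" "P \<noteq> F'" for F'
    using bspec[OF P(2), of F'] P(1) that by blast
  have irr: "P = F1 \<or> P = F2"
    if "implicative_filter H F1" "implicative_filter H F2" "P = F1 \<inter> F2" for F1 F2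
  proof (rule ccontr)
    assume "\<not> ?thesis"
    then have "a \<in> F1" "a \<in> F2" using max[OF that(1)] max[OF that(2)] that(3) by auto
    then show False using P(1) that(3) by blast
  qed
  have "P \<in> irreducible_filters H"
    unfolding irreducible_filters_def
  proof (intro CollectI conjI allI impI)
    show "implicative_filter H P" "P \<noteq> carrier" using P(1) a by auto
  qed (rule irr)
  then show ?thesis using P by blast
qed

text \<open>The operation of the base of the spectrum is dual to implication: if \<open>b \<rightarrow> a\<close> is not in \<open>P\<close>, then
  \<open>adjoin P b\<close> omits \<open>a\<close> and extends to an irreducible filter that omits \<open>a\<close>.\<close>

lemma hphi_imp:
  assumes fin: "finite carrier" and ab: "a \<in> carrier" "b \<in> carrier"
  shows "(inclusion_on (irreducible_filters H))\<inverse> ``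
      ((irreducible_filters H - hphi H a) - (irreducible_filters H - hphi H b)) =
    irreducible_filters H - hphi H (b \<rightarrow> a)"
proof (intro equalityI subsetI)
  fix P assume "P \<in> (inclusion_on (irreducible_filters H))\<inverse> ``
      ((irreducible_filters H - hphi H a) - (irreducible_filters H - hphi H b))"
  then obtain Q where Q: "P \<in> irreducible_filters H" "Q \<in> irreducible_filters H" "P \<subseteq> Q" "a \<notin> Q" "b \<in> Q"
    by (auto simp: inclusion_on_def hphi_def)
  then have "b \<rightarrow> a \<notin> P" using filterD(3)[OF irreducible_filtersD(1)[OF Q(2)] Q(5)] ab by blast
  then show "P \<in> irreducible_filters H - hphi H (b \<rightarrow> a)" using Q by (simp add: hphi_def)
next
  fix P assume "P \<in> irreducible_filters H - hphi H (b \<rightarrow> a)"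
  then have P: "P \<in> irreducible_filters H" "b \<rightarrow> a \<notin> P" by (auto simp: hphi_def)
  note A = adjoin[OF irreducible_filtersD(1)[OF P(1)] ab(2)]
  have "a \<in> carrier - adjoin P b" using P(2) ab by (simp add: adjoin_def)
  then obtain Q where "Q \<in> irreducible_filters H" "adjoin P b \<subseteq> Q" "a \<notin> Q"
    using irreducible_extension[OF fin A(1)] by blast
  then show "P \<in> (inclusion_on (irreducible_filters H))\<inverse> ``
      ((irreducible_filters H - hphi H a) - (irreducible_filters H - hphi H b))"
    using A P(1) by (auto simp: inclusion_on_def hphi_def)
qed

end

text \<open>This identity is the form that prelinearity takes without a join: it says that every upper
  bound of \<open>a \<rightarrow> b\<close> and \<open>b \<rightarrow> a\<close> is the top element.\<close>

lemma prelinear_identity: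
  assumes H: "prelinear_hilbert H" and abc: "a \<in> hcarrier H" "b \<in> hcarrier H" "c \<in> hcarrier H"
  shows "himp H (himp H (himp H a b) c) (himp H (himp H (himp H b a) c) c) = hone H"
proof -
  define s where "s = HImp (HImp (HImp (HVar 0) (HVar 1)) (HVar 2))
    (HImp (HImp (HImp (HVar 1) (HVar 0)) (HVar 2)) (HVar 2))"
  have "satisfies_identity C s HOne" if C: "hilbert_chain C" for C :: "nat hilbert"
    unfolding satisfies_identity_def
  proof (intro allI impI)
    fix v :: "nat \<Rightarrow> nat" assume v: "range v \<subseteq> hcarrier C"
    have "hilbert C" using C by unfold_locales (simp add: hilbert_chain_def)
    moreover have vC: "v n \<in> hcarrier C" for n using v by (simp add: image_subset_iff)
    moreover have "himp C (v 0) (v 1) = hone C \<or> himp C (v 1) (v 0) = hone C"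
      using C vC by (simp add: hilbert_chain_def hle_def)
    ultimately have "himp C (himp C (himp C (v 0) (v 1)) (v 2))
        (himp C (himp C (himp C (v 1) (v 0)) (v 2)) (v 2)) = hone C"
      by (intro hilbert.comparable_prelinear)
    then show "heval C v s = heval C v HOne"
      by (simp add: s_def)
  qed
  then have "satisfies_identity H s HOne" using H by (simp add: prelinear_hilbert_def)
  moreover define v where "v n = (if n = 0 then a else if n = 1 then b else c)" for n :: nat
  moreover have "range v \<subseteq> hcarrier H" using abc by (auto simp: v_def)
  ultimately have "heval H v s = heval H v HOne" by (simp add: satisfies_identity_def)
  then show ?thesis by (simp add: s_def v_def)
qed

lemma finite_irreducible_filters:
  assumes "finite (hcarrier H)"
  shows "finite (irreducible_filters H)"
proof -
  have "irreducible_filters H \<subseteq> Pow (hcarrier H)"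
    by (auto simp: irreducible_filters_def implicative_filter_def)
  then show ?thesis by (rule finite_subset) (simp add: assms)
qed

lemma partial_order_on_inclusion_on: "partial_order_on S (inclusion_on S)"
  by (rule partial_order_onI) (auto simp: inclusion_on_def)

text \<open>If \<open>a\<close> and \<open>b\<close> witnessed that two filters above \<open>P\<close> are incomparable, then neither \<open>a \<rightarrow> b\<close> nor
  \<open>b \<rightarrow> a\<close> would be in \<open>P\<close>, and \<open>irreducible_join\<close> would contradict the prelinear identity.\<close>

lemma irreducible_filters_root_system:
  assumes H: "prelinear_hilbert H"
  shows "root_system (irreducible_filters H) (inclusion_on (irreducible_filters H))"
proof (rule root_systemI[OF partial_order_on_inclusion_on])
  interpret hilbert H using H by unfold_locales (simp add: prelinear_hilbert_def)
  fix P F G assume FG: "(P, F) \<in> inclusion_on (irreducible_filters H)" "(P, G) \<in> inclusion_on (irreducible_filters H)"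
  then have P: "P \<in> irreducible_filters H" "F \<in> irreducible_filters H" "G \<in> irreducible_filters H"
    "P \<subseteq> F" "P \<subseteq> G" by (auto simp: inclusion_on_def)
  note F' = irreducible_filtersD[OF P(2)] and G' = irreducible_filtersD[OF P(3)]
    and P' = irreducible_filtersD[OF P(1)]
  have "F \<subseteq> G \<or> G \<subseteq> F"
  proof (rule ccontr)
    assume "\<not> (F \<subseteq> G \<or> G \<subseteq> F)"
    then obtain a b where a: "a \<in> F" "a \<notin> G" and b: "b \<in> G" "b \<notin> F" by blast
    then have ab: "a \<in> carrier" "b \<in> carrier" using F'(3) G'(3) by auto
    have "a \<rightarrow> b \<notin> P" "b \<rightarrow> a \<notin> P"
      using filterD(3)[OF F'(1) a(1), of b] filterD(3)[OF G'(1) b(1), of a] a b ab P by auto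
    then obtain c where c: "c \<in> carrier - P" "(a \<rightarrow> b) \<rightarrow> c \<in> P" "(b \<rightarrow> a) \<rightarrow> c \<in> P"
      using irreducible_join[OF P(1), of "a \<rightarrow> b" "b \<rightarrow> a"] ab by auto
    have "((a \<rightarrow> b) \<rightarrow> c) \<rightarrow> (((b \<rightarrow> a) \<rightarrow> c) \<rightarrow> c) \<in> P"
      using prelinear_identity[OF H ab, of c] c(1) filterD(2)[OF P'(1)] by simp
    then have "((b \<rightarrow> a) \<rightarrow> c) \<rightarrow> c \<in> P" by (rule filterD(3)[OF P'(1) c(2)]) (use ab c(1) in simp)
    then have "c \<in> P" by (rule filterD(3)[OF P'(1) c(3)]) (use c(1) in simp)
    then show False using c(1) by simp
  qed
  then show "(F, G) \<in> inclusion_on (irreducible_filters H) \<or> (G, F) \<in> inclusion_on (irreducible_filters H)"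
    using P by (auto simp: inclusion_on_def)
qed

text \<open>The base separates points, so it contains all principal downsets by \<open>principal_downset_in_base\<close>.
  Hence the topology that it generates consists of all downsets.\<close>

lemma X_hilbert:
  assumes H: "PHil0_obj H" and fin: "finite (hcarrier H)"
  shows "PHS0_obj (X_hilbert H)" "hs_points (X_hilbert H) = irreducible_filters H"
    "hs_ord (X_hilbert H) = inclusion_on (irreducible_filters H)"
proof -
  interpret hilbert H using H by unfold_locales (simp add: PHil0_obj_def prelinear_hilbert_def)
  let ?X = "irreducible_filters H" and ?r = "inclusion_on (irreducible_filters H)"
  let ?\<kappa> = "{?X - hphi H a | a. a \<in> carrier}"
  have finX: "finite ?X" by (rule finite_irreducible_filters[OF fin])
  have rs: "root_system ?X ?r"
    by (rule irreducible_filters_root_system) (use H in \<open>simp add: PHil0_obj_def\<close>)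
  have X: "?X \<in> ?\<kappa>"
  proof -
    have zero: "hzero H \<in> carrier" "\<And>a. a \<in> carrier \<Longrightarrow> hzero H \<rightarrow> a = \<one>"
      using H by (auto simp: PHil0_obj_def hle_def)
    have "hzero H \<notin> P" if P: "P \<in> ?X" for P
    proof
      note P' = irreducible_filtersD[OF P]
      assume "hzero H \<in> P"
      then have "a \<in> P" if "a \<in> carrier" for a
        using filterD(3)[OF P'(1), of "hzero H" a] filterD(2)[OF P'(1)] zero(2)[OF that] that by simp
      then show False using P'(2,3) by blast
    qed
    then have "?X - hphi H (hzero H) = ?X" by (auto simp: hphi_def)
    then show ?thesis using zero(1) by blast
  qed
  have down: "U \<subseteq> ?X \<and> ?r\<inverse> `` U \<subseteq> U" if "U \<in> ?\<kappa>" for U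
    using that by (auto simp: inclusion_on_def hphi_def)
  have diff: "?r\<inverse> `` (U - V) \<in> ?\<kappa>" if U: "U \<in> ?\<kappa>" and V: "V \<in> ?\<kappa>" for U V
  proof -
    obtain a b where "U = ?X - hphi H a" "V = ?X - hphi H b" "a \<in> carrier" "b \<in> carrier"
      using U V by blast
    then show ?thesis using hphi_imp[OF fin, of a b] closed(2)[of b a] by blast
  qed
  have sep: "\<exists>V\<in>?\<kappa>. Q \<in> V \<and> P \<notin> V" if PQ: "P \<in> ?X" "Q \<in> ?X" "(P, Q) \<notin> ?r" for P Q
  proof -
    obtain a where a: "a \<in> P" "a \<notin> Q" using PQ by (auto simp: inclusion_on_def)
    then have "a \<in> carrier" using irreducible_filtersD(3)[OF PQ(1)] by blast
    then show ?thesis using a PQ by (intro bexI[of _ "?X - hphi H a"]) (auto simp: hphi_def)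
  qed
  have "openin (topology_generated_by ?\<kappa>) U \<longleftrightarrow> openin (alexandrov ?X ?r) U" for U
  proof
    assume "openin (topology_generated_by ?\<kappa>) U"
    then have "generate_topology_on ?\<kappa> U" by (rule openin_topology_generated_by)
    then show "openin (alexandrov ?X ?r) U"
    proof induction
      case (Basis U)
      then show ?case using down by (simp add: openin_alexandrov)
    qed auto
  next
    assume "openin (alexandrov ?X ?r) U"
    then have U: "U \<subseteq> ?X" "?r\<inverse> `` U \<subseteq> U" by (auto simp: openin_alexandrov)
    have "U = \<Union>((\<lambda>P. ?r\<inverse> `` {P}) ` U)"
      using U partial_order_onD(2)[OF partial_order_on_inclusion_on] by blast
    moreover have "openin (topology_generated_by ?\<kappa>) (?r\<inverse> `` {P})" if "P \<in> U" for P
      by (rule topology_generated_by_Basis, rule principal_downset_in_base[OF finX rs X down diff sep])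
        (use that U in auto)
    ultimately show "openin (topology_generated_by ?\<kappa>) U"
      using openin_Union[of "(\<lambda>P. ?r\<inverse> `` {P}) ` U"] by (metis (no_types, lifting) imageE)
  qed
  then have "topology_generated_by ?\<kappa> = alexandrov ?X ?r" by (simp add: topology_eq)
  then have eq: "X_hilbert H = \<lparr>hs_top = alexandrov ?X ?r, hs_base = ?\<kappa>\<rparr>"
    by (simp add: X_hilbert_def)
  show "PHS0_obj (X_hilbert H)" unfolding eq by (rule finite_PHS0_objI[OF finX rs X down diff sep])
  show "hs_points (X_hilbert H) = ?X" "hs_ord (X_hilbert H) = ?r"
    unfolding eq using topspace_alexandrov[OF partial_order_onD(1)[OF partial_order_on_inclusion_on]]
      dual_specialization_alexandrov[OF partial_order_on_inclusion_on] by simp_all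
qed

section \<open>Spectra of the Heyting extensions\<close>

text \<open>For finite \<open>H\<close>, the Heyting algebra \<open>star H\<close> consists of all upsets of the spectrum: the upset
  above \<open>P\<close> is the intersection of the sets \<open>hphi H a\<close> for \<open>a \<in> P\<close>.\<close>

lemma heyting_generated_eq_upsets:
  assumes fin: "finite (hcarrier H)"
  shows "heyting_generated H =
    {U. U \<subseteq> irreducible_filters H \<and> inclusion_on (irreducible_filters H) `` U \<subseteq> U}"
proof (intro equalityI subsetI)
  let ?X = "irreducible_filters H" and ?r = "inclusion_on (irreducible_filters H)"
  fix U assume "U \<in> heyting_generated H"
  then have "U \<subseteq> ?X \<and> ?r `` U \<subseteq> U"
  proof induction
    case (imp U V)
    note r = partial_order_onD[OF partial_order_on_inclusion_on[of ?X]]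
    have "Q \<in> upset_imp ?X ?r U V" if P: "P \<in> upset_imp ?X ?r U V" "(P, Q) \<in> ?r" for P Q
    proof -
      have "Q \<notin> ?r\<inverse> `` (U \<inter> (?X - V))"
      proof
        assume "Q \<in> ?r\<inverse> `` (U \<inter> (?X - V))"
        then obtain R where "(Q, R) \<in> ?r" "R \<in> U \<inter> (?X - V)" by (elim ImageE) simp
        then have "P \<in> ?r\<inverse> `` (U \<inter> (?X - V))" using r(3)[OF P(2), of R] by blast
        then show False using P(1) by (simp add: upset_imp_def)
      qed
      moreover have "Q \<in> ?X" using P(2) r(1) by blast
      ultimately show ?thesis by (simp add: upset_imp_def)
    qed
    then show ?case by (auto simp: upset_imp_def)
  qed (auto simp: hphi_def inclusion_on_def)
  then show "U \<in> {U. U \<subseteq> ?X \<and> ?r `` U \<subseteq> U}" by simp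
next
  let ?X = "irreducible_filters H" and ?r = "inclusion_on (irreducible_filters H)"
  fix U assume "U \<in> {U. U \<subseteq> ?X \<and> ?r `` U \<subseteq> U}"
  then have U: "U \<subseteq> ?X" "?r `` U \<subseteq> U" by auto
  have principal: "?r `` {P} \<in> heyting_generated H" if P: "P \<in> ?X" for P
  proof -
    have sub: "P \<subseteq> hcarrier H" using P by (auto simp: irreducible_filters_def implicative_filter_def)
    then have "finite P" using fin finite_subset by blast
    then have "?X \<inter> (\<Inter>a\<in>P. hphi H a) \<in> heyting_generated H" using sub
    proof (induction P rule: finite_induct)
      case empty
      then show ?case by (simp add: heyting_generated.top)
    next
      case (insert a P)
      have "?X \<inter> (\<Inter>a\<in>insert a P. hphi H a) = hphi H a \<inter> (?X \<inter> (\<Inter>a\<in>P. hphi H a))" by auto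
      then show ?case using insert by (simp add: heyting_generated.meet heyting_generated.gen)
    qed
    moreover have "?X \<inter> (\<Inter>a\<in>P. hphi H a) = ?r `` {P}" using P by (auto simp: hphi_def inclusion_on_def)
    ultimately show ?thesis by simp
  qed
  have "finite U" using U(1) finite_irreducible_filters[OF fin] finite_subset by blast
  then have "(\<Union>P\<in>U. ?r `` {P}) \<in> heyting_generated H" using U(1)
  proof (induction U rule: finite_induct)
    case empty
    then show ?case by (simp add: heyting_generated.bot)
  next
    case (insert P U)
    then show ?case using principal by (simp add: heyting_generated.join)
  qed
  moreover have "(\<Union>P\<in>U. ?r `` {P}) = U" using U by (auto simp: inclusion_on_def)
  ultimately show "U \<in> heyting_generated H" by simp
qed

text \<open>A prime filter \<open>F\<close> of upsets of a finite poset has a least member, which is the union of the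
  principal upsets of its points. By primeness one of these principal upsets is in \<open>F\<close>.\<close>

lemma prime_filters_star:
  assumes fin: "finite (hcarrier H)"
  shows "prime_filters (star H) =
    (\<lambda>P. {U \<in> heyting_generated H. P \<in> U}) ` irreducible_filters H"
proof (intro equalityI subsetI)
  let ?X = "irreducible_filters H" and ?r = "inclusion_on (irreducible_filters H)"
  let ?L = "heyting_generated H"
  note L = heyting_generated_eq_upsets[OF fin]
  fix F assume "F \<in> prime_filters (star H)"
  then have F0: "F \<subseteq> ?L \<and> F \<noteq> ?L \<and> ?X \<in> F \<and> (\<forall>U\<in>F. \<forall>V\<in>?L. U \<inter> V = U \<longrightarrow> V \<in> F) \<and>
      (\<forall>U\<in>F. \<forall>V\<in>F. U \<inter> V \<in> F) \<and> (\<forall>U\<in>?L. \<forall>V\<in>?L. U \<union> V \<in> F \<longrightarrow> U \<in> F \<or> V \<in> F)"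
    unfolding prime_filters_def star_def hey_le_def heyting.simps mem_Collect_eq .
  then have F: "F \<subseteq> ?L" "F \<noteq> ?L" "?X \<in> F" by auto
  have up: "V \<in> F" if "U \<in> F" "V \<in> ?L" "U \<subseteq> V" for U V
    using F0 that(1,2) Int_absorb2[OF that(3)] by (elim conjE) (drule bspec, assumption, blast)
  have meet: "U \<inter> V \<in> F" if "U \<in> F" "V \<in> F" for U V
    using F0 that by (elim conjE) (drule bspec, assumption, drule bspec, assumption)
  have prime: "U \<in> F \<or> V \<in> F" if "U \<in> ?L" "V \<in> ?L" "U \<union> V \<in> F" for U V
    using F0 that by blast
  have X: "finite ?X" by (rule finite_irreducible_filters[OF fin])
  have "F \<subseteq> Pow ?X" using F(1) unfolding L by (rule subset_trans) auto
  then have "finite F" by (rule finite_subset) (simp add: X)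
  then have K: "\<Inter>F \<in> F"
  proof -
    have "\<Inter>G \<in> F" if "finite G" "G \<noteq> {}" "G \<subseteq> F" for G
      using that by (induction G rule: finite_ne_induct) (simp_all add: meet)
    then show ?thesis using \<open>finite F\<close> F(3) by blast
  qed
  have empty: "{} \<notin> F" using F(1,2) up by blast
  have KX: "\<Inter>F \<subseteq> ?X" "?r `` \<Inter>F \<subseteq> \<Inter>F" using K F(1) unfolding L by auto
  have principal: "?r `` {P} \<in> ?L" if "P \<in> ?X" for P
    unfolding L by (auto simp: inclusion_on_def)
  have "\<exists>P\<in>G. ?r `` {P} \<in> F" if "finite G" "G \<subseteq> ?X" "(\<Union>P\<in>G. ?r `` {P}) \<in> F" for G
    using that
  proof (induction G rule: finite_induct)
    case empty
    then show ?case using \<open>{} \<notin> F\<close> by simp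
  next
    case (insert P G)
    have "(\<Union>P\<in>G. ?r `` {P}) \<in> ?L" unfolding L by (auto simp: inclusion_on_def)
    then have "?r `` {P} \<in> F \<or> (\<Union>P\<in>G. ?r `` {P}) \<in> F"
      using insert.prems prime[OF principal] by simp
    then show ?case using insert by auto
  qed
  moreover have "(\<Union>P\<in>\<Inter>F. ?r `` {P}) = \<Inter>F" using KX by (auto simp: inclusion_on_def)
  ultimately obtain P where P: "P \<in> \<Inter>F" "?r `` {P} \<in> F"
    using K KX(1) X finite_subset[of "\<Inter>F" ?X] by metis
  have "F = {U \<in> ?L. P \<in> U}"
  proof (intro equalityI subsetI)
    show "U \<in> {U \<in> ?L. P \<in> U}" if "U \<in> F" for U using that F(1) P(1) by blast
    fix U assume U: "U \<in> {U \<in> ?L. P \<in> U}"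
    then have "?r `` {P} \<subseteq> U" unfolding L by blast
    then show "U \<in> F" using up[OF P(2)] U by blast
  qed
  then show "F \<in> (\<lambda>P. {U \<in> ?L. P \<in> U}) ` ?X" using P(1) KX(1) by blast
next
  let ?L = "heyting_generated H"
  fix F assume "F \<in> (\<lambda>P. {U \<in> ?L. P \<in> U}) ` irreducible_filters H"
  then obtain P where P: "P \<in> irreducible_filters H" "F = {U \<in> ?L. P \<in> U}" by blast
  have "{} \<in> ?L - F" using P(2) by (simp add: heyting_generated.bot)
  then have "F \<noteq> ?L" by blast
  then show "F \<in> prime_filters (star H)"
    using P(1) unfolding prime_filters_def star_def hey_le_def P(2)
    by (auto simp: heyting_generated.top heyting_generated.meet)
qed

text \<open>The prime spectrum of \<open>star H\<close> is thus a copy of the spectrum of \<open>H\<close> as a poset.\<close>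

definition evaluation :: "('a, 'm) hilbert_scheme \<Rightarrow> 'a set \<Rightarrow> 'a set set set" where
  "evaluation H P = {U \<in> heyting_generated H. P \<in> U}"

lemma evaluation_iso:
  assumes fin: "finite (hcarrier H)"
  shows "bij_betw (evaluation H) (irreducible_filters H) (prime_filters (star H))"
    "\<And>P Q. P \<in> irreducible_filters H \<Longrightarrow> Q \<in> irreducible_filters H \<Longrightarrow>
      evaluation H P \<subseteq> evaluation H Q \<longleftrightarrow> P \<subseteq> Q"
proof -
  let ?X = "irreducible_filters H" and ?r = "inclusion_on (irreducible_filters H)"
  note L = heyting_generated_eq_upsets[OF fin]
  show iff: "evaluation H P \<subseteq> evaluation H Q \<longleftrightarrow> P \<subseteq> Q" if P: "P \<in> ?X" and Q: "Q \<in> ?X" for P Q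
  proof
    have "?r `` {P} \<in> heyting_generated H" unfolding L by (auto simp: inclusion_on_def)
    then have "?r `` {P} \<in> evaluation H P" using P by (simp add: evaluation_def inclusion_on_def)
    moreover assume "evaluation H P \<subseteq> evaluation H Q"
    ultimately have "?r `` {P} \<in> evaluation H Q" by blast
    then show "P \<subseteq> Q" by (simp add: evaluation_def inclusion_on_def)
  next
    assume "P \<subseteq> Q"
    then have "(P, Q) \<in> ?r" using P Q by (simp add: inclusion_on_def)
    then show "evaluation H P \<subseteq> evaluation H Q" unfolding evaluation_def L by blast
  qed
  have "inj_on (evaluation H) ?X"
  proof (rule inj_onI)
    fix P Q assume "P \<in> ?X" "Q \<in> ?X" "evaluation H P = evaluation H Q"
    then show "P = Q" using iff[of P Q] iff[of Q P] by blast
  qed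
  then show "bij_betw (evaluation H) ?X (prime_filters (star H))"
    using prime_filters_star[OF fin] by (simp add: bij_betw_def evaluation_def[abs_def])
qed

lemma evaluation_inclusion_iff:
  assumes "finite (hcarrier H)" "P \<in> irreducible_filters H" "Q \<in> irreducible_filters H"
  shows "(P, Q) \<in> inclusion_on (irreducible_filters H) \<longleftrightarrow>
    (evaluation H P, evaluation H Q) \<in> inclusion_on (prime_filters (star H))"
  using evaluation_iso(2)[OF assms] bij_betw_apply[OF evaluation_iso(1)[OF assms(1)]] assms(2,3)
  by (simp add: inclusion_on_def)

text \<open>In a finite algebra, membership of the elements in a prime filter amounts to finitely many open
  conditions, which determine the filter.\<close>

lemma X_heyting_discrete:
  assumes fin: "finite (hey_carrier A)"
  shows "os_top (X_heyting A) = discrete_topology (prime_filters A)"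
proof -
  let ?S = "{pphi A a | a. a \<in> hey_carrier A} \<union> {prime_filters A - pphi A a | a. a \<in> hey_carrier A}"
  let ?T = "topology_generated_by ?S"
  have top: "topspace ?T = prime_filters A"
  proof
    show "topspace ?T \<subseteq> prime_filters A" by (auto simp: pphi_def)
    have "F \<in> \<Union>?S" if "F \<in> prime_filters A" for F
    proof -
      have "hey_top A \<in> F" "F \<subseteq> hey_carrier A" using that by (auto simp: prime_filters_def)
      then have "F \<in> pphi A (hey_top A)" "hey_top A \<in> hey_carrier A" using that by (auto simp: pphi_def)
      then show ?thesis by blast
    qed
    then show "prime_filters A \<subseteq> topspace ?T" unfolding topology_generated_by_topspace by (rule subsetI)
  qed
  have "openin ?T {F}" if F: "F \<in> prime_filters A" for F
  proof -
    let ?K = "\<lambda>a. if a \<in> F then pphi A a else prime_filters A - pphi A a"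
    have "openin ?T ((\<Inter>a\<in>hey_carrier A. ?K a) \<inter> topspace ?T)"
    proof (rule openin_INT[OF fin])
      show "openin ?T (?K a)" if "a \<in> hey_carrier A" for a
        using that by (intro topology_generated_by_Basis) auto
    qed
    moreover have "(\<Inter>a\<in>hey_carrier A. ?K a) \<inter> topspace ?T = {F}"
    proof (intro equalityI subsetI)
      fix G assume G: "G \<in> (\<Inter>a\<in>hey_carrier A. ?K a) \<inter> topspace ?T"
      then have G': "G \<in> prime_filters A" unfolding top by blast
      have "a \<in> F \<longleftrightarrow> a \<in> G" if a: "a \<in> hey_carrier A" for a
      proof -
        have "G \<in> ?K a" using G a by blast
        then show ?thesis using G' by (cases "a \<in> F") (simp_all add: pphi_def)
      qed
      moreover have "F \<subseteq> hey_carrier A" "G \<subseteq> hey_carrier A" using F G' by (auto simp: prime_filters_def)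
      ultimately show "G \<in> {F}" by blast
    next
      fix G assume "G \<in> {F}"
      then show "G \<in> (\<Inter>a\<in>hey_carrier A. ?K a) \<inter> topspace ?T" using F unfolding top by (auto simp: pphi_def)
    qed
    ultimately show ?thesis by simp
  qed
  then have "discrete_topology (prime_filters A) = ?T"
    unfolding discrete_topology_unique using top by simp
  then show ?thesis by (simp add: X_heyting_def)
qed

lemma X_heyting_star:
  assumes H: "PHil0_obj H" and fin: "finite (hcarrier H)"
  shows "PEs_obj (X_heyting (star H))" "os_points (X_heyting (star H)) = prime_filters (star H)"
    "os_ord (X_heyting (star H)) = inclusion_on (prime_filters (star H))"
    "os_top (X_heyting (star H)) = discrete_topology (prime_filters (star H))"
    "finite (prime_filters (star H))"
proof -
  let ?X = "irreducible_filters H" and ?Y = "prime_filters (star H)"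
  have finX: "finite ?X" by (rule finite_irreducible_filters[OF fin])
  then have "finite (heyting_generated H)" unfolding heyting_generated_eq_upsets[OF fin] by simp
  then show top: "os_top (X_heyting (star H)) = discrete_topology ?Y"
    by (intro X_heyting_discrete) (simp add: star_def)
  show ord: "os_ord (X_heyting (star H)) = inclusion_on ?Y" by (simp add: X_heyting_def)
  show "os_points (X_heyting (star H)) = ?Y" by (simp add: top)
  show finY: "finite ?Y" using bij_betw_finite evaluation_iso(1)[OF fin] finX by blast
  have rsX: "root_system ?X (inclusion_on ?X)"
    by (rule irreducible_filters_root_system) (use H in \<open>simp add: PHil0_obj_def\<close>)
  have "root_system ?Y (inclusion_on ?Y)"
  proof (rule root_systemI[OF partial_order_on_inclusion_on])
    fix F G K assume FG: "(F, G) \<in> inclusion_on ?Y" and FK: "(F, K) \<in> inclusion_on ?Y"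
    have ev: "\<exists>P\<in>?X. Z = evaluation H P" if "Z \<in> ?Y" for Z
      using evaluation_iso(1)[OF fin] that unfolding bij_betw_def by blast
    obtain P Q R where PQR: "P \<in> ?X" "Q \<in> ?X" "R \<in> ?X"
      "F = evaluation H P" "G = evaluation H Q" "K = evaluation H R"
      using ev[of F] ev[of G] ev[of K] FG FK by (auto simp: inclusion_on_def)
    then have "(P, Q) \<in> inclusion_on ?X" "(P, R) \<in> inclusion_on ?X"
      using FG FK evaluation_iso(2)[OF fin] by (auto simp: inclusion_on_def)
    then have "(Q, R) \<in> inclusion_on ?X \<or> (R, Q) \<in> inclusion_on ?X" by (rule root_systemD(2)[OF rsX])
    then show "(G, K) \<in> inclusion_on ?Y \<or> (K, G) \<in> inclusion_on ?Y"
      using FG FK PQR evaluation_iso(2)[OF fin] by (auto simp: inclusion_on_def)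
  qed
  then have "PEs_obj \<lparr>os_top = discrete_topology ?Y, os_ord = inclusion_on ?Y\<rparr>"
    by (rule finite_PEs_objI[OF finY])
  moreover have "X_heyting (star H) = \<lparr>os_top = discrete_topology ?Y, os_ord = inclusion_on ?Y\<rparr>"
    using top ord by simp
  ultimately show "PEs_obj (X_heyting (star H))" by simp
qed


section \<open>Comparison of the two products\<close>

lemma staircases_image:
  assumes f: "bij_betw f A A'" "\<And>x y. x \<in> A \<Longrightarrow> y \<in> A \<Longrightarrow> (x, y) \<in> r \<longleftrightarrow> (f x, f y) \<in> r'"
    and g: "bij_betw g B B'" "\<And>x y. x \<in> B \<Longrightarrow> y \<in> B \<Longrightarrow> (x, y) \<in> s \<longleftrightarrow> (g x, g y) \<in> s'"
    and r': "r' \<subseteq> A' \<times> A'" and s': "s' \<subseteq> B' \<times> B'" and C: "C \<in> staircases r s A B"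
  shows "map_prod f g ` C \<in> staircases r' s' A' B'"
proof -
  have C': "C \<noteq> {}" "C \<subseteq> A \<times> B" "\<And>c d. c \<in> C \<Longrightarrow> d \<in> C \<Longrightarrow> (c, d) \<in> prod_ord r s \<or> (d, c) \<in> prod_ord r s"
    "r `` (fst ` C) \<subseteq> fst ` C" "s `` (snd ` C) \<subseteq> snd ` C"
    using C by (auto simp: staircases_def)
  have mono: "(map_prod f g c, map_prod f g d) \<in> prod_ord r' s'"
    if "c \<in> C" "d \<in> C" "(c, d) \<in> prod_ord r s" for c d
  proof -
    have "fst c \<in> A" "fst d \<in> A" "snd c \<in> B" "snd d \<in> B" using that(1,2) C'(2) by auto
    then show ?thesis using that(3) f(2) g(2) unfolding prod_ord_iff by simp
  qed
  have "map_prod f g ` C \<subseteq> A' \<times> B'"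
    using C'(2) bij_betw_apply[OF f(1)] bij_betw_apply[OF g(1)] by fastforce
  moreover have "c \<in> fst ` map_prod f g ` C" if c: "c \<in> r' `` (fst ` map_prod f g ` C)" for c
  proof -
    obtain x y where x: "(x, y) \<in> C" "(f x, c) \<in> r'" using c by force
    obtain z where z: "z \<in> A" "c = f z" using x(2) r' f(1) unfolding bij_betw_def by blast
    have "(x, z) \<in> r" using x z f(2)[of x z] C'(2) by blast
    then have "z \<in> fst ` C" using x(1) C'(4) by force
    then show ?thesis using z(2) by force
  qed
  moreover have "c \<in> snd ` map_prod f g ` C" if c: "c \<in> s' `` (snd ` map_prod f g ` C)" for c
  proof -
    obtain x y where y: "(x, y) \<in> C" "(g y, c) \<in> s'" using c by force
    obtain z where z: "z \<in> B" "c = g z" using y(2) s' g(1) unfolding bij_betw_def by blast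
    have "(y, z) \<in> s" using y z g(2)[of y z] C'(2) by blast
    then have "z \<in> snd ` C" using y(1) C'(5) by force
    then show ?thesis using z(2) by force
  qed
  moreover have "(c, d) \<in> prod_ord r' s' \<or> (d, c) \<in> prod_ord r' s'"
    if "c \<in> map_prod f g ` C" "d \<in> map_prod f g ` C" for c d
    using that C'(3) mono by (elim imageE) blast
  ultimately show ?thesis using C'(1) unfolding staircases_def by blast
qed

lemma staircases_bij:
  assumes f: "bij_betw f A A'" "\<And>x y. x \<in> A \<Longrightarrow> y \<in> A \<Longrightarrow> (x, y) \<in> r \<longleftrightarrow> (f x, f y) \<in> r'"
    and g: "bij_betw g B B'" "\<And>x y. x \<in> B \<Longrightarrow> y \<in> B \<Longrightarrow> (x, y) \<in> s \<longleftrightarrow> (g x, g y) \<in> s'"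
    and r: "r \<subseteq> A \<times> A" "r' \<subseteq> A' \<times> A'" and s: "s \<subseteq> B \<times> B" "s' \<subseteq> B' \<times> B'"
  shows "bij_betw (image (map_prod f g)) (staircases r s A B) (staircases r' s' A' B')"
proof (rule bij_betw_byWitness)
  let ?f = "inv_into A f" and ?g = "inv_into B g"
  have f': "bij_betw ?f A' A" "\<And>x. x \<in> A \<Longrightarrow> ?f (f x) = x" "\<And>x. x \<in> A' \<Longrightarrow> f (?f x) = x" "\<And>x. x \<in> A' \<Longrightarrow> ?f x \<in> A"
    using f(1) bij_betw_inv_into_left bij_betw_inv_into_right bij_betw_inv_into bij_betw_apply by metis+
  have g': "bij_betw ?g B' B" "\<And>x. x \<in> B \<Longrightarrow> ?g (g x) = x" "\<And>x. x \<in> B' \<Longrightarrow> g (?g x) = x" "\<And>x. x \<in> B' \<Longrightarrow> ?g x \<in> B"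
    using g(1) bij_betw_inv_into_left bij_betw_inv_into_right bij_betw_inv_into bij_betw_apply by metis+
  show "image (map_prod f g) ` staircases r s A B \<subseteq> staircases r' s' A' B'"
    using staircases_image[OF f g r(2) s(2)] by blast
  have "map_prod ?f ?g ` C \<in> staircases r s A B" if "C \<in> staircases r' s' A' B'" for C
    by (rule staircases_image[OF f'(1) _ g'(1) _ r(1) s(1) that])
      (use f(2) g(2) f'(3,4) g'(3,4) in auto)
  then show "image (map_prod ?f ?g) ` staircases r' s' A' B' \<subseteq> staircases r s A B" by blast
  show "\<forall>C\<in>staircases r s A B. map_prod ?f ?g ` map_prod f g ` C = C"
  proof
    fix C assume "C \<in> staircases r s A B"
    then have "C \<subseteq> A \<times> B" by (auto simp: staircases_def)
    then have "(map_prod ?f ?g \<circ> map_prod f g) ` C = id ` C" using f'(2) g'(2) by (intro image_cong) auto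
    then show "map_prod ?f ?g ` map_prod f g ` C = C" by (simp add: image_comp)
  qed
  show "\<forall>C\<in>staircases r' s' A' B'. map_prod f g ` map_prod ?f ?g ` C = C"
  proof
    fix C assume "C \<in> staircases r' s' A' B'"
    then have "C \<subseteq> A' \<times> B'" by (auto simp: staircases_def)
    then have "(map_prod f g \<circ> map_prod ?f ?g) ` C = id ` C" using f'(3) g'(3) by (intro image_cong) auto
    then show "map_prod f g ` map_prod ?f ?g ` C = C" by (simp add: image_comp)
  qed
qed

lemma bij_from_infinite_type:
  assumes "infinite (UNIV :: 'p set)" "finite W"
  shows "\<exists>(P :: 'p set) st. bij_betw st P W"
proof -
  obtain P :: "'p set" where "finite P" "card P = card W"
    using infinite_arbitrarily_large[OF assms(1)] by blast
  then show ?thesis using finite_same_card_bij assms(2) by blast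
qed

theorem theorem4:
  fixes H :: "'a bhilbert" and G :: "'b bhilbert"
  assumes "PHil0_obj H" and "finite (hcarrier H)"
    and "PHil0_obj G" and "finite (hcarrier G)"
    and "infinite (UNIV :: 'p set)" and "infinite (UNIV :: 'q set)"
  shows "(\<exists>(E :: 'p ordspace) p1 p2.
             PEs_product E p1 p2 (X_heyting (star H)) (X_heyting (star G))) \<and>
         (\<exists>(Q :: 'q hspace) R1 R2. PHS0_product Q R1 R2 (X_hilbert H) (X_hilbert G)) \<and>
         (\<forall>(E :: 'p ordspace) p1 p2 (Q :: 'q hspace) R1 R2.
             PEs_product E p1 p2 (X_heyting (star H)) (X_heyting (star G)) \<longrightarrow>
             PHS0_product Q R1 R2 (X_hilbert H) (X_hilbert G) \<longrightarrow>
             (\<exists>(\<tau> :: 'p topology) \<kappa>. topspace \<tau> = os_points E \<and>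
                PHS0_obj \<lparr>hs_top = \<tau>, hs_base = \<kappa>\<rparr> \<and>
                PHS0_isomorphic Q \<lparr>hs_top = \<tau>, hs_base = \<kappa>\<rparr>))"
proof -
  let ?X1 = "irreducible_filters H" and ?X2 = "irreducible_filters G"
  let ?Y1 = "prime_filters (star H)" and ?Y2 = "prime_filters (star G)"
  let ?W = "staircases (inclusion_on ?X1) (inclusion_on ?X2) ?X1 ?X2"
  let ?V = "staircases (inclusion_on ?Y1) (inclusion_on ?Y2) ?Y1 ?Y2"
  note H = X_hilbert[OF assms(1,2)] and G = X_hilbert[OF assms(3,4)]
  note H' = X_heyting_star[OF assms(1,2)] and G' = X_heyting_star[OF assms(3,4)]
  have fin: "finite ?X1" "finite ?X2" using finite_irreducible_filters assms by auto
  have "?W \<subseteq> Pow (?X1 \<times> ?X2)" by (auto simp: staircases_def)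
  then have finW: "finite ?W" using fin finite_subset by blast
  have WV: "bij_betw (image (map_prod (evaluation H) (evaluation G))) ?W ?V"
    by (rule staircases_bij[OF evaluation_iso(1)[OF assms(2)] evaluation_inclusion_iff[OF assms(2)]
          evaluation_iso(1)[OF assms(4)] evaluation_inclusion_iff[OF assms(4)]])
      (auto simp: inclusion_on_def)
  obtain P :: "'p set" and stP where P: "bij_betw stP P ?V"
    using bij_from_infinite_type[OF assms(5)] finW bij_betw_finite[OF WV] by blast
  obtain P' :: "'q set" and stP' where P': "bij_betw stP' P' ?W"
    using bij_from_infinite_type[OF assms(6)] finW by blast
  obtain E0 :: "'p ordspace" and e1 e2 where
    E0: "PEs_product E0 e1 e2 (X_heyting (star H)) (X_heyting (star G))" "os_points E0 = P"
    using staircase_PEs_product[OF H'(1) G'(1), of stP P] P H' G' by auto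
  obtain Q0 :: "'q hspace" and r1 r2 where
    Q0: "PHS0_product Q0 r1 r2 (X_hilbert H) (X_hilbert G)" "hs_points Q0 = P'"
    using staircase_PHS0_product[OF H(1) G(1), of stP' P'] P' H G fin by auto
  have "\<exists>(\<tau> :: 'p topology) \<kappa>. topspace \<tau> = os_points E \<and> PHS0_obj \<lparr>hs_top = \<tau>, hs_base = \<kappa>\<rparr> \<and>
      PHS0_isomorphic Q \<lparr>hs_top = \<tau>, hs_base = \<kappa>\<rparr>"
    if E: "PEs_product E p1 p2 (X_heyting (star H)) (X_heyting (star G))"
      and Q: "PHS0_product Q R1 R2 (X_hilbert H) (X_hilbert G)"
    for E :: "'p ordspace" and p1 p2 and Q :: "'q hspace" and R1 R2
  proof -
    \<comment> \<open>Both products are unique up to isomorphism. Thus the points of \<open>Q\<close> correspond to the staircases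
      of the spectra of \<open>H\<close> and \<open>G\<close>, and the points of \<open>E\<close> to those of the prime spectra.\<close>
    obtain b1 where "bij_betw b1 (hs_points Q) P'"
      using PHS0_isomorphic_points[OF PHS0_product_unique[OF Q Q0(1)]] Q0(2) by auto
    then have "bij_betw (stP' \<circ> b1) (hs_points Q) ?W" using P' bij_betw_trans by blast
    then have "bij_betw (image (map_prod (evaluation H) (evaluation G)) \<circ> (stP' \<circ> b1)) (hs_points Q) ?V"
      using WV bij_betw_trans by blast
    moreover have "bij_betw (inv_into P stP) ?V P" using P bij_betw_inv_into by blast
    moreover obtain b2 where "bij_betw b2 P (os_points E)"
      using PEs_product_bij_points[OF E0(1) E] E0(2) by auto
    ultimately obtain b where "bij_betw b (hs_points Q) (os_points E)"
      using bij_betw_trans by metis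
    moreover have "PHS0_obj Q" using Q by (simp add: PHS0_product_def)
    ultimately show ?thesis using PHS0_transport by blast
  qed
  then show ?thesis using E0(1) Q0(1) by blast
qed

end
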